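(* Let $0<\alpha<1$, $\gamma\ge0$ with $0<\alpha+\gamma\le1$, and consider one of the three Pearson diffusions (Ornstein-Uhlenbeck, Cox-Ingersoll-Ross, Jacobi) with state space $S$, Fokker-Planck operator $\mathcal{L}$, stationary density $\boldsymbol{m}$, eigenvalues $\lambda_n$ and orthonormal polynomials $Q_n$. Let $h$ be such that $h/\boldsymbol{m}\in L_2(\boldsymbol{m}(x)dx)$ and the series $\sum_n a_nQ_n$, where $a_n=\int_S h(y)Q_n(y)\,dy$, converges to $h/\boldsymbol{m}$ uniformly on finite intervals contained in $S$. Then the fractional Cauchy problem $$\mathcal{D}^{(\alpha,\gamma)}_t g(t,x)=\mathcal{L}g(t,x),\qquad g(0,x)=h(x)$$ has a strong solution given by $$g_{\alpha,\gamma}(t,x)=\boldsymbol{m}(x)\sum_{n=0}^{\infty}\operatorname{E}_{\alpha,1+\gamma/\alpha,\gamma/\alpha}\left(-\lambda_nt^{\alpha+\gamma}\right)Q_n(x)\,a_n .$$ The series converges absolutely for each fixed $t>0$, $x\in S$, and the equation of the Cauchy problem holds pointwise.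
   Context: For $0<\alpha<1$, $\gamma\ge0$: $\mathcal{D}^{(\alpha,\gamma)}_t f(t)=\frac{t^{-\gamma}}{\Gamma(1-\alpha)}\int_0^t\frac{f'(s)}{(t-s)^{\alpha}}\,ds$. Pearson diffusions: drift $\mu(x)$, diffusion coefficient $D(x)$, generator $\mathcal{G}g=\mu g'+Dg''$, Fokker-Planck operator $\mathcal{L}p=-(\mu p)'+(Dp)''$ (derivatives in the space variable). (OU) $S=\mathbb{R}$, $D(x)=\theta\sigma^2$, $\mu(x)=-\theta(x-\mu_0)$, $\theta,\sigma^2>0$, $\mu_0\in\mathbb{R}$; $\boldsymbol{m}(x)=\frac{1}{\sqrt{2\pi\sigma^2}}e^{-(x-\mu_0)^2/(2\sigma^2)}$; $\lambda_n=\theta n$ (Hermite polynomials). (CIR) $S=(0,\infty)$, $D(x)=\theta x/a$, $\mu(x)=-\theta(x-b/a)$, $\theta,a,b>0$; $\boldsymbol{m}(x)=\frac{a^b}{\Gamma(b)}x^{b-1}e^{-ax}$; $\lambda_n=\theta n$ (Laguerre polynomials $L_n^{b-1}(ax)$). (Jacobi) $S=(-1,1)$, $D(x)=1-x^2$, $\mu(x)=-(a+b+2)x+b-a$, $a,b>-1$; $\boldsymbol{m}(x)=\frac{(1-x)^a(1+x)^b}{B(a+1,b+1)2^{a+b+1}}$; $\lambda_n=n(n+a+b+1)$ (Jacobi polynomials $P_n^{(a,b)}$). In each case $Q_n$ is the corresponding degree-$n$ polynomial, $\mathcal{G}Q_n=-\lambda_nQ_n$, normalized so that $\int_S Q_nQ_k\boldsymbol{m}\,dx=\delta_{nk}$.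 Kilbas-Saigo function: for $a,m>0$, $l>-1/a$, $\operatorname{E}_{a,m,l}(z)=\sum_{n=0}^\infty c_n z^n$ with $c_0=1$ and $c_n=\prod_{k=0}^{n-1}\frac{\Gamma[1+a(km+l)]}{\Gamma[1+a(km+l+1)]}$. "Strong solution" means that the equation holds pointwise for $t>0$, $x\in S$, and the initial condition holds. *)

theory Defs
  imports "HOL-Analysis.Analysis"
begin

text \<open>
  Parameters: \<open>OU \<theta> \<mu>0 v\<close> (with \<open>v = \<sigma>\<^sup>2\<close>),
  \<open>CIR \<theta> a b\<close> and \<open>Jacobi a b\<close>.
\<close>

datatype pearson = OU real real real | CIR real real real | Jacobi real real

fun pearson_params :: "pearson \<Rightarrow> bool" where
  "pearson_params (OU \<theta> \<mu>0 v) \<longleftrightarrow> \<theta> > 0 \<and> v > 0"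
| "pearson_params (CIR \<theta> a b) \<longleftrightarrow> \<theta> > 0 \<and> a > 0 \<and> b > 0"
| "pearson_params (Jacobi a b) \<longleftrightarrow> a > -1 \<and> b > -1"

fun state_space :: "pearson \<Rightarrow> real set" where
  "state_space (OU \<theta> \<mu>0 v) = UNIV"
| "state_space (CIR \<theta> a b) = {0<..}"
| "state_space (Jacobi a b) = {-1<..<1}"

fun drift :: "pearson \<Rightarrow> real \<Rightarrow> real" where
  "drift (OU \<theta> \<mu>0 v) x = - \<theta> * (x - \<mu>0)"
| "drift (CIR \<theta> a b) x = - \<theta> * (x - b / a)"
| "drift (Jacobi a b) x = - (a + b + 2) * x + b - a"

fun diffusion :: "pearson \<Rightarrow> real \<Rightarrow> real" where
  "diffusion (OU \<theta> \<mu>0 v) x = \<theta> * v"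
| "diffusion (CIR \<theta> a b) x = \<theta> * x / a"
| "diffusion (Jacobi a b) x = 1 - x\<^sup>2"

fun stat_density :: "pearson \<Rightarrow> real \<Rightarrow> real" where
  "stat_density (OU \<theta> \<mu>0 v) x = 1 / sqrt (2 * pi * v) * exp (- (x - \<mu>0)\<^sup>2 / (2 * v))"
| "stat_density (CIR \<theta> a b) x = a powr b / Gamma b * x powr (b - 1) * exp (- a * x)"
| "stat_density (Jacobi a b) x =
     (1 - x) powr a * (1 + x) powr b / (Beta (a + 1) (b + 1) * 2 powr (a + b + 1))"

fun eigval :: "pearson \<Rightarrow> nat \<Rightarrow> real" where
  "eigval (OU \<theta> \<mu>0 v) n = \<theta> * real n"
| "eigval (CIR \<theta> a b) n = \<theta> * real n"
| "eigval (Jacobi a b) n = real n * (real n + a + b + 1)"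

definition generator :: "pearson \<Rightarrow> (real \<Rightarrow> real) \<Rightarrow> real \<Rightarrow> real" where
  "generator P f x = drift P x * deriv f x + diffusion P x * deriv (deriv f) x"

definition fokker_planck :: "pearson \<Rightarrow> (real \<Rightarrow> real) \<Rightarrow> real \<Rightarrow> real" where
  "fokker_planck P p x =
     - deriv (\<lambda>y. drift P y * p y) x + deriv (deriv (\<lambda>y. diffusion P y * p y)) x"

text \<open>
  The derivatives in \<^const>\<open>fokker_planck\<close> exist at every point of the (open) state space.
\<close>

definition fokker_planck_defined :: "pearson \<Rightarrow> (real \<Rightarrow> real) \<Rightarrow> bool" where
  "fokker_planck_defined P p \<longleftrightarrow> (\<forall>x\<in>state_space P.
     (\<lambda>y. drift P y * p y) differentiable at x \<and>
     (\<lambda>y. diffusion P y * p y) differentiable at x \<and>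
     deriv (\<lambda>y. diffusion P y * p y) differentiable at x)"

text \<open>
  These conditions determine each \<open>Q n\<close> up to its sign, as a multiple of a Hermite, Laguerre or
  Jacobi polynomial; the sign cancels in the products \<open>Q n x * fp_coeff P Q h n\<close> below.
\<close>

definition orthonormal_polys :: "pearson \<Rightarrow> (nat \<Rightarrow> real poly) \<Rightarrow> bool" where
  "orthonormal_polys P Q \<longleftrightarrow>
     (\<forall>n. degree (Q n) = n) \<and>
     (\<forall>n. \<forall>x\<in>state_space P. generator P (poly (Q n)) x = - eigval P n * poly (Q n) x) \<and>
     (\<forall>n k. (LINT x:state_space P|lebesgue. poly (Q n) x * poly (Q k) x * stat_density P x)
        = (if n = k then 1 else 0))"

definition stat_measure :: "pearson \<Rightarrow> real measure" where
  "stat_measure P = density (lebesgue_on (state_space P)) (\<lambda>x. ennreal (stat_density P x))"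

definition in_L2 :: "pearson \<Rightarrow> (real \<Rightarrow> real) \<Rightarrow> bool" where
  "in_L2 P f \<longleftrightarrow> f \<in> borel_measurable (stat_measure P) \<and> integrable (stat_measure P) (\<lambda>x. (f x)\<^sup>2)"

definition fp_coeff :: "pearson \<Rightarrow> (nat \<Rightarrow> real poly) \<Rightarrow> (real \<Rightarrow> real) \<Rightarrow> nat \<Rightarrow> real" where
  "fp_coeff P Q h n = (LINT y:state_space P|lebesgue. h y * poly (Q n) y)"

definition kilbas_saigo_coeff :: "real \<Rightarrow> real \<Rightarrow> real \<Rightarrow> nat \<Rightarrow> real" where
  "kilbas_saigo_coeff a m l n =
     (\<Prod>k<n. Gamma (1 + a * (real k * m + l)) / Gamma (1 + a * (real k * m + l + 1)))"

definition kilbas_saigo :: "real \<Rightarrow> real \<Rightarrow> real \<Rightarrow> real \<Rightarrow> real" where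
  "kilbas_saigo a m l z = (\<Sum>n. kilbas_saigo_coeff a m l n * z ^ n)"

text \<open>
  The integral of the fractional derivative is the Henstock-Kurzweil integral, which extends both
  the Lebesgue integral and its improper versions: the derivative of a solution with
  continuous initial data need not be absolutely integrable at \<open>0\<close>. The values of the integrand
  at the end points \<open>0\<close> and \<open>t\<close> are irrelevant.
\<close>

definition frac_integrand :: "real \<Rightarrow> (real \<Rightarrow> real) \<Rightarrow> real \<Rightarrow> real \<Rightarrow> real" where
  "frac_integrand \<alpha> f t s = deriv f s / (t - s) powr \<alpha>"

definition frac_deriv :: "real \<Rightarrow> real \<Rightarrow> (real \<Rightarrow> real) \<Rightarrow> real \<Rightarrow> real" where
  "frac_deriv \<alpha> \<gamma> f t = t powr (- \<gamma>) / Gamma (1 - \<alpha>) * integral {0..t} (frac_integrand \<alpha> f t)"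

text \<open>
  Continuity on \<open>[0,\<infinity>)\<close> ties the initial value, which enters \<^const>\<open>frac_deriv\<close> only through
  \<open>f'\<close>, to the values at positive times.
\<close>

definition frac_deriv_defined :: "real \<Rightarrow> (real \<Rightarrow> real) \<Rightarrow> bool" where
  "frac_deriv_defined \<alpha> f \<longleftrightarrow>
     continuous_on {0..} f \<and>
     (\<forall>t>0. f differentiable at t \<and> frac_integrand \<alpha> f t integrable_on {0..t})"

definition strong_solution ::
    "real \<Rightarrow> real \<Rightarrow> pearson \<Rightarrow> (real \<Rightarrow> real) \<Rightarrow> (real \<Rightarrow> real \<Rightarrow> real) \<Rightarrow> bool" where
  "strong_solution \<alpha> \<gamma> P h g \<longleftrightarrow>
     (\<forall>x\<in>state_space P. g 0 x = h x) \<and>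
     (\<forall>x\<in>state_space P. frac_deriv_defined \<alpha> (\<lambda>t. g t x)) \<and>
     (\<forall>t>0. fokker_planck_defined P (g t)) \<and>
     (\<forall>t>0. \<forall>x\<in>state_space P. frac_deriv \<alpha> \<gamma> (\<lambda>s. g s x) t = fokker_planck P (g t) x)"

definition sol_term ::
    "real \<Rightarrow> real \<Rightarrow> pearson \<Rightarrow> (nat \<Rightarrow> real poly) \<Rightarrow> (real \<Rightarrow> real) \<Rightarrow> real \<Rightarrow> real \<Rightarrow> nat \<Rightarrow> real" where
  "sol_term \<alpha> \<gamma> P Q h t x n =
     kilbas_saigo \<alpha> (1 + \<gamma> / \<alpha>) (\<gamma> / \<alpha>) (- eigval P n * t powr (\<alpha> + \<gamma>))
       * poly (Q n) x * fp_coeff P Q h n"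

definition sol_series ::
    "real \<Rightarrow> real \<Rightarrow> pearson \<Rightarrow> (nat \<Rightarrow> real poly) \<Rightarrow> (real \<Rightarrow> real) \<Rightarrow> real \<Rightarrow> real \<Rightarrow> real" where
  "sol_series \<alpha> \<gamma> P Q h t x = stat_density P x * (\<Sum>n. sol_term \<alpha> \<gamma> P Q h t x n)"

end

theory Submission
  imports Defs
begin

text \<open>
  Put \<open>\<beta> = \<alpha> + \<gamma>\<close> and let \<open>F z\<close> be the Kilbas-Saigo function at \<open>-z\<close>. Applied to
  \<open>G(t\<^sup>\<beta>)\<close> with \<open>G\<close> an entire power series, the fractional derivative shifts the coefficients,
  so \<open>t \<mapsto> F(\<lambda> t\<^sup>\<beta>)\<close> is an eigenfunction. At a minimum attained at \<open>t > 0\<close> the Caputo integral is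
  negative unless the minimum equals the initial value; this minimum principle, applied to \<open>F\<close>,
  \<open>-z F'\<close> and \<open>z\<^sup>2 F''\<close>, shows that \<open>F\<close> is nonnegative, decreasing and convex, whence
  \<open>F z\<close> and \<open>\<bar>z F' z\<bar>\<close> are \<open>O(1 / (1 + z))\<close>.

  A local elliptic estimate for \<open>\<G>\<close> bounds \<open>\<Sum>n. Q\<^sub>n(x)\<^sup>2 / (1 + \<lambda>\<^sub>n\<^sup>2)\<close> on compact sets, without any
  asymptotics of the classical polynomials. Together with Bessel's inequality and Cauchy-Schwarz
  this makes the series for the solution and for its time derivative converge absolutely,
  uniformly for \<open>t\<close> away from \<open>0\<close>. Since \<open>F(\<lambda>\<^sub>n t\<^sup>\<beta>)\<close> decreases in \<open>n\<close>, Abel's test gives uniform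
  convergence of the solution series down to \<open>t = 0\<close>. The Caputo integral is continuous under
  these two convergences (integrate by parts near \<open>0\<close>), hence the series of the \<open>\<G>\<close>-images converges
  locally uniformly too, and so the solution is \<open>C\<^sup>2\<close> in \<open>x\<close> and solves the equation.
\<close>

section \<open>The Caputo integral\<close>

text \<open>The obstacle is the series of the \<G>-images. Applying \<G> costs a factor
  \<open>\<lambda>_n\<close>, and for fixed \<open>t\<close> the product
  \<open>\<lambda>_n * F(\<lambda>_n t^\<beta>)\<close> is merely bounded, whereas Cauchy-Schwarz
  against the kernel sum needs the decay \<open>1 / (1 + \<lambda>_n)\<close>. The time derivative
  does not pay this price: \<open>s * d/ds F(\<lambda> s^\<beta>)\<close> equals
  \<open>\<beta> * (z * F' z)\<close> at \<open>z = \<lambda> s^\<beta>\<close>, and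
  \<open>z * F' z\<close> decays as fast as \<open>F z\<close>. So regularity in space is bought on
  the time side: on partial sums \<G> is the Caputo integral up to a factor depending on
  \<open>t\<close> only, and that integral passes to the limit. The passage requires uniform
  convergence of the solution series down to time \<open>0\<close>; square summability of the
  coefficients does not give it, and the locally uniform convergence of the initial expansion does.

  The decay of \<open>F\<close> is read off the equation itself, since \<open>z * F z\<close> is, up
  to a constant, a Caputo integral with bounds independent of \<open>z\<close>. Convexity then
  carries the decay over from \<open>F\<close> to \<open>z * F' z\<close>.\<close>

lemma kernel_has_derivative:
  fixes r t s :: real
  assumes "s < t"
  shows "((\<lambda>s. (t - s) powr r) has_real_derivative - r * (t - s) powr (r - 1)) (at s)"
proof -
  have "((\<lambda>z. z powr r) has_real_derivative r * (t - s) powr (r - 1)) (at (t - s))"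
    using assms by (intro has_real_derivative_powr) auto
  moreover have "((\<lambda>s. t - s) has_real_derivative - 1) (at s)"
    by (auto intro!: derivative_eq_intros)
  ultimately show ?thesis using DERIV_chain2 by fastforce
qed

lemma integral_kernel:
  fixes \<alpha> a t :: real
  assumes "\<alpha> < 1" "a \<le> t"
  shows "((\<lambda>s. 1 / (t - s) powr \<alpha>) has_integral (t - a) powr (1 - \<alpha>) / (1 - \<alpha>)) {a..t}"
proof -
  have "((\<lambda>s. 1 / (t - s) powr \<alpha>) has_integral
      - ((t - t) powr (1 - \<alpha>) / (1 - \<alpha>)) - - ((t - a) powr (1 - \<alpha>) / (1 - \<alpha>))) {a..t}"
  proof (rule fundamental_theorem_of_calculus_interior[OF assms(2)])
    show "continuous_on {a..t} (\<lambda>s. - ((t - s) powr (1 - \<alpha>) / (1 - \<alpha>)))"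
      using assms by (intro continuous_intros continuous_on_powr') auto
    fix s assume s: "s \<in> {a<..<t}"
    have "((\<lambda>s. - ((t - s) powr (1 - \<alpha>) / (1 - \<alpha>))) has_real_derivative
        - (- (1 - \<alpha>) * (t - s) powr (1 - \<alpha> - 1) / (1 - \<alpha>))) (at s)"
      using s by (intro DERIV_minus DERIV_cdivide kernel_has_derivative) auto
    moreover have "- (- (1 - \<alpha>) * (t - s) powr (1 - \<alpha> - 1) / (1 - \<alpha>)) = 1 / (t - s) powr \<alpha>"
      using assms by (simp add: powr_minus_divide minus_divide_left)
    ultimately show "((\<lambda>s. - ((t - s) powr (1 - \<alpha>) / (1 - \<alpha>))) has_vector_derivative
        1 / (t - s) powr \<alpha>) (at s)"
      by (simp only: has_real_derivative_iff_has_vector_derivative)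
  qed
  then show ?thesis by simp
qed

text \<open>The derivative may be unbounded at \<open>0\<close>, while for \<open>\<tau> < t\<close>
  the kernel is smooth on \<open>{0..\<tau>}\<close>. Moving the derivative onto the kernel leaves
  an integral that sees only the continuous \<open>f\<close>.\<close>

lemma kernel_by_parts:
  fixes f f' :: "real \<Rightarrow> real"
  assumes "0 \<le> \<tau>" "\<tau> < t"
    and cont: "continuous_on {0..\<tau>} f"
    and deriv: "\<And>s. s \<in> {0<..<\<tau>} \<Longrightarrow> (f has_real_derivative f' s) (at s)"
  shows "((\<lambda>s. f' s / (t - s) powr \<alpha>) has_integral
    f \<tau> * (t - \<tau>) powr (-\<alpha>) - f 0 * t powr (-\<alpha>)
      - integral {0..\<tau>} (\<lambda>s. f s * (\<alpha> * (t - s) powr (-\<alpha>-1)))) {0..\<tau>}"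
    and "(\<lambda>s. f s * (\<alpha> * (t - s) powr (-\<alpha>-1))) integrable_on {0..\<tau>}"
proof -
  have c: "continuous_on {0..\<tau>} (\<lambda>s. f s * (\<alpha> * (t - s) powr (-\<alpha>-1)))"
    using assms(1,2) by (intro continuous_intros cont) auto
  then show int: "(\<lambda>s. f s * (\<alpha> * (t - s) powr (-\<alpha>-1))) integrable_on {0..\<tau>}"
    by (rule integrable_continuous_real)
  have "((\<lambda>s. f' s * (t - s) powr (-\<alpha>)) has_integral
    f \<tau> * (t - \<tau>) powr (-\<alpha>) - f 0 * t powr (-\<alpha>)
      - integral {0..\<tau>} (\<lambda>s. f s * (\<alpha> * (t - s) powr (-\<alpha>-1)))) {0..\<tau>}"
  proof (rule integration_by_parts_interior[OF bounded_bilinear_mult assms(1) cont])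
    show "continuous_on {0..\<tau>} (\<lambda>s. (t - s) powr (-\<alpha>))"
      using assms(1,2) by (intro continuous_intros) auto
    show "((\<lambda>s. (t - s) powr - \<alpha>) has_vector_derivative \<alpha> * (t - s) powr (- \<alpha> - 1)) (at s)"
      if "s \<in> {0<..<\<tau>}" for s
      unfolding has_real_derivative_iff_has_vector_derivative[symmetric]
      using kernel_has_derivative[of s t "-\<alpha>"] that assms(2) by simp
    show "(f has_vector_derivative f' s) (at s)" if "s \<in> {0<..<\<tau>}" for s
      unfolding has_real_derivative_iff_has_vector_derivative[symmetric]
      using that by (rule deriv)
  qed (use int in \<open>simp add: has_integral_integral\<close>)
  then show "((\<lambda>s. f' s / (t - s) powr \<alpha>) has_integral
    f \<tau> * (t - \<tau>) powr (-\<alpha>) - f 0 * t powr (-\<alpha>)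
      - integral {0..\<tau>} (\<lambda>s. f s * (\<alpha> * (t - s) powr (-\<alpha>-1)))) {0..\<tau>}"
    by (simp add: powr_minus divide_inverse)
qed

text \<open>The two ends differ: \<open>f'\<close> may blow up at \<open>0\<close>, and the kernel
  is singular at \<open>t\<close>. Continuity of \<open>f'\<close> is therefore asked on
  \<open>{t/2..t}\<close>, where it meets the singular kernel; near \<open>0\<close> continuity of
  \<open>f\<close> takes over.\<close>

definition caputo_regular :: "real \<Rightarrow> (real \<Rightarrow> real) \<Rightarrow> (real \<Rightarrow> real) \<Rightarrow> bool" where
  "caputo_regular t f f' \<longleftrightarrow> continuous_on {0..t} f \<and> continuous_on {t/2..t} f' \<and>
     (\<forall>s\<in>{0<..t}. (f has_real_derivative f' s) (at s))"

lemma caputo_regular_diff: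
  assumes "caputo_regular t f f'" "caputo_regular t g g'"
  shows "caputo_regular t (\<lambda>s. f s - g s) (\<lambda>s. f' s - g' s)"
  using assms unfolding caputo_regular_def by (auto intro!: continuous_intros derivative_intros)

text \<open>On \<open>{0..t/2}\<close> integration by parts produces three terms, each at most
  \<open>A * (t/2) powr (-\<alpha>)\<close>; on \<open>{t/2..t}\<close> the bound \<open>B\<close>
  is integrated against the kernel. Being linear in \<open>A\<close> and \<open>B\<close>, the
  estimate turns uniform convergence into convergence of the integrals.\<close>

lemma caputo_bound:
  fixes f f' :: "real \<Rightarrow> real"
  assumes "0 < \<alpha>" "\<alpha> < 1" "0 < t"
    and reg: "caputo_regular t f f'"
    and A: "\<And>s. s \<in> {0..t} \<Longrightarrow> \<bar>f s\<bar> \<le> A"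
    and B: "\<And>s. s \<in> {t/2..t} \<Longrightarrow> \<bar>f' s\<bar> \<le> B"
  shows "(\<lambda>s. f' s / (t - s) powr \<alpha>) integrable_on {0..t}"
    and "\<bar>integral {0..t} (\<lambda>s. f' s / (t - s) powr \<alpha>)\<bar>
      \<le> 3 * A * (t/2) powr (-\<alpha>) + B * (t/2) powr (1 - \<alpha>) / (1 - \<alpha>)"
proof -
  let ?w = "\<lambda>s. f' s / (t - s) powr \<alpha>"
  let ?k = "\<lambda>s. f s * (\<alpha> * (t - s) powr (-\<alpha>-1))"
  let ?m = "(t/2) powr (-\<alpha>)"
  have cf: "continuous_on {0..t/2} f" and df: "\<And>s. s \<in> {0<..<t/2} \<Longrightarrow> (f has_real_derivative f' s) (at s)"
    using reg \<open>0 < t\<close> unfolding caputo_regular_def by (auto intro: continuous_on_subset)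
  have A0: "0 \<le> A" using A[of 0] \<open>0 < t\<close> by force
  note p = kernel_by_parts[OF _ _ cf df, of t \<alpha>]
  have p1: "(?w has_integral f (t/2) * ?m - f 0 * t powr (-\<alpha>) - integral {0..t/2} ?k) {0..t/2}"
    using p(1) \<open>0 < t\<close> by simp
  have "norm (integral {0..t/2} ?k) \<le> A * (t/2) powr (-\<alpha>-1) * (t/2 - 0)"
  proof (rule integral_bound)
    show "continuous_on {0..t/2} ?k" using cf \<open>0 < t\<close> by (intro continuous_intros) auto
    fix s assume s: "s \<in> {0..t/2}"
    have "\<alpha> * (t - s) powr (-\<alpha>-1) \<le> 1 * (t/2) powr (-\<alpha>-1)"
      using s assms by (intro mult_mono powr_mono2') auto
    then show "norm (?k s) \<le> A * (t/2) powr (-\<alpha>-1)"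
      using A[of s] s assms(1,3) A0 by (auto simp: abs_mult intro!: mult_mono)
  qed (use \<open>0 < t\<close> in auto)
  also have "\<dots> = A * ?m" using \<open>0 < t\<close> by (simp add: powr_diff)
  finally have k: "\<bar>integral {0..t/2} ?k\<bar> \<le> A * ?m" by simp
  have "\<bar>f (t/2) * ?m\<bar> \<le> A * ?m" using A[of "t/2"] \<open>0 < t\<close> by (auto simp: abs_mult intro!: mult_right_mono)
  moreover have "\<bar>f 0 * t powr (-\<alpha>)\<bar> \<le> A * ?m" unfolding abs_mult
    using A[of 0] A0 \<open>0 < t\<close> assms by (intro mult_mono) (auto intro: powr_mono2')
  ultimately have b1: "\<bar>integral {0..t/2} ?w\<bar> \<le> 3 * A * ?m"
    using k integral_unique[OF p1] by linarith
  have int2: "(\<lambda>s. B * (1 / (t - s) powr \<alpha>)) integrable_on {t/2..t}"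
    using integral_kernel[of \<alpha> "t/2" t] assms by (intro integrable_on_mult_right) (auto simp: integrable_on_def)
  have i2: "?w integrable_on {t/2..t}"
  proof (rule measurable_bounded_by_integrable_imp_integrable)
    have "f' \<in> borel_measurable (lebesgue_on {t/2..t})"
      using reg by (auto simp: caputo_regular_def intro!: continuous_imp_measurable_on_sets_lebesgue)
    moreover have "(\<lambda>s. (t - s) powr \<alpha>) \<in> borel_measurable (lebesgue_on {t/2..t})"
      using assms by (intro continuous_imp_measurable_on_sets_lebesgue continuous_intros continuous_on_powr') auto
    ultimately show "?w \<in> borel_measurable (lebesgue_on {t/2..t})" by measurable
    \<comment> \<open>At \<open>s = t\<close> both sides are \<open>0\<close>, since
      \<open>0 powr \<alpha> = 0\<close> and division by \<open>0\<close> gives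
      \<open>0\<close>.\<close>
    show "norm (?w s) \<le> B * (1 / (t - s) powr \<alpha>)" if "s \<in> {t/2..t}" for s
      using B[OF that] by (auto simp: intro!: divide_right_mono)
  qed (use int2 in auto)
  have b2: "\<bar>integral {t/2..t} ?w\<bar> \<le> B * (t/2) powr (1 - \<alpha>) / (1 - \<alpha>)"
  proof -
    have "norm (integral {t/2..t} ?w) \<le> integral {t/2..t} (\<lambda>s. B * (1 / (t - s) powr \<alpha>))"
    proof (rule integral_norm_bound_integral[OF i2 int2])
      show "norm (?w s) \<le> B * (1 / (t - s) powr \<alpha>)" if "s \<in> {t/2..t}" for s
        using B[OF that] by (auto simp: intro!: divide_right_mono)
    qed
    also have "\<dots> = B * ((t/2) powr (1 - \<alpha>) / (1 - \<alpha>))"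
      using integral_unique[OF integral_kernel[of \<alpha> "t/2" t]] assms by (subst integral_mult_right) simp_all
    finally show ?thesis by simp
  qed
  have comb: "(?w has_integral integral {0..t/2} ?w + integral {t/2..t} ?w) {0..t}"
    by (rule has_integral_combine[of 0 "t/2"]) (use p1 i2 \<open>0 < t\<close> in \<open>auto simp: has_integral_integral integrable_on_def\<close>)
  then show "?w integrable_on {0..t}" by blast
  show "\<bar>integral {0..t} ?w\<bar> \<le> 3 * A * ?m + B * (t/2) powr (1 - \<alpha>) / (1 - \<alpha>)"
    using integral_unique[OF comb] b1 b2 by linarith
qed

lemma caputo_integrable:
  assumes "0 < \<alpha>" "\<alpha> < 1" "0 < t" "caputo_regular t f f'"
  shows "(\<lambda>s. f' s / (t - s) powr \<alpha>) integrable_on {0..t}"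
proof -
  have "compact (f ` {0..t})" "compact (f' ` {t/2..t})"
    using assms by (auto simp: caputo_regular_def intro!: compact_continuous_image)
  then obtain A B where "\<And>s. s \<in> {0..t} \<Longrightarrow> \<bar>f s\<bar> \<le> A" "\<And>s. s \<in> {t/2..t} \<Longrightarrow> \<bar>f' s\<bar> \<le> B"
    by (metis (no_types, opaque_lifting) bounded_iff compact_imp_bounded image_eqI real_norm_def)
  with assms show ?thesis by (intro caputo_bound(1)) 
qed

text \<open>\<open>caputo_bound\<close> applied to differences. The parameter \<open>x\<close> is
  carried along because differentiating the solution series in space will require a limit that is
  uniform in space.\<close>

lemma caputo_uniform_limit:
  fixes u u' :: "nat \<Rightarrow> 'a \<Rightarrow> real \<Rightarrow> real"
  assumes "0 < \<alpha>" "\<alpha> < 1" "0 < t"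
    and reg: "\<And>N x. x \<in> X \<Longrightarrow> caputo_regular t (u N x) (u' N x)"
      "\<And>x. x \<in> X \<Longrightarrow> caputo_regular t (v x) (v' x)"
    and lim: "uniform_limit (X \<times> {0..t}) (\<lambda>N (x, s). u N x s) (\<lambda>(x, s). v x s) sequentially"
    and lim': "uniform_limit (X \<times> {t/2..t}) (\<lambda>N (x, s). u' N x s) (\<lambda>(x, s). v' x s) sequentially"
  shows "uniform_limit X (\<lambda>N x. integral {0..t} (\<lambda>s. u' N x s / (t - s) powr \<alpha>))
    (\<lambda>x. integral {0..t} (\<lambda>s. v' x s / (t - s) powr \<alpha>)) sequentially"
proof (rule uniform_limitI)
  fix e :: real assume "0 < e"
  \<comment> \<open>\<open>K\<close> is the bound of \<open>caputo_bound\<close> for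
    \<open>A = B = 1\<close>.\<close>
  define K where "K = 3 * (t/2) powr (-\<alpha>) + (t/2) powr (1 - \<alpha>) / (1 - \<alpha>)"
  have K: "0 < K" using assms(1-3) by (auto simp: K_def intro!: add_pos_nonneg)
  define d where "d = e / (2 * K)"
  have d: "0 < d" using K \<open>0 < e\<close> by (simp add: d_def)
  from uniform_limitD[OF lim d] uniform_limitD[OF lim' d]
  show "\<forall>\<^sub>F N in sequentially. \<forall>x\<in>X. dist (integral {0..t} (\<lambda>s. u' N x s / (t - s) powr \<alpha>))
      (integral {0..t} (\<lambda>s. v' x s / (t - s) powr \<alpha>)) < e"
  proof eventually_elim
    case (elim N)
    show ?case
    proof
      fix x assume x: "x \<in> X"
      have "integral {0..t} (\<lambda>s. u' N x s / (t - s) powr \<alpha>) - integral {0..t} (\<lambda>s. v' x s / (t - s) powr \<alpha>)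
          = integral {0..t} (\<lambda>s. (u' N x s - v' x s) / (t - s) powr \<alpha>)"
        by (subst integral_diff[symmetric])
          (use assms(1-3) reg x in \<open>auto intro!: caputo_integrable simp: diff_divide_distrib\<close>)
      also have "\<bar>\<dots>\<bar> \<le> 3 * d * (t/2) powr (-\<alpha>) + d * (t/2) powr (1 - \<alpha>) / (1 - \<alpha>)"
        by (rule caputo_bound(2)[OF assms(1-3) caputo_regular_diff[OF reg(1) reg(2)]])
           (use elim x in \<open>fastforce simp: dist_real_def less_imp_le\<close>)+
      also have "\<dots> = d * K" by (simp add: K_def algebra_simps)
      also have "\<dots> < e" using K \<open>0 < e\<close> by (simp add: d_def)
      finally show "dist (integral {0..t} (\<lambda>s. u' N x s / (t - s) powr \<alpha>))
          (integral {0..t} (\<lambda>s. v' x s / (t - s) powr \<alpha>)) < e" by (simp add: dist_real_def)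
    qed
  qed
qed

text \<open>Integrating by parts on \<open>[0,\<tau>]\<close> gives a kernel of constant sign; the boundary term at
  \<open>\<tau> \<rightarrow> t\<close> vanishes because \<open>f\<close> is differentiable at \<open>t\<close> and \<open>\<alpha> < 1\<close>.\<close>

lemma caputo_at_minimum:
  assumes "0 < \<alpha>" "\<alpha> < 1" "0 < t"
    and reg: "caputo_regular t f f'"
    and min: "\<And>s. s \<in> {0..t} \<Longrightarrow> f t \<le> f s"
  shows "integral {0..t} (\<lambda>s. f' s / (t - s) powr \<alpha>) \<le> (f t - f 0) * t powr (-\<alpha>)"
proof -
  let ?w = "\<lambda>s. f' s / (t - s) powr \<alpha>"
  define \<psi> where "\<psi> s = f s - f t" for s
  have d: "(\<psi> has_real_derivative f' s) (at s)" if "s \<in> {0<..t}" for s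
    using reg that unfolding caputo_regular_def \<psi>_def by (auto intro!: derivative_eq_intros)
  have c: "continuous_on {0..t} \<psi>"
    using reg unfolding caputo_regular_def \<psi>_def by (auto intro!: continuous_intros)
  have int: "?w integrable_on {0..t}" by (rule caputo_integrable[OF assms(1-4)])
  have le: "integral {0..\<tau>} ?w \<le> \<psi> \<tau> * (t - \<tau>) powr (-\<alpha>) - \<psi> 0 * t powr (-\<alpha>)"
    if \<tau>: "0 \<le> \<tau>" "\<tau> < t" for \<tau>
  proof -
    have c': "continuous_on {0..\<tau>} \<psi>" using c by (rule continuous_on_subset) (use \<tau> in auto)
    have d': "(\<psi> has_real_derivative f' s) (at s)" if "s \<in> {0<..<\<tau>}" for s
      using d that \<tau> by auto
    have "0 \<le> integral {0..\<tau>} (\<lambda>s. \<psi> s * (\<alpha> * (t - s) powr (-\<alpha>-1)))"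
      by (rule integral_nonneg[OF kernel_by_parts(2)[OF \<tau> c' d']])
         (use \<tau> min assms(1) in \<open>auto simp: \<psi>_def\<close>)
    then show ?thesis using integral_unique[OF kernel_by_parts(1)[OF \<tau> c' d', of \<alpha>]] by linarith
  qed
  have "((\<lambda>\<tau>. integral {0..\<tau>} ?w) \<longlongrightarrow> integral {0..t} ?w) (at t within {0..t})"
    using indefinite_integral_continuous_1[OF int] \<open>0 < t\<close> by (simp add: continuous_on)
  then have L1: "((\<lambda>\<tau>. integral {0..\<tau>} ?w) \<longlongrightarrow> integral {0..t} ?w) (at_left t)"
    using \<open>0 < t\<close> by (simp add: at_within_Icc_at_left)
  have q: "((\<lambda>\<tau>. (\<psi> \<tau> - \<psi> t) / (\<tau> - t)) \<longlongrightarrow> f' t) (at_left t)"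
    using d[of t] \<open>0 < t\<close> unfolding has_field_derivative_iff
    by (auto intro: filterlim_mono simp: at_le)
  have r: "((\<lambda>\<tau>. (t - \<tau>) powr (1 - \<alpha>)) \<longlongrightarrow> 0) (at_left t)"
  proof -
    have "((\<lambda>\<tau>. (t - \<tau>) powr (1 - \<alpha>)) \<longlongrightarrow> (t - t) powr (1 - \<alpha>)) (at_left t)"
      using assms by (intro tendsto_powr' tendsto_intros) (auto simp: eventually_at_filter)
    then show ?thesis by simp
  qed
  have "((\<lambda>\<tau>. - ((\<psi> \<tau> - \<psi> t) / (\<tau> - t) * (t - \<tau>) powr (1 - \<alpha>))) \<longlongrightarrow> - (f' t * 0)) (at_left t)"
    by (intro tendsto_intros q r)
  moreover have "\<forall>\<^sub>F \<tau> in at_left t. - ((\<psi> \<tau> - \<psi> t) / (\<tau> - t) * (t - \<tau>) powr (1 - \<alpha>))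
      = \<psi> \<tau> * (t - \<tau>) powr (-\<alpha>)"
  proof (rule eventually_at_leftI[of 0])
    fix \<tau> assume "\<tau> \<in> {0<..<t}"
    then have "(t - \<tau>) powr (1 - \<alpha>) = (t - \<tau>) * (t - \<tau>) powr (-\<alpha>)" "t - \<tau> \<noteq> 0" "\<tau> - t \<noteq> 0"
      by (simp_all add: powr_diff powr_minus divide_inverse)
    then show "- ((\<psi> \<tau> - \<psi> t) / (\<tau> - t) * (t - \<tau>) powr (1 - \<alpha>)) = \<psi> \<tau> * (t - \<tau>) powr (-\<alpha>)"
      by (simp add: \<psi>_def divide_simps) (simp add: algebra_simps)
  qed fact
  ultimately have "((\<lambda>\<tau>. \<psi> \<tau> * (t - \<tau>) powr (-\<alpha>)) \<longlongrightarrow> 0) (at_left t)"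
    by (simp add: tendsto_cong)
  then have L2: "((\<lambda>\<tau>. \<psi> \<tau> * (t - \<tau>) powr (-\<alpha>) - \<psi> 0 * t powr (-\<alpha>)) \<longlongrightarrow> 0 - \<psi> 0 * t powr (-\<alpha>)) (at_left t)"
    by (intro tendsto_intros)
  have "integral {0..t} ?w \<le> 0 - \<psi> 0 * t powr (-\<alpha>)"
    by (rule tendsto_le[OF _ L2 L1]) (auto intro!: eventually_at_leftI[of 0] le simp: \<open>0 < t\<close>)
  then show ?thesis by (simp add: \<psi>_def algebra_simps)
qed

section \<open>The Kilbas-Saigo function\<close>

text \<open>The substitution \<open>s = t * u\<close> leads to Euler's integral
  \<open>r * Beta r (1 - \<alpha>)\<close>, and \<open>r * Gamma r = Gamma (1 + r)\<close>.\<close>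

lemma caputo_powr:
  fixes r t :: real
  assumes "0 < r" "0 < t" "\<alpha> < 1"
  shows "((\<lambda>s. r * s powr (r - 1) / (t - s) powr \<alpha>) has_integral
    Gamma (1 - \<alpha>) * (Gamma (1 + r) / Gamma (1 + r - \<alpha>)) * t powr (r - \<alpha>)) {0..t}"
proof -
  let ?f = "\<lambda>x. x powr (r - 1) * (1 - x) powr (1 - \<alpha> - 1)"
  have "(?f has_integral Beta r (1 - \<alpha>)) (cbox 0 1)"
    using has_integral_Beta_real[of r "1 - \<alpha>"] assms by simp
  from has_integral_affinity'[OF this, of "1 / t" 0]
  have "((\<lambda>s. ?f (s / t)) has_integral (t * Beta r (1 - \<alpha>))) {0..t}"
    using assms by simp
  then have "((\<lambda>s. r * t powr (r - 1 - \<alpha>) * ?f (s / t)) has_integral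
      (r * t powr (r - 1 - \<alpha>) * (t * Beta r (1 - \<alpha>)))) {0..t}"
    by (rule has_integral_mult_right)
  moreover have "r * t powr (r - 1 - \<alpha>) * ?f (s / t) = r * s powr (r - 1) / (t - s) powr \<alpha>"
    if "s \<in> {0..t}" for s
  proof -
    have "1 - s / t = (t - s) / t" using assms by (simp add: field_simps)
    then have "?f (s / t) = s powr (r - 1) / t powr (r - 1) * ((t - s) powr (-\<alpha>) / t powr (-\<alpha>))"
      using that assms by (simp add: powr_divide)
    moreover have "t powr (r - 1 - \<alpha>) = t powr (r - 1) * t powr (-\<alpha>)"
      by (simp add: powr_add[symmetric])
    ultimately show ?thesis
      using assms by (simp add: powr_minus_divide[of "t - s"])
  qed
  moreover have "r * t powr (r - 1 - \<alpha>) * (t * Beta r (1 - \<alpha>))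
      = Gamma (1 - \<alpha>) * (Gamma (1 + r) / Gamma (1 + r - \<alpha>)) * t powr (r - \<alpha>)"
  proof -
    have "r \<notin> \<int>\<^sub>\<le>\<^sub>0" using \<open>0 < r\<close> by (auto elim!: nonpos_Ints_cases')
    then have "Gamma (1 + r) = r * Gamma r" using Gamma_plus1[of r] by (simp add: add.commute)
    moreover have "t powr (r - \<alpha>) = t * t powr (r - 1 - \<alpha>)"
      using assms powr_add[of t 1 "r - 1 - \<alpha>"] by simp
    ultimately show ?thesis by (simp add: Beta_def algebra_simps)
  qed
  ultimately show ?thesis
    using has_integral_cong[of "{0..t}" "\<lambda>s. r * t powr (r - 1 - \<alpha>) * ?f (s / t)"] by simp
qed

section \<open>Entire power series and their coefficient sequences\<close>

definition entire_coeffs :: "(nat \<Rightarrow> real) \<Rightarrow> bool" where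
  "entire_coeffs g \<longleftrightarrow> (\<forall>z. summable (\<lambda>n. g n * z ^ n))"

definition powser :: "(nat \<Rightarrow> real) \<Rightarrow> real \<Rightarrow> real" where
  "powser g z = (\<Sum>n. g n * z ^ n)"

lemma entire_coeffs_abs_summable:
  assumes "entire_coeffs g"
  shows "summable (\<lambda>n. \<bar>g n * z ^ n\<bar>)"
  using powser_insidea[of g "\<bar>z\<bar> + 1" z] assms by (simp add: entire_coeffs_def)

lemma entire_coeffs_diffs: "entire_coeffs g \<Longrightarrow> entire_coeffs (diffs g)"
  using termdiff_converges_all[of g] by (simp add: entire_coeffs_def)

lemma entire_coeffs_scale: "entire_coeffs g \<Longrightarrow> entire_coeffs (\<lambda>n. g n * c ^ n)"
  by (simp add: entire_coeffs_def mult.assoc power_mult_distrib[symmetric])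

lemma powser_scale: "powser (\<lambda>n. g n * c ^ n) z = powser g (c * z)"
  by (simp add: powser_def mult.assoc power_mult_distrib)

lemma powser_diffs_scale:
  assumes "entire_coeffs g"
  shows "powser (diffs (\<lambda>n. g n * c ^ n)) z = c * powser (diffs g) (c * z)"
proof -
  have "diffs (\<lambda>n. g n * c ^ n) n * z ^ n = c * (diffs g n * (c * z) ^ n)" for n
    by (simp add: diffs_def power_mult_distrib)
  then show ?thesis
    using entire_coeffs_diffs[OF assms] by (simp add: powser_def entire_coeffs_def suminf_mult)
qed

lemma powser_0 [simp]: "powser g 0 = g 0"
  by (simp add: powser_def)

lemma powser_has_derivative:
  assumes "entire_coeffs g"
  shows "(powser g has_real_derivative powser (diffs g) z) (at z)"
  using termdiffs_strong_converges_everywhere[of g z] assms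
  by (simp add: powser_def[abs_def] entire_coeffs_def)

lemma continuous_on_powser:
  "entire_coeffs g \<Longrightarrow> continuous_on A (powser g)"
  using powser_has_derivative DERIV_isCont continuous_at_imp_continuous_on by blast

lemma continuous_on_powser_compose:
  "entire_coeffs g \<Longrightarrow> continuous_on A f \<Longrightarrow> continuous_on A (\<lambda>x. powser g (f x))"
  by (rule continuous_on_compose2[OF continuous_on_powser]) auto

lemma powser_sums: "entire_coeffs g \<Longrightarrow> (\<lambda>n. g n * z ^ n) sums powser g z"
  by (simp add: entire_coeffs_def powser_def summable_sums)

text \<open>The Euler operator \<open>z d/dz\<close> multiplies the \<open>n\<close>-th coefficient
  by \<open>n\<close>, so \<open>z F'\<close> and \<open>z^2 F''\<close> are again series to which
  the minimum principle can be applied. The third claim leaves the index unshifted: its partial sums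
  are the derivatives of the partial sums of \<open>g\<close>, and the factor \<open>real n\<close>
  kills the term in which \<open>0 - 1 = 0\<close>.\<close>

lemma powser_euler:
  assumes "entire_coeffs g"
  shows "entire_coeffs (\<lambda>n. real n * g n)"
    and "powser (\<lambda>n. real n * g n) z = z * powser (diffs g) z"
    and "(\<lambda>n. real n * g n * z ^ (n - 1)) sums powser (diffs g) z"
proof -
  have s: "(\<lambda>n. real n * g n * z ^ (n - 1)) sums powser (diffs g) z" for z
    using powser_sums[OF entire_coeffs_diffs[OF assms], of z]
      sums_Suc_iff[of "\<lambda>n. real n * g n * z ^ (n - 1)"] by (simp add: diffs_def)
  show "(\<lambda>n. real n * g n * z ^ (n - 1)) sums powser (diffs g) z" by (rule s)
  have e: "(\<lambda>n. real n * g n * z ^ n) sums (z * powser (diffs g) z)" for z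
  proof -
    have "z * (real n * g n * z ^ (n - 1)) = real n * g n * z ^ n" for n by (cases n) auto
    then show ?thesis using sums_mult[OF s[of z], of z] by (simp only:)
  qed
  then show "entire_coeffs (\<lambda>n. real n * g n)" by (auto simp: entire_coeffs_def sums_iff)
  show "powser (\<lambda>n. real n * g n) z = z * powser (diffs g) z"
    using e by (simp add: powser_def sums_iff)
qed

section \<open>Power series in \<open>t powr \<beta>\<close> under the Caputo integral\<close>

locale kilbas_saigo_range =
  fixes \<alpha> \<beta> :: real
  assumes alpha_pos: "0 < \<alpha>" and alpha_less: "\<alpha> < 1" and alpha_le: "\<alpha> \<le> \<beta>"
begin

lemma beta_pos: "0 < \<beta>" using alpha_pos alpha_le by simp

text \<open>The factor that the Caputo derivative of order \<alpha> puts on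
  \<open>t powr (n * \<beta>)\<close> for \<open>n > 0\<close>. Constants have Caputo derivative
  \<open>0\<close>, not \<open>\<rho> 0\<close>, so the series below use
  \<open>\<rho> (Suc n)\<close>.\<close>

definition \<rho> :: "nat \<Rightarrow> real" where
  "\<rho> n = Gamma (1 + real n * \<beta>) / Gamma (1 + real n * \<beta> - \<alpha>)"

lemma powser_compose_has_derivative:
  assumes "entire_coeffs g" "0 < s"
  shows "((\<lambda>s. powser g (s powr \<beta>)) has_real_derivative
    powser (diffs g) (s powr \<beta>) * (\<beta> * s powr (\<beta> - 1))) (at s)"
  by (rule DERIV_chain2[OF powser_has_derivative[OF assms(1)]])
     (use assms(2) in \<open>rule has_real_derivative_powr\<close>)

lemma caputo_regular_powser:
  assumes "entire_coeffs g" "0 < t"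
  shows "caputo_regular t (\<lambda>s. powser g (s powr \<beta>))
    (\<lambda>s. powser (diffs g) (s powr \<beta>) * (\<beta> * s powr (\<beta> - 1)))"
  unfolding caputo_regular_def using assms beta_pos
  by (auto intro!: continuous_intros continuous_on_powser_compose entire_coeffs_diffs
       continuous_on_powr' powser_compose_has_derivative)

text \<open>This is \<open>caputo_powr\<close> with \<open>r = n * \<beta>\<close>; the derivatives
  are written by the chain rule so that they match the differentiated power series.\<close>

lemma caputo_monomial_sum:
  fixes g :: "nat \<Rightarrow> real"
  assumes "0 < t"
  shows "((\<lambda>s. (\<Sum>n<N. real n * g n * (s powr \<beta>) ^ (n - 1) * (\<beta> * s powr (\<beta> - 1))) / (t - s) powr \<alpha>)
    has_integral (\<Sum>n<N. if n = 0 then 0 else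
      Gamma (1 - \<alpha>) * t powr (\<beta> - \<alpha>) * (g n * \<rho> n * (t powr \<beta>) ^ (n - 1)))) {0..t}"
proof -
  have mono: "((\<lambda>s. real n * g n * (s powr \<beta>) ^ (n - 1) * (\<beta> * s powr (\<beta> - 1)) / (t - s) powr \<alpha>)
    has_integral (if n = 0 then 0 else
      Gamma (1 - \<alpha>) * t powr (\<beta> - \<alpha>) * (g n * \<rho> n * (t powr \<beta>) ^ (n - 1)))) {0..t}" for n
  proof (cases n)
    case 0
    then show ?thesis by simp
  next
    case (Suc m)
    define r where "r = real n * \<beta>"
    have r: "0 < r" using Suc beta_pos by (simp add: r_def)
    have pw: "(s powr \<beta>) ^ m = s powr (real m * \<beta>)" if "0 < s" for s
      using that by (simp add: powr_realpow[symmetric] powr_powr mult.commute)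
    have "((\<lambda>s. g n * (r * s powr (r - 1) / (t - s) powr \<alpha>)) has_integral
        g n * (Gamma (1 - \<alpha>) * (Gamma (1 + r) / Gamma (1 + r - \<alpha>)) * t powr (r - \<alpha>))) {0..t}"
      by (intro has_integral_mult_right caputo_powr r assms alpha_less)
    also have "g n * (Gamma (1 - \<alpha>) * (Gamma (1 + r) / Gamma (1 + r - \<alpha>)) * t powr (r - \<alpha>))
        = Gamma (1 - \<alpha>) * t powr (\<beta> - \<alpha>) * (g n * \<rho> n * (t powr \<beta>) ^ (n - 1))"
    proof -
      have "t powr (r - \<alpha>) = t powr (\<beta> - \<alpha>) * (t powr \<beta>) ^ m"
        using assms by (simp add: pw powr_add[symmetric] r_def Suc algebra_simps)
      then show ?thesis by (simp add: \<rho>_def r_def Suc)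
    qed
    finally have int: "((\<lambda>s. g n * (r * s powr (r - 1) / (t - s) powr \<alpha>)) has_integral
      Gamma (1 - \<alpha>) * t powr (\<beta> - \<alpha>) * (g n * \<rho> n * (t powr \<beta>) ^ (n - 1))) {0..t}" .
    have eq: "g n * (r * s powr (r - 1) / (t - s) powr \<alpha>)
        = real n * g n * (s powr \<beta>) ^ (n - 1) * (\<beta> * s powr (\<beta> - 1)) / (t - s) powr \<alpha>"
      if "s \<in> {0..t}" for s
    \<comment> \<open>At \<open>s = 0\<close> both sides vanish because \<open>0 powr _ = 0\<close>,
      whatever the exponent.\<close>
    proof (cases "s = 0")
      case False
      then have "s powr (r - 1) = (s powr \<beta>) ^ m * s powr (\<beta> - 1)"
        using that by (simp add: pw powr_add[symmetric] r_def Suc algebra_simps)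
      then show ?thesis by (simp add: r_def Suc)
    qed simp
    have "n \<noteq> 0" using Suc by simp
    show ?thesis unfolding if_not_P[OF \<open>n \<noteq> 0\<close>] by (rule has_integral_eq[OF eq int])
  qed
  show ?thesis unfolding sum_divide_distrib by (intro has_integral_sum mono) auto
qed

text \<open>Convergence of the shifted series is a by-product: up to a positive factor its partial
  sums are the Caputo integrals of the partial sums of \<open>g\<close>, and these converge by
  \<open>caputo_uniform_limit\<close>.\<close>

lemma caputo_powser:
  assumes g: "entire_coeffs g" and "0 < t"
  shows "summable (\<lambda>n. g (Suc n) * \<rho> (Suc n) * (t powr \<beta>) ^ n)"
    and "integral {0..t} (\<lambda>s. powser (diffs g) (s powr \<beta>) * (\<beta> * s powr (\<beta> - 1)) / (t - s) powr \<alpha>)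
      = Gamma (1 - \<alpha>) * t powr (\<beta> - \<alpha>) * (\<Sum>n. g (Suc n) * \<rho> (Suc n) * (t powr \<beta>) ^ n)"
proof -
  define u where "u N s = (\<Sum>n<N. g n * (s powr \<beta>) ^ n)" for N s
  define u' where "u' N s = (\<Sum>n<N. real n * g n * (s powr \<beta>) ^ (n - 1) * (\<beta> * s powr (\<beta> - 1)))" for N s
  let ?v = "\<lambda>s. powser g (s powr \<beta>)"
  let ?v' = "\<lambda>s. powser (diffs g) (s powr \<beta>) * (\<beta> * s powr (\<beta> - 1))"
  define Z where "Z = t powr \<beta>"
  define k where "k = Gamma (1 - \<alpha>) * t powr (\<beta> - \<alpha>)"
  have Z: "s powr \<beta> \<le> Z" if "s \<in> {0..t}" for s
    using that beta_pos by (auto simp: Z_def intro!: powr_mono2)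
  have "continuous_on {t/2..t} (\<lambda>s. \<beta> * s powr (\<beta> - 1))"
    using \<open>0 < t\<close> by (auto intro!: continuous_intros)
  then have "compact ((\<lambda>s. \<beta> * s powr (\<beta> - 1)) ` {t/2..t})" by (intro compact_continuous_image) auto
  then obtain B where B: "\<And>s. s \<in> {t/2..t} \<Longrightarrow> \<bar>\<beta> * s powr (\<beta> - 1)\<bar> \<le> B"
    by (metis (no_types, lifting) bounded_iff compact_imp_bounded image_eqI real_norm_def)
  have lim: "uniform_limit {0..t} u ?v sequentially"
    unfolding u_def[abs_def] powser_def
  proof (rule Weierstrass_m_test)
    show "summable (\<lambda>n. \<bar>g n * Z ^ n\<bar>)" by (rule entire_coeffs_abs_summable[OF g])
    show "norm (g n * (s powr \<beta>) ^ n) \<le> \<bar>g n * Z ^ n\<bar>" if "s \<in> {0..t}" for n s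
      using Z[OF that] by (auto simp: abs_mult power_abs intro!: mult_left_mono power_mono)
  qed
  have "uniform_limit {t/2..t} u' (\<lambda>s. \<Sum>n. real n * g n * (s powr \<beta>) ^ (n - 1) * (\<beta> * s powr (\<beta> - 1))) sequentially"
    unfolding u'_def[abs_def]
  proof (rule Weierstrass_m_test)
    have "summable (\<lambda>n. \<bar>diffs g n * Z ^ n\<bar>)" by (rule entire_coeffs_abs_summable[OF entire_coeffs_diffs[OF g]])
    then have "summable (\<lambda>n. \<bar>real n * g n * Z ^ (n - 1)\<bar>)"
      by (subst summable_Suc_iff[symmetric]) (simp add: diffs_def)
    then show "summable (\<lambda>n. \<bar>real n * g n * Z ^ (n - 1)\<bar> * B)" by (rule summable_mult2)
    show "norm (real n * g n * (s powr \<beta>) ^ (n - 1) * (\<beta> * s powr (\<beta> - 1))) \<le> \<bar>real n * g n * Z ^ (n - 1)\<bar> * B"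
      if "s \<in> {t/2..t}" for n s
    proof -
      have s: "s \<in> {0..t}" using that \<open>0 < t\<close> by auto
      have "\<bar>real n * g n * (s powr \<beta>) ^ (n - 1)\<bar> \<le> \<bar>real n * g n * Z ^ (n - 1)\<bar>"
        using Z[OF s] by (auto simp: abs_mult power_abs intro!: mult_left_mono power_mono)
      then show ?thesis using B[OF that] by (subst real_norm_def, subst abs_mult) (intro mult_mono, auto)
    qed
  qed
  also have "(\<lambda>s. \<Sum>n. real n * g n * (s powr \<beta>) ^ (n - 1) * (\<beta> * s powr (\<beta> - 1))) = ?v'"
  proof
    fix s
    show "(\<Sum>n. real n * g n * (s powr \<beta>) ^ (n - 1) * (\<beta> * s powr (\<beta> - 1))) = ?v' s"
      using sums_unique[OF sums_mult2[OF powser_euler(3)[OF g, of "s powr \<beta>"], of "\<beta> * s powr (\<beta> - 1)"]] by simp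
  qed
  finally have lim': "uniform_limit {t/2..t} u' ?v' sequentially" .
  have "caputo_regular t (u N) (u' N)" for N
    unfolding caputo_regular_def
  proof (intro conjI ballI)
    show "continuous_on {0..t} (u N)" unfolding u_def
      using beta_pos by (intro continuous_intros continuous_on_powr') auto
    show "continuous_on {t/2..t} (u' N)" unfolding u'_def
      using \<open>0 < t\<close> by (intro continuous_intros continuous_on_powr') auto
    fix s assume "s \<in> {0<..t}"
    then have "((\<lambda>s. s powr \<beta>) has_real_derivative \<beta> * s powr (\<beta> - 1)) (at s)"
      by (intro has_real_derivative_powr) auto
    from DERIV_power[OF this]
    have "((\<lambda>s. g n * (s powr \<beta>) ^ n) has_real_derivative
        g n * (real n * (\<beta> * s powr (\<beta> - 1) * (s powr \<beta>) ^ (n - 1)))) (at s)" for n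
      by (intro DERIV_cmult) simp
    then show "(u N has_real_derivative u' N s) (at s)"
      unfolding u_def[abs_def] u'_def by (intro DERIV_sum) (simp add: mult_ac)
  qed
  \<comment> \<open>A one-point parameter set specialises the uniform limit to a single
    function.\<close>
  moreover have "snd \<in> {()} \<times> A \<rightarrow> A" for A :: "real set" by auto
  ultimately have "(\<lambda>N. integral {0..t} (\<lambda>s. u' N s / (t - s) powr \<alpha>)) \<longlonglongrightarrow> integral {0..t} (\<lambda>s. ?v' s / (t - s) powr \<alpha>)"
    using caputo_uniform_limit[OF alpha_pos alpha_less \<open>0 < t\<close>, of "{()}" "\<lambda>N _. u N" "\<lambda>N _. u' N"
        "\<lambda>_. ?v" "\<lambda>_. ?v'"] caputo_regular_powser[OF g \<open>0 < t\<close>]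
      uniform_limit_compose'[OF lim, of snd "{()} \<times> {0..t}"]
      uniform_limit_compose'[OF lim', of snd "{()} \<times> {t/2..t}"]
    by (simp add: case_prod_beta')
  moreover have "integral {0..t} (\<lambda>s. u' N s / (t - s) powr \<alpha>) = (\<Sum>n<N. if n = 0 then 0 else
      k * (g n * \<rho> n * (t powr \<beta>) ^ (n - 1)))" for N
    unfolding u'_def k_def using caputo_monomial_sum[OF \<open>0 < t\<close>] by (rule integral_unique)
  ultimately have "(\<lambda>n. if n = 0 then 0 else k * (g n * \<rho> n * (t powr \<beta>) ^ (n - 1)))
      sums integral {0..t} (\<lambda>s. ?v' s / (t - s) powr \<alpha>)"
    by (simp add: sums_def)
  then have s: "(\<lambda>n. k * (g (Suc n) * \<rho> (Suc n) * (t powr \<beta>) ^ n))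
      sums integral {0..t} (\<lambda>s. ?v' s / (t - s) powr \<alpha>)"
    using sums_Suc_iff[of "\<lambda>n. if n = 0 then 0 else k * (g n * \<rho> n * (t powr \<beta>) ^ (n - 1))"] by simp
  have "0 < k" using \<open>0 < t\<close> alpha_less by (simp add: k_def)
  then show sm: "summable (\<lambda>n. g (Suc n) * \<rho> (Suc n) * (t powr \<beta>) ^ n)"
    using summable_mult_D[OF sums_summable[OF s]] by simp
  show "integral {0..t} (\<lambda>s. ?v' s / (t - s) powr \<alpha>) = k * (\<Sum>n. g (Suc n) * \<rho> (Suc n) * (t powr \<beta>) ^ n)"
    using sums_unique[OF s] suminf_mult[OF sm, of k] by simp
qed

text \<open>By \<open>caputo_powser\<close>, \<open>eq\<close> says that
  \<open>\<phi> t = powser g (t powr \<beta>)\<close> has Caputo derivative \<open>t powr (\<beta> -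
  \<alpha>) * (S (t powr \<beta>) - \<phi> t)\<close>. Since \<open>\<phi> 0\<close> is nonnegative,
  a negative minimum lies at some \<open>t > 0\<close>; there the right-hand side is positive,
  whereas \<open>caputo_at_minimum\<close> makes the left-hand side negative.\<close>

lemma powser_minimum_principle:
  assumes g: "entire_coeffs g" and "0 \<le> g 0"
    and eq: "\<And>z. 0 < z \<Longrightarrow> (\<lambda>n. g (Suc n) * \<rho> (Suc n) * z ^ n) sums (S z - powser g z)"
    and S: "\<And>z. 0 < z \<Longrightarrow> 0 \<le> S z"
    and "0 \<le> z"
  shows "0 \<le> powser g z"
proof (rule ccontr)
  assume "\<not> 0 \<le> powser g z"
  then have neg: "powser g z < 0" by simp
  with assms(2,5) have "0 < z" by (cases "z = 0") auto
  define T where "T = z powr (1 / \<beta>)"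
  have T: "0 < T" "T powr \<beta> = z" using \<open>0 < z\<close> beta_pos by (auto simp: T_def powr_powr)
  let ?\<phi> = "\<lambda>s. powser g (s powr \<beta>)"
  have "continuous_on {0..T} ?\<phi>"
    using caputo_regular_powser[OF g T(1)] by (simp add: caputo_regular_def)
  then obtain t where t: "t \<in> {0..T}" and min: "\<And>s. s \<in> {0..T} \<Longrightarrow> ?\<phi> t \<le> ?\<phi> s"
    using continuous_attains_inf[of "{0..T}" ?\<phi>] T(1) by auto
  have t_neg: "?\<phi> t < 0" using min[of T] neg T by simp
  with assms(2) t have "0 < t" by (cases "t = 0") auto
  let ?I = "integral {0..t} (\<lambda>s. powser (diffs g) (s powr \<beta>) * (\<beta> * s powr (\<beta> - 1)) / (t - s) powr \<alpha>)"
  have "?I \<le> (?\<phi> t - ?\<phi> 0) * t powr (-\<alpha>)"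
    by (rule caputo_at_minimum[OF alpha_pos alpha_less \<open>0 < t\<close> caputo_regular_powser[OF g \<open>0 < t\<close>]])
       (use t min in auto)
  also have "\<dots> < 0"
    using t_neg assms(2) \<open>0 < t\<close> by (intro mult_neg_pos) auto
  finally have "?I < 0" .
  moreover have "?I = Gamma (1 - \<alpha>) * t powr (\<beta> - \<alpha>) * (S (t powr \<beta>) - ?\<phi> t)"
    using caputo_powser(2)[OF g \<open>0 < t\<close>] sums_unique[OF eq[of "t powr \<beta>"]] \<open>0 < t\<close> by simp
  moreover have "0 < Gamma (1 - \<alpha>) * t powr (\<beta> - \<alpha>) * (S (t powr \<beta>) - ?\<phi> t)"
    using S[of "t powr \<beta>"] t_neg \<open>0 < t\<close> alpha_less by (intro mult_pos_pos) auto
  ultimately show False by simp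
qed

text \<open>Log-convexity of Gamma at
  \<open>1 + x - \<alpha> = \<alpha> * x + (1 - \<alpha>) * (x + 1)\<close>, combined with
  \<open>ln (Gamma (x + 1)) = ln x + ln (Gamma x)\<close>. It forces \<open>\<rho> n\<close> to
  infinity, which makes the Kilbas-Saigo series entire.\<close>

lemma Gamma_ratio_ge:
  assumes "0 < x"
  shows "x powr \<alpha> \<le> Gamma (1 + x) / Gamma (1 + x - \<alpha>)"
proof -
  have pos: "0 < Gamma (1 + x)" "0 < Gamma (1 + x - \<alpha>)" using assms alpha_less by auto
  have "(ln \<circ> Gamma) ((1 - (1 - \<alpha>)) *\<^sub>R x + (1 - \<alpha>) *\<^sub>R (x + 1))
      \<le> (1 - (1 - \<alpha>)) * (ln \<circ> Gamma) x + (1 - \<alpha>) * (ln \<circ> Gamma) (x + 1)"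
    using assms alpha_pos alpha_less by (intro convex_onD[OF log_convex_Gamma_real]) auto
  moreover have "(1 - (1 - \<alpha>)) *\<^sub>R x + (1 - \<alpha>) *\<^sub>R (x + 1) = 1 + x - \<alpha>" by (simp add: algebra_simps)
  ultimately have le: "ln (Gamma (1 + x - \<alpha>)) \<le> \<alpha> * ln (Gamma x) + (1 - \<alpha>) * ln (Gamma (x + 1))"
    by simp
  have "x \<notin> \<int>\<^sub>\<le>\<^sub>0" using assms by (auto elim!: nonpos_Ints_cases')
  then have "ln (Gamma (x + 1)) = ln x + ln (Gamma x)"
    using assms Gamma_plus1[of x] by (simp add: ln_mult_pos)
  then have "\<alpha> * ln x \<le> ln (Gamma (x + 1)) - ln (Gamma (1 + x - \<alpha>))"
    using le by (simp add: algebra_simps)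
  also have "\<dots> = ln (Gamma (1 + x) / Gamma (1 + x - \<alpha>))"
    using pos by (simp add: ln_div add.commute)
  finally have "exp (\<alpha> * ln x) \<le> exp (ln (Gamma (1 + x) / Gamma (1 + x - \<alpha>)))" by simp
  moreover have "0 < Gamma (1 + x) / Gamma (1 + x - \<alpha>)" using pos by simp
  ultimately show ?thesis using assms by (simp add: powr_def)
qed

lemma rho_pos: "0 < \<rho> n"
  using alpha_less beta_pos by (auto simp: \<rho>_def intro!: divide_pos_pos Gamma_real_pos add_pos_nonneg)
    (smt (verit) mult_nonneg_nonneg of_nat_0_le_iff)

lemma rho_ge_eventually:
  assumes "0 \<le> K"
  shows "\<exists>N. \<forall>n\<ge>N. K \<le> \<rho> (Suc n)"
proof -
  obtain N where N: "K powr (1 / \<alpha>) / \<beta> \<le> real N" using real_arch_simple by blast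
  have "K \<le> \<rho> (Suc n)" if "N \<le> n" for n
  proof -
    have "K powr (1 / \<alpha>) \<le> real N * \<beta>" using N beta_pos by (simp add: field_simps)
    also have "\<dots> \<le> real (Suc n) * \<beta>" using that beta_pos by (intro mult_right_mono) auto
    finally have "(K powr (1 / \<alpha>)) powr \<alpha> \<le> (real (Suc n) * \<beta>) powr \<alpha>"
      using alpha_pos by (intro powr_mono2) auto
    also have "\<dots> \<le> \<rho> (Suc n)"
      unfolding \<rho>_def using beta_pos by (intro Gamma_ratio_ge) auto
    finally show ?thesis using assms alpha_pos by (simp add: powr_powr)
  qed
  then show ?thesis by blast
qed

section \<open>Signs, convexity and decay of the Kilbas-Saigo function\<close>

definition ks_coeff :: "nat \<Rightarrow> real" where
  "ks_coeff n = (-1) ^ n / (\<Prod>k<n. \<rho> (Suc k))"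

abbreviation F :: "real \<Rightarrow> real" where "F \<equiv> powser ks_coeff"
abbreviation F' :: "real \<Rightarrow> real" where "F' \<equiv> powser (diffs ks_coeff)"

lemma ks_coeff_0: "ks_coeff 0 = 1" by (simp add: ks_coeff_def)

text \<open>The eigenvalue equation on the level of coefficients. The minus sign of the argument
  \<open>-z\<close> is built into \<open>ks_coeff\<close>.\<close>

lemma ks_coeff_Suc: "ks_coeff (Suc n) * \<rho> (Suc n) = - ks_coeff n"
  using rho_pos[of "Suc n"] by (simp add: ks_coeff_def)

lemma entire_ks_coeff: "entire_coeffs ks_coeff"
  unfolding entire_coeffs_def
proof
  fix z :: real
  \<comment> \<open>With \<open>\<rho> (Suc n)\<close> at least \<open>2 * \<bar>z\<bar>\<close> the
    ratio of consecutive terms is at most \<open>1/2\<close>.\<close>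
  obtain N where N: "\<And>n. N \<le> n \<Longrightarrow> 2 * \<bar>z\<bar> \<le> \<rho> (Suc n)"
    using rho_ge_eventually[of "2 * \<bar>z\<bar>"] by auto
  show "summable (\<lambda>n. ks_coeff n * z ^ n)"
  proof (rule summable_ratio_test)
    show "(1/2 :: real) < 1" by simp
    fix n assume "N \<le> n"
    have "\<bar>ks_coeff n\<bar> = \<bar>ks_coeff (Suc n)\<bar> * \<rho> (Suc n)"
      using ks_coeff_Suc[of n] rho_pos[of "Suc n"] by (metis abs_minus_cancel abs_mult abs_of_pos)
    moreover have "\<bar>ks_coeff (Suc n)\<bar> * (2 * \<bar>z\<bar>) \<le> \<bar>ks_coeff (Suc n)\<bar> * \<rho> (Suc n)"
      using N[OF \<open>N \<le> n\<close>] by (intro mult_left_mono) auto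
    ultimately have "(\<bar>ks_coeff (Suc n)\<bar> * (2 * \<bar>z\<bar>)) * \<bar>z\<bar> ^ n \<le> \<bar>ks_coeff n\<bar> * \<bar>z\<bar> ^ n"
      by (intro mult_right_mono) auto
    then show "norm (ks_coeff (Suc n) * z ^ Suc n) \<le> 1/2 * norm (ks_coeff n * z ^ n)"
      by (simp add: abs_mult power_abs mult_ac)
  qed
qed

text \<open>The coefficient recurrence is the equation of the minimum principle with source
  \<open>S = 0\<close>.\<close>

lemma F_nonneg: "0 \<le> z \<Longrightarrow> 0 \<le> F z"
proof (rule powser_minimum_principle[OF entire_ks_coeff, where S = "\<lambda>_. 0"])
  show "(\<lambda>n. ks_coeff (Suc n) * \<rho> (Suc n) * z ^ n) sums (0 - F z)" for z
    using sums_minus[OF powser_sums[OF entire_ks_coeff, of z]] by (simp add: ks_coeff_Suc)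
qed (auto simp: ks_coeff_0)

text \<open>Write \<open>c_n\<close> for \<open>ks_coeff n\<close>. For the coefficients
  \<open>-n c_n\<close> of \<open>-z F'\<close> the shift yields
  \<open>(n + 1) c_n = c_n + n c_n\<close>. The source is therefore \<open>F\<close>, which is
  already known to be nonnegative.\<close>

lemma F'_nonpos_aux: "0 \<le> z \<Longrightarrow> 0 \<le> powser (\<lambda>n. - (real n * ks_coeff n)) z"
  and F'_aux: "powser (\<lambda>n. - (real n * ks_coeff n)) z = - (z * F' z)"
proof -
  have s: "(\<lambda>n. real n * ks_coeff n * z ^ n) sums (z * F' z)" for z
    using powser_sums[OF powser_euler(1)[OF entire_ks_coeff], of z] unfolding powser_euler(2)[OF entire_ks_coeff] .
  have s': "(\<lambda>n. - (real n * ks_coeff n) * z ^ n) sums - (z * F' z)" for z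
    using sums_minus[OF s[of z]] by simp
  have e: "entire_coeffs (\<lambda>n. - (real n * ks_coeff n))"
    using s' unfolding entire_coeffs_def by (auto simp: sums_iff)
  show p: "powser (\<lambda>n. - (real n * ks_coeff n)) z = - (z * F' z)" for z
    using s' by (simp add: powser_def sums_iff)
  show "0 \<le> powser (\<lambda>n. - (real n * ks_coeff n)) z" if "0 \<le> z"
  proof (rule powser_minimum_principle[OF e, where S = F])
    fix z :: real assume "0 < z"
    have "- (real (Suc n) * ks_coeff (Suc n)) * \<rho> (Suc n) * z ^ n = ks_coeff n * z ^ n + real n * ks_coeff n * z ^ n" for n
    proof -
      have "- (real (Suc n) * ks_coeff (Suc n)) * \<rho> (Suc n) = - (real (Suc n) * (ks_coeff (Suc n) * \<rho> (Suc n)))" by simp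
      also have "\<dots> = ks_coeff n + real n * ks_coeff n" unfolding ks_coeff_Suc by (simp add: algebra_simps)
      finally show ?thesis by (simp only: distrib_right)
    qed
    then show "(\<lambda>n. - (real (Suc n) * ks_coeff (Suc n)) * \<rho> (Suc n) * z ^ n) sums (F z - powser (\<lambda>n. - (real n * ks_coeff n)) z)"
      using sums_add[OF powser_sums[OF entire_ks_coeff] s, of z] by (simp add: p)
  qed (use that F_nonneg in auto)
qed

lemma F'_nonpos: "0 < z \<Longrightarrow> F' z \<le> 0"
  using F'_nonpos_aux[of z] by (simp add: F'_aux mult_le_0_iff)

text \<open>The coefficients \<open>n (n - 1) c_n\<close> belong to \<open>z^2 F''\<close>. The
  shift yields \<open>-(n + 1) n c_n = -2 n c_n - n (n - 1) c_n\<close>, so the source is twice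
  \<open>-z F'\<close>, nonnegative by the preceding step.\<close>

lemma F''_nonneg:
  assumes "0 < z"
  shows "0 \<le> powser (diffs (diffs ks_coeff)) z"
proof -
  let ?g = "\<lambda>n. real n * ks_coeff n"
  let ?h = "\<lambda>n. real n * ?g n - ?g n"
  note eg = powser_euler(1)[OF entire_ks_coeff]
  have sg: "(\<lambda>n. ?g n * z ^ n) sums powser ?g z" for z by (rule powser_sums[OF eg])
  have sh: "(\<lambda>n. ?h n * z ^ n) sums (powser (\<lambda>n. real n * ?g n) z - powser ?g z)" for z
    using sums_diff[OF powser_sums[OF powser_euler(1)[OF eg]] sg, of z] by (simp add: left_diff_distrib)
  have eh: "entire_coeffs ?h" using sh unfolding entire_coeffs_def by (auto simp: sums_iff)
  have "0 \<le> powser ?h z"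
  proof (rule powser_minimum_principle[OF eh, where S = "\<lambda>z. 2 * powser (\<lambda>n. - (real n * ks_coeff n)) z"])
    fix z :: real assume "0 < z"
    have "?h (Suc n) * \<rho> (Suc n) * z ^ n = - 2 * (?g n * z ^ n) - ?h n * z ^ n" for n
    proof -
      have "?h (Suc n) * \<rho> (Suc n) = (real (Suc n) * real (Suc n) - real (Suc n)) * (ks_coeff (Suc n) * \<rho> (Suc n))"
        by (simp add: algebra_simps)
      also have "\<dots> = - 2 * ?g n - ?h n" unfolding ks_coeff_Suc by (simp add: algebra_simps)
      finally show ?thesis by (simp only: left_diff_distrib mult.assoc)
    qed
    moreover have "(\<lambda>n. - 2 * (?g n * z ^ n) - ?h n * z ^ n) sums (- 2 * powser ?g z - powser ?h z)"
      by (intro sums_diff sums_mult sg powser_sums eh)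
    ultimately show "(\<lambda>n. ?h (Suc n) * \<rho> (Suc n) * z ^ n) sums (2 * powser (\<lambda>n. - (real n * ks_coeff n)) z - powser ?h z)"
      by (simp add: F'_aux powser_euler(2)[OF entire_ks_coeff])
  qed (use assms F'_nonpos_aux in auto)
  also have "powser ?h z = z * powser (diffs ?g) z - powser ?g z"
    using sh[of z] powser_euler(2)[OF eg, of z] by (simp add: powser_def sums_iff)
  also have "powser (diffs ?g) z = F' z + z * powser (diffs (diffs ks_coeff)) z"
  proof (rule DERIV_unique)
    show "(powser ?g has_real_derivative powser (diffs ?g) z) (at z)"
      by (rule powser_has_derivative[OF eg])
    have "((\<lambda>z. z * F' z) has_real_derivative F' z + z * powser (diffs (diffs ks_coeff)) z) (at z)"
      using DERIV_mult[OF DERIV_ident powser_has_derivative[OF entire_coeffs_diffs[OF entire_ks_coeff]], of z] by (simp add: mult_ac)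
    then show "(powser ?g has_real_derivative F' z + z * powser (diffs (diffs ks_coeff)) z) (at z)"
      by (simp add: powser_euler(2)[OF entire_ks_coeff, abs_def])
  qed
  also have "z * (F' z + z * powser (diffs (diffs ks_coeff)) z) - powser ?g z = z * z * powser (diffs (diffs ks_coeff)) z"
    by (simp add: powser_euler(2)[OF entire_ks_coeff] algebra_simps)
  finally show ?thesis 
    using mult_pos_neg[OF mult_pos_pos[OF assms assms], of "powser (diffs (diffs ks_coeff)) z"] by linarith
qed

lemma F_antimono:
  assumes "0 \<le> y" "y \<le> z"
  shows "F z \<le> F y"
proof (cases "y = z")
  case False
  with assms have "y < z" by simp
  from MVT2[OF this powser_has_derivative[OF entire_ks_coeff]]
  obtain \<xi> where \<xi>: "y < \<xi>" "F z - F y = (z - y) * F' \<xi>" by blast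
  have "(z - y) * F' \<xi> \<le> 0"
    using F'_nonpos[of \<xi>] \<xi> assms by (intro mult_nonneg_nonpos) auto
  then show ?thesis using \<xi> by simp
qed simp

lemma F_le_1: "0 \<le> z \<Longrightarrow> F z \<le> 1"
  using F_antimono[of 0 z] by (simp add: ks_coeff_0)

lemma F'_mono:
  assumes "0 < y" "y \<le> z"
  shows "F' y \<le> F' z"
proof (rule DERIV_nonneg_imp_nondecreasing[OF assms(2)])
  fix x assume "y \<le> x" "x \<le> z"
  then show "\<exists>d. (F' has_real_derivative d) (at x) \<and> 0 \<le> d"
    using powser_has_derivative[OF entire_coeffs_diffs[OF entire_ks_coeff]] F''_nonneg[of x] assms by auto
qed

text \<open>By convexity the chord over \<open>[y, z]\<close> is at least as steep as the tangent at
  \<open>z\<close>. This bounds \<open>F'\<close> by values of \<open>F\<close>: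
  \<open>y = 0\<close> gives boundedness of \<open>z F'\<close>, and \<open>y = z/2\<close> gives
  its decay.\<close>

lemma F_tangent:
  assumes "0 \<le> y" "y < z"
  shows "(z - y) * \<bar>F' z\<bar> \<le> F y - F z"
proof -
  from MVT2[OF assms(2) powser_has_derivative[OF entire_ks_coeff]]
  obtain \<xi> where \<xi>: "y < \<xi>" "\<xi> < z" "F z - F y = (z - y) * F' \<xi>" by blast
  have "F' \<xi> \<le> F' z" using \<xi> assms by (intro F'_mono) auto
  then have "(z - y) * F' \<xi> \<le> (z - y) * F' z" using assms by (intro mult_left_mono) auto
  moreover have "F' z \<le> 0" using assms by (intro F'_nonpos) auto
  ultimately show ?thesis using \<xi>(3) by (simp add: algebra_simps)
qed

definition F_scaled' :: "real \<Rightarrow> real \<Rightarrow> real" where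
  "F_scaled' \<kappa> s = \<kappa> * F' (\<kappa> * s powr \<beta>) * (\<beta> * s powr (\<beta> - 1))"

lemma F_scaled_regular:
  assumes "0 < t"
  shows "caputo_regular t (\<lambda>s. F (\<kappa> * s powr \<beta>)) (F_scaled' \<kappa>)"
  using caputo_regular_powser[OF entire_coeffs_scale[OF entire_ks_coeff, of \<kappa>] assms]
  by (simp add: powser_scale powser_diffs_scale[OF entire_ks_coeff] F_scaled'_def[abs_def])

text \<open>Weights \<open>\<kappa> ^ n\<close> survive the coefficient shift up to one factor
  \<kappa>. Dividing by the powers of \<open>t\<close> and the Gamma factor,
  \<open>F (\<kappa> * t powr \<beta>)\<close> is an eigenfunction of the fractional derivative with
  eigenvalue \<open>-\<kappa>\<close>.\<close>

lemma F_scaled_caputo: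
  assumes "0 < t"
  shows "integral {0..t} (\<lambda>s. F_scaled' \<kappa> s / (t - s) powr \<alpha>)
    = Gamma (1 - \<alpha>) * t powr (\<beta> - \<alpha>) * (- \<kappa> * F (\<kappa> * t powr \<beta>))"
proof -
  have "ks_coeff (Suc n) * \<kappa> ^ Suc n * \<rho> (Suc n) * (t powr \<beta>) ^ n = - \<kappa> * (ks_coeff n * (\<kappa> * t powr \<beta>) ^ n)" for n
  proof -
    have "ks_coeff (Suc n) * \<kappa> ^ Suc n * \<rho> (Suc n) * (t powr \<beta>) ^ n
        = (ks_coeff (Suc n) * \<rho> (Suc n)) * \<kappa> ^ Suc n * (t powr \<beta>) ^ n" by simp
    then show ?thesis unfolding ks_coeff_Suc by (simp add: power_mult_distrib)
  qed
  then have "(\<Sum>n. ks_coeff (Suc n) * \<kappa> ^ Suc n * \<rho> (Suc n) * (t powr \<beta>) ^ n) = - \<kappa> * F (\<kappa> * t powr \<beta>)"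
    using sums_unique[OF sums_mult[OF powser_sums[OF entire_ks_coeff, of "\<kappa> * t powr \<beta>"], of "- \<kappa>"]] by simp
  then show ?thesis
    using caputo_powser(2)[OF entire_coeffs_scale[OF entire_ks_coeff, of \<kappa>] assms]
    by (simp add: powser_diffs_scale[OF entire_ks_coeff] F_scaled'_def)
qed

text \<open>In this form bounds on \<open>z * F' z\<close> become bounds on the time derivative in
  which \<kappa> enters only through \<open>z\<close>.\<close>

lemma F_scaled'_eq:
  assumes "0 < s"
  shows "F_scaled' \<kappa> s = \<beta> / s * (\<kappa> * s powr \<beta> * F' (\<kappa> * s powr \<beta>))"
  using assms by (simp add: F_scaled'_def powr_diff)

lemma zF'_le_1:
  assumes "0 \<le> z"
  shows "\<bar>z * F' z\<bar> \<le> 1"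
proof (cases "z = 0")
  case False
  then have "(z - 0) * \<bar>F' z\<bar> \<le> F 0 - F z" using assms by (intro F_tangent) auto
  then show ?thesis using F_nonneg[OF assms] assms by (simp add: ks_coeff_0 abs_mult)
qed simp

text \<open>At \<open>t = 1\<close> the eigenvalue equation expresses \<open>z * F z\<close> as a
  Caputo integral divided by \<open>- Gamma (1 - \<alpha>)\<close>. \<open>caputo_bound\<close>
  estimates it with \<open>A = 1\<close> and \<open>B = 2 * \<beta>\<close>, both independent of
  \<open>z\<close>; \<open>B\<close> comes from \<open>zF'_le_1\<close> and
  \<open>s \<ge> 1/2\<close>.\<close>

lemma F_decay:
  obtains C where "0 < C" "\<And>z. 0 \<le> z \<Longrightarrow> F z \<le> C / (1 + z)" "\<And>z. 0 \<le> z \<Longrightarrow> \<bar>z * F' z\<bar> \<le> C / (1 + z)"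
proof -
  define K where "K = (3 * (1/2) powr (-\<alpha>) + 2 * \<beta> * (1/2) powr (1 - \<alpha>) / (1 - \<alpha>)) / Gamma (1 - \<alpha>)"
  have K: "0 < K" using alpha_less beta_pos by (auto simp: K_def intro!: divide_pos_pos add_pos_pos)
  have zF: "z * F z \<le> K" if "0 \<le> z" for z
  proof -
    have "\<bar>integral {0..1} (\<lambda>s. F_scaled' z s / (1 - s) powr \<alpha>)\<bar>
        \<le> 3 * 1 * (1/2) powr (-\<alpha>) + 2 * \<beta> * (1/2) powr (1 - \<alpha>) / (1 - \<alpha>)"
    proof (rule caputo_bound(2)[OF alpha_pos alpha_less zero_less_one F_scaled_regular[OF zero_less_one]])
      show "\<bar>F (z * s powr \<beta>)\<bar> \<le> 1" for s
        using that F_nonneg[of "z * s powr \<beta>"] F_le_1[of "z * s powr \<beta>"] by auto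
      fix s :: real assume s: "s \<in> {1/2..1}"
      then have "\<bar>F_scaled' z s\<bar> = \<beta> / s * \<bar>z * s powr \<beta> * F' (z * s powr \<beta>)\<bar>"
        using beta_pos by (simp add: F_scaled'_eq abs_mult)
      also have "\<dots> \<le> \<beta> / s * 1"
        using s beta_pos that by (intro mult_left_mono zF'_le_1) auto
      also have "\<dots> \<le> 2 * \<beta>" using s beta_pos by (simp add: field_simps)
      finally show "\<bar>F_scaled' z s\<bar> \<le> 2 * \<beta>" .
    qed
    also have "\<dots> = Gamma (1 - \<alpha>) * K" using alpha_less Gamma_real_pos[of "1 - \<alpha>"] by (simp add: K_def del: Gamma_real_pos)
    also have "integral {0..1} (\<lambda>s. F_scaled' z s / (1 - s) powr \<alpha>) = Gamma (1 - \<alpha>) * (- (z * F z))"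
      using F_scaled_caputo[of 1 z] by simp
    finally have "Gamma (1 - \<alpha>) * (z * F z) \<le> Gamma (1 - \<alpha>) * K"
      using abs_ge_minus_self[of "Gamma (1 - \<alpha>) * (- (z * F z))"] by simp
    then show ?thesis using alpha_less by simp
  qed
  have b1: "F z \<le> (4 * K + 1) / (1 + z)" if "0 \<le> z" for z
  proof -
    have "F z * (1 + z) \<le> 1 + K" using zF[OF that] F_le_1[OF that] by (simp add: algebra_simps)
    also have "\<dots> \<le> 4 * K + 1" using K by simp
    finally show ?thesis using that by (simp add: field_simps)
  qed
  have b2: "\<bar>z * F' z\<bar> \<le> (4 * K + 1) / (1 + z)" if "0 \<le> z" for z
  proof (cases "z = 0")
    case True then show ?thesis using K by simp
  next
    case False
    then have z: "0 < z" using that by simp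
    \<comment> \<open>The chord over the half interval costs a factor \<open>2\<close> and
      evaluation at \<open>z/2\<close> another one, hence \<open>4 * K\<close>. The additional
      \<open>1\<close> comes from \<open>zF'_le_1\<close> and covers small \<open>z\<close>.\<close>
    have "(z - z/2) * \<bar>F' z\<bar> \<le> F (z/2) - F z" using z by (intro F_tangent) auto
    then have "z * \<bar>F' z\<bar> \<le> 2 * F (z/2)" using F_nonneg[OF that] by simp
    then have "z * (z * \<bar>F' z\<bar>) \<le> z * (2 * F (z/2))" using z by (intro mult_left_mono) auto
    also have "\<dots> = 4 * (z/2 * F (z/2))" by simp
    also have "\<dots> \<le> 4 * K" using zF[of "z/2"] z by simp
    finally have "\<bar>z * F' z\<bar> * (1 + z) \<le> 4 * K + 1"
      using zF'_le_1[OF that] z by (simp add: abs_mult algebra_simps)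
    then show ?thesis using z by (simp add: field_simps)
  qed
  show ?thesis by (rule that[of "4 * K + 1"]) (use K b1 b2 in auto)
qed

end

section \<open>Elliptic estimate and Pearson equation\<close>

text \<open>Cauchy-Schwarz against the constant \<open>1\<close>: the integral of
  \<open>(\<phi> - k)^2\<close>, with \<open>k\<close> the mean of \<phi>, is nonnegative.\<close>

lemma integral_sq_le:
  fixes \<phi> :: "real \<Rightarrow> real"
  assumes "c < d" "continuous_on {c..d} \<phi>"
  shows "(integral {c..d} \<phi>)\<^sup>2 \<le> (d - c) * integral {c..d} (\<lambda>x. (\<phi> x)\<^sup>2)"
proof -
  define k where "k = integral {c..d} \<phi> / (d - c)"
  have k: "integral {c..d} \<phi> = k * (d - c)" using assms(1) by (simp add: k_def)
  have i1: "(\<lambda>x. (\<phi> x)\<^sup>2) integrable_on {c..d}" "\<phi> integrable_on {c..d}"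
    using assms(2) by (auto intro!: integrable_continuous_real continuous_intros)
  have i: "((\<lambda>x. (\<phi> x)\<^sup>2 - 2 * k * \<phi> x + k\<^sup>2) has_integral
      (integral {c..d} (\<lambda>x. (\<phi> x)\<^sup>2) - 2 * k * (k * (d - c)) + k\<^sup>2 * (d - c))) {c..d}"
  proof (intro has_integral_add has_integral_diff has_integral_mult_right)
    show "(\<phi> has_integral k * (d - c)) {c..d}" using i1(2) k by (metis integrable_integral)
    show "((\<lambda>x. k\<^sup>2) has_integral k\<^sup>2 * (d - c)) {c..d}"
      using has_integral_const_real[of "k\<^sup>2" c d] assms(1) by (simp add: mult.commute)
  qed (use i1 in \<open>simp add: integrable_integral\<close>)
  have "0 \<le> integral {c..d} (\<lambda>x. (\<phi> x)\<^sup>2) - 2 * k * (k * (d - c)) + k\<^sup>2 * (d - c)"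
  proof (rule has_integral_nonneg[OF i])
    fix x
    have "(\<phi> x)\<^sup>2 - 2 * k * \<phi> x + k\<^sup>2 = (\<phi> x - k)\<^sup>2" by (simp add: power2_diff)
    then show "0 \<le> (\<phi> x)\<^sup>2 - 2 * k * \<phi> x + k\<^sup>2" by simp
  qed
  then have "k\<^sup>2 * (d - c) \<le> integral {c..d} (\<lambda>x. (\<phi> x)\<^sup>2)" by (simp add: power2_eq_square)
  then have "(d - c) * (k\<^sup>2 * (d - c)) \<le> (d - c) * integral {c..d} (\<lambda>x. (\<phi> x)\<^sup>2)"
    using assms(1) by (intro mult_left_mono) auto
  then show ?thesis by (simp add: k power2_eq_square mult_ac)
qed

text \<open>The sign condition on \<open>f' x\<close> holds on at least one of the two sides of \<open>x\<close>; on that side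
  \<open>f\<close> can drop below \<open>f x\<close> only because of \<open>(p f')'\<close>.\<close>

lemma elliptic_one_sided:
  fixes f f' p w :: "real \<Rightarrow> real"
  assumes "c < d" "x \<in> {c..d}" "0 < p0"
    and df: "\<And>y. y \<in> {c..d} \<Longrightarrow> (f has_real_derivative f' y) (at y)"
    and dv: "\<And>y. y \<in> {c..d} \<Longrightarrow> ((\<lambda>y. p y * f' y) has_real_derivative w y) (at y)"
    and w: "continuous_on {c..d} w"
    and p: "\<And>y. y \<in> {c..d} \<Longrightarrow> p0 \<le> p y"
    and "0 \<le> f x" and dir: "\<And>y. y \<in> {c..d} \<Longrightarrow> 0 \<le> f' x * (y - x)"
  shows "(f x)\<^sup>2 \<le> 2 / (d - c) * integral {c..d} (\<lambda>y. (f y)\<^sup>2)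
    + 2 * (d - c) ^ 3 / p0\<^sup>2 * integral {c..d} (\<lambda>y. (w y)\<^sup>2)"
proof -
  \<comment> \<open>\<open>G\<close> bounds the oscillation of the flux \<open>p * f'\<close> over
    \<open>{c..d}\<close>, as \<open>w\<close> is the derivative of the flux.\<close>
  define G where "G = integral {c..d} (\<lambda>y. \<bar>w y\<bar>)"
  define L where "L = d - c"
  have L: "0 < L" using assms(1) by (simp add: L_def)
  have iw: "(\<lambda>y. \<bar>w y\<bar>) integrable_on {a..b}" "w integrable_on {a..b}" if "{a..b} \<subseteq> {c..d}" for a b
    using continuous_on_subset[OF w that] by (auto intro!: integrable_continuous_real continuous_intros)
  have G0: "0 \<le> G" unfolding G_def by (intro integral_nonneg iw) auto
  have incr: "\<bar>p b * f' b - p a * f' a\<bar> \<le> G" if "a \<in> {c..d}" "b \<in> {c..d}" "a \<le> b" for a b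
  proof -
    have sub: "{a..b} \<subseteq> {c..d}" using that by auto
    have "(w has_integral (p b * f' b - p a * f' a)) {a..b}"
      using sub dv \<open>a \<le> b\<close>
      by (intro fundamental_theorem_of_calculus)
         (auto simp: has_real_derivative_iff_has_vector_derivative[symmetric] intro: has_field_derivative_at_within)
    then have "\<bar>p b * f' b - p a * f' a\<bar> \<le> integral {a..b} (\<lambda>y. \<bar>w y\<bar>)"
      using integral_norm_bound_integral[OF iw(2)[OF sub] iw(1)[OF sub]] by (auto dest: integral_unique)
    also have "\<dots> \<le> G" unfolding G_def by (intro integral_subset_le sub iw) auto
    finally show ?thesis .
  qed
  have le: "f x \<le> f y + L * G / p0" if y: "y \<in> {c..d}" for y
  proof -
    \<comment> \<open>The sign condition at \<open>x\<close> reaches \<open>y\<close> through the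
      flux at the mean-value point, which differs from the flux at \<open>x\<close> by at most
      \<open>G\<close>.\<close>
    obtain \<xi> where \<xi>: "\<xi> \<in> {c..d}" "f y - f x = f' \<xi> * (y - x)"
    proof (cases x y rule: linorder_cases)
      case less
      with MVT2[OF less, of f f'] df y assms(2) that show ?thesis
        by (metis atLeastAtMost_iff less_eq_real_def mult.commute order_trans)
    next
      case greater
      with MVT2[OF greater, of f f'] df y assms(2) obtain z where "y < z" "z < x" "f x - f y = (x - y) * f' z"
        by (metis atLeastAtMost_iff less_eq_real_def order_trans)
      with that[of z] y assms(2) show ?thesis by (auto simp: algebra_simps)
    qed (use that[of x] assms(2) in auto)
    have d: "\<bar>p \<xi> * f' \<xi> - p x * f' x\<bar> \<le> G"
      using incr[of \<xi> x] incr[of x \<xi>] \<xi>(1) assms(2) by (cases "x \<le> \<xi>") (auto simp: abs_minus_commute)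
    have "\<bar>y - x\<bar> \<le> L" using y assms(2) by (auto simp: L_def)
    with d have "\<bar>(p \<xi> * f' \<xi> - p x * f' x) * (y - x)\<bar> \<le> G * L"
      unfolding abs_mult using G0 by (intro mult_mono) auto
    moreover have "0 \<le> p x * (f' x * (y - x))" using p[of x] assms(2,3) by (intro mult_nonneg_nonneg[OF _ dir[OF y]]) auto
    ultimately have "- (G * L) \<le> p \<xi> * (f' \<xi> * (y - x))" by (simp add: algebra_simps abs_le_iff)
    then have "- (G * L) \<le> p \<xi> * (f y - f x)" using \<xi>(2) by simp
    \<comment> \<open>The lower bound on \<open>p\<close> points the right way when
      \<open>f y < f x\<close>; in the other case the claim is clear from the signs.\<close>
    moreover have "p \<xi> * (f y - f x) \<le> p0 * (f y - f x)" if "f y < f x"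
      using p[OF \<xi>(1)] that by (intro mult_right_mono_neg) auto
    moreover have "0 \<le> p0 * (f y - f x)" if "f x \<le> f y" using that assms(3) by simp
    moreover have "0 \<le> G * L" using G0 L by simp
    ultimately have "- (G * L) \<le> p0 * (f y - f x)" by linarith
    then show ?thesis using assms(3) by (simp add: field_simps)
  qed
  have cf: "continuous_on {c..d} f"
    using df by (meson DERIV_continuous_on has_field_derivative_at_within)
  \<comment> \<open>Averaging the comparison over \<open>y\<close> brings in the integral of
    \<open>f\<close>.\<close>
  have "integral {c..d} (\<lambda>_. f x) \<le> integral {c..d} (\<lambda>y. f y + L * G / p0)"
    using le cf by (intro integral_le) (auto intro!: integrable_continuous_real continuous_intros)
  also have "\<dots> = integral {c..d} f + L * (L * G / p0)"
    using cf assms(1) by (subst integral_add) (auto simp: L_def intro!: integrable_continuous_real continuous_intros)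
  finally have "L * f x \<le> integral {c..d} f + L * (L * G / p0)" using assms(1) by (simp add: L_def)
  then have "f x \<le> integral {c..d} f / L + L * G / p0" using L by (simp add: field_simps)
  then have "(f x)\<^sup>2 \<le> (integral {c..d} f / L + L * G / p0)\<^sup>2" using assms(8) by (intro power_mono)
  also have "\<dots> \<le> 2 * (integral {c..d} f / L)\<^sup>2 + 2 * (L * G / p0)\<^sup>2"
  proof -
    have "(a + b)\<^sup>2 \<le> 2 * a\<^sup>2 + 2 * b\<^sup>2" for a b :: real
      using sum_squares_bound[of a b] by (simp add: power2_sum)
    then show ?thesis .
  qed
  also have "2 * (integral {c..d} f / L)\<^sup>2 \<le> 2 / L * integral {c..d} (\<lambda>y. (f y)\<^sup>2)"
    using integral_sq_le[OF assms(1) cf] L unfolding L_def[symmetric] by (simp add: power_divide field_simps power2_eq_square)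
  also have "2 * (L * G / p0)\<^sup>2 \<le> 2 * L ^ 3 / p0\<^sup>2 * integral {c..d} (\<lambda>y. (w y)\<^sup>2)"
  proof -
    have "G\<^sup>2 \<le> L * integral {c..d} (\<lambda>y. (w y)\<^sup>2)"
      using integral_sq_le[OF assms(1), of "\<lambda>y. \<bar>w y\<bar>"] w by (simp add: G_def L_def continuous_on_rabs)
    then have "2 * L\<^sup>2 / p0\<^sup>2 * G\<^sup>2 \<le> 2 * L\<^sup>2 / p0\<^sup>2 * (L * integral {c..d} (\<lambda>y. (w y)\<^sup>2))"
      by (intro mult_left_mono) auto
    then show ?thesis by (simp add: power_mult_distrib power_divide power2_eq_square power3_eq_cube mult_ac)
  qed
  finally show ?thesis by (simp add: L_def)
qed

text \<open>A sign \<sigma> makes \<open>\<sigma> * f x\<close> nonnegative; then one half of the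
  interval satisfies the direction condition for \<open>\<sigma> * f\<close>. Both halves have
  length \<delta>, so the constants do not depend on the choice.\<close>

lemma elliptic_pointwise_bound:
  fixes f f' p w :: "real \<Rightarrow> real"
  assumes "0 < \<delta>" "0 < p0"
    and df: "\<And>y. y \<in> {x-\<delta>..x+\<delta>} \<Longrightarrow> (f has_real_derivative f' y) (at y)"
    and dv: "\<And>y. y \<in> {x-\<delta>..x+\<delta>} \<Longrightarrow> ((\<lambda>y. p y * f' y) has_real_derivative w y) (at y)"
    and w: "continuous_on {x-\<delta>..x+\<delta>} w"
    and p: "\<And>y. y \<in> {x-\<delta>..x+\<delta>} \<Longrightarrow> p0 \<le> p y"
  shows "(f x)\<^sup>2 \<le> 2 / \<delta> * integral {x-\<delta>..x+\<delta>} (\<lambda>y. (f y)\<^sup>2)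
    + 2 * \<delta> ^ 3 / p0\<^sup>2 * integral {x-\<delta>..x+\<delta>} (\<lambda>y. (w y)\<^sup>2)"
proof -
  have "\<exists>c d \<sigma>. {c..d} \<subseteq> {x-\<delta>..x+\<delta>} \<and> x \<in> {c..d} \<and> d - c = \<delta> \<and> \<bar>\<sigma>\<bar> = 1 \<and> 0 \<le> \<sigma> * f x \<and>
      (\<forall>y\<in>{c..d}. 0 \<le> \<sigma> * f' x * (y - x))"
  proof -
    define \<sigma> :: real where "\<sigma> = (if 0 \<le> f x then 1 else - 1)"
    show ?thesis
    proof (cases "0 \<le> \<sigma> * f' x")
      case True
      then show ?thesis using assms(1)
        by (intro exI[of _ x] exI[of _ "x + \<delta>"] exI[of _ \<sigma>]) (auto simp: \<sigma>_def)
    next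
      case False
      then show ?thesis using assms(1)
        by (intro exI[of _ "x - \<delta>"] exI[of _ x] exI[of _ \<sigma>]) (auto simp: \<sigma>_def mult_nonneg_nonpos mult_nonpos_nonpos)
    qed
  qed
  then obtain c d \<sigma> where cd: "{c..d} \<subseteq> {x-\<delta>..x+\<delta>}" "x \<in> {c..d}" "d - c = \<delta>" and \<sigma>: "\<bar>\<sigma>\<bar> = 1" "0 \<le> \<sigma> * f x"
    and dir: "\<And>y. y \<in> {c..d} \<Longrightarrow> 0 \<le> \<sigma> * f' x * (y - x)" by blast
  have \<sigma>2: "\<sigma>\<^sup>2 = 1" using \<sigma>(1) by (metis power2_abs power_one)
  have cw: "continuous_on {c..d} w" using w cd(1) by (rule continuous_on_subset)
  have dv': "((\<lambda>y. p y * (\<sigma> * f' y)) has_real_derivative \<sigma> * w y) (at y)" if "y \<in> {c..d}" for y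
    using DERIV_cmult[OF dv[of y], of \<sigma>] that cd(1) by (auto simp: mult_ac)
  have cf: "continuous_on {x-\<delta>..x+\<delta>} f"
    using df by (meson DERIV_continuous_on has_field_derivative_at_within)
  have "(\<sigma> * f x)\<^sup>2 \<le> 2 / (d - c) * integral {c..d} (\<lambda>y. (\<sigma> * f y)\<^sup>2)
    + 2 * (d - c) ^ 3 / p0\<^sup>2 * integral {c..d} (\<lambda>y. (\<sigma> * w y)\<^sup>2)"
    by (rule elliptic_one_sided[where f' = "\<lambda>y. \<sigma> * f' y" and p = p])
       (use cd assms(1,2) \<sigma> dir df p dv' cw in \<open>auto intro!: DERIV_cmult continuous_intros\<close>)
  then have "(f x)\<^sup>2 \<le> 2 / \<delta> * integral {c..d} (\<lambda>y. (f y)\<^sup>2) + 2 * \<delta> ^ 3 / p0\<^sup>2 * integral {c..d} (\<lambda>y. (w y)\<^sup>2)"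
    by (simp add: power_mult_distrib \<sigma>2 cd(3))
  also have "\<dots> \<le> 2 / \<delta> * integral {x-\<delta>..x+\<delta>} (\<lambda>y. (f y)\<^sup>2)
    + 2 * \<delta> ^ 3 / p0\<^sup>2 * integral {x-\<delta>..x+\<delta>} (\<lambda>y. (w y)\<^sup>2)"
    using cd(1) cf cw w assms(1,2) continuous_on_subset[OF cf cd(1)]
    by (intro add_mono mult_left_mono integral_subset_le)
       (auto intro!: integrable_continuous_real continuous_intros)
  finally show ?thesis .
qed

section \<open>Orthonormal systems in L2\<close>

lemma integrable_mult_L2:
  fixes g h :: "'a \<Rightarrow> real"
  assumes "g \<in> borel_measurable M" "integrable M (\<lambda>x. (g x)\<^sup>2)"
    and "h \<in> borel_measurable M" "integrable M (\<lambda>x. (h x)\<^sup>2)"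
  shows "integrable M (\<lambda>x. g x * h x)"
proof (rule Bochner_Integration.integrable_bound)
  show "integrable M (\<lambda>x. (g x)\<^sup>2 + (h x)\<^sup>2)" using assms by simp
  show "(\<lambda>x. g x * h x) \<in> borel_measurable M" using assms by measurable
  show "AE x in M. norm (g x * h x) \<le> norm ((g x)\<^sup>2 + (h x)\<^sup>2)"
  proof (rule AE_I2)
    fix x
    have "0 \<le> (\<bar>g x\<bar> - \<bar>h x\<bar>)\<^sup>2" by simp
    then have "2 * (\<bar>g x\<bar> * \<bar>h x\<bar>) \<le> (g x)\<^sup>2 + (h x)\<^sup>2" by (simp add: power2_diff)
    moreover have "0 \<le> \<bar>g x\<bar> * \<bar>h x\<bar>" by simp
    ultimately have "\<bar>g x\<bar> * \<bar>h x\<bar> \<le> (g x)\<^sup>2 + (h x)\<^sup>2" by linarith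
    then show "norm (g x * h x) \<le> norm ((g x)\<^sup>2 + (h x)\<^sup>2)" by (simp add: abs_mult)
  qed
qed

lemma orthonormal_sum_square:
  fixes e :: "nat \<Rightarrow> 'a \<Rightarrow> real"
  assumes e: "\<And>n. e n \<in> borel_measurable M" "\<And>n. integrable M (\<lambda>x. (e n x)\<^sup>2)"
    and orth: "\<And>n k. (\<integral>x. e n x * e k x \<partial>M) = (if n = k then 1 else 0)"
  shows "integrable M (\<lambda>x. (\<Sum>n<N. b n * e n x)\<^sup>2)"
    and "(\<integral>x. (\<Sum>n<N. b n * e n x)\<^sup>2 \<partial>M) = (\<Sum>n<N. (b n)\<^sup>2)"
proof -
  have ee: "integrable M (\<lambda>x. e n x * e k x)" for n k by (intro integrable_mult_L2 e)
  have sq: "(\<Sum>n<N. b n * e n x)\<^sup>2 = (\<Sum>n<N. \<Sum>k<N. b n * b k * (e n x * e k x))" for b x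
    by (simp add: power2_eq_square sum_product mult_ac)
  show i: "integrable M (\<lambda>x. (\<Sum>n<N. b n * e n x)\<^sup>2)" for b unfolding sq using ee by auto
  show v: "(\<integral>x. (\<Sum>n<N. b n * e n x)\<^sup>2 \<partial>M) = (\<Sum>n<N. (b n)\<^sup>2)" for b
    unfolding sq using ee by (simp add: Bochner_Integration.integral_sum orth power2_eq_square if_distrib cong: if_cong)
qed

lemma Bessel_inequality:
  fixes e :: "nat \<Rightarrow> 'a \<Rightarrow> real"
  assumes H: "H \<in> borel_measurable M" "integrable M (\<lambda>x. (H x)\<^sup>2)"
    and e: "\<And>n. e n \<in> borel_measurable M" "\<And>n. integrable M (\<lambda>x. (e n x)\<^sup>2)"
    and orth: "\<And>n k. (\<integral>x. e n x * e k x \<partial>M) = (if n = k then 1 else 0)"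
  shows "(\<Sum>n<N. (\<integral>x. H x * e n x \<partial>M)\<^sup>2) \<le> (\<integral>x. (H x)\<^sup>2 \<partial>M)"
proof -
  note i = orthonormal_sum_square(1)[OF e orth] and v = orthonormal_sum_square(2)[OF e orth]
  have He: "integrable M (\<lambda>x. H x * e n x)" for n by (intro integrable_mult_L2 e H)
  define a where "a n = (\<integral>x. H x * e n x \<partial>M)" for n
  have eq: "(H x - (\<Sum>n<N. a n * e n x))\<^sup>2 = (H x)\<^sup>2 - 2 * (\<Sum>n<N. a n * (H x * e n x)) + (\<Sum>n<N. a n * e n x)\<^sup>2" for x
    by (simp add: power2_diff sum_distrib_left mult_ac)
  have "0 \<le> (\<integral>x. (H x - (\<Sum>n<N. a n * e n x))\<^sup>2 \<partial>M)" by simp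
  also have "\<dots> = (\<integral>x. (H x)\<^sup>2 \<partial>M) - 2 * (\<Sum>n<N. a n * a n) + (\<Sum>n<N. (a n)\<^sup>2)"
    unfolding eq using H(2) He i[of a]
    by (simp add: Bochner_Integration.integral_sum v a_def[symmetric])
  finally show "(\<Sum>n<N. (\<integral>x. H x * e n x \<partial>M)\<^sup>2) \<le> (\<integral>x. (H x)\<^sup>2 \<partial>M)"
    by (simp add: a_def power2_eq_square)
qed

section \<open>Common properties of the three Pearson families\<close>

lemma open_state_space: "open (state_space P)" by (cases P) auto

lemma state_space_interval: "u \<in> state_space P \<Longrightarrow> v \<in> state_space P \<Longrightarrow> {u..v} \<subseteq> state_space P"
  by (cases P) auto

lemma diffusion_pos: "pearson_params P \<Longrightarrow> x \<in> state_space P \<Longrightarrow> 0 < diffusion P x"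
  by (cases P) (auto simp: abs_square_less_1 abs_less_iff)

lemma stat_density_pos: "pearson_params P \<Longrightarrow> x \<in> state_space P \<Longrightarrow> 0 < stat_density P x"
  by (cases P) (auto simp: Beta_def intro!: divide_pos_pos mult_pos_pos)

lemma eigval_0 [simp]: "eigval P 0 = 0" by (cases P) auto

text \<open>In the Jacobi case the increment is \<open>2 * n + a + b + 2\<close>, positive for
  \<open>a, b > -1\<close>. Monotonicity in \<open>n\<close> is what Abel's test will use.\<close>

lemma eigval_Suc: "pearson_params P \<Longrightarrow> eigval P n \<le> eigval P (Suc n)"
  by (cases P) (auto simp: algebra_simps)

lemma eigval_mono: "pearson_params P \<Longrightarrow> n \<le> k \<Longrightarrow> eigval P n \<le> eigval P k"
  by (rule lift_Suc_mono_le[of "eigval P"]) (auto intro: eigval_Suc)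

lemma eigval_nonneg: "pearson_params P \<Longrightarrow> 0 \<le> eigval P n"
  using eigval_mono[of P 0 n] by simp

lemma drift_differentiable: "drift P differentiable (at x)"
proof -
  have "\<exists>d. (drift P has_real_derivative d) (at x)"
  proof (cases P)
    case (OU \<theta> \<mu>0 v)
    have "drift P = (\<lambda>x. - \<theta> * (x - \<mu>0))" by (auto simp: OU)
    then show ?thesis by (auto intro!: exI derivative_eq_intros)
  next
    case (CIR \<theta> a b)
    have "drift P = (\<lambda>x. - \<theta> * (x - b / a))" by (auto simp: CIR)
    then show ?thesis by (auto intro!: exI derivative_eq_intros)
  next
    case (Jacobi a b)
    have "drift P = (\<lambda>x. - (a + b + 2) * x + b - a)" by (auto simp: Jacobi)
    then show ?thesis by (auto intro!: exI derivative_eq_intros)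
  qed
  then show ?thesis by (simp add: real_differentiable_def)
qed

lemma powr_has_log_derivative:
  fixes x r :: real
  assumes "0 < x"
  shows "((\<lambda>x. x powr r) has_real_derivative x powr r * (r / x)) (at x)"
  by (rule DERIV_cong[OF has_real_derivative_powr[OF assms]]) (use assms in \<open>simp add: powr_diff\<close>)

text \<open>\<open>r\<close> is the logarithmic derivative of the density; the last conjunct is the Pearson equation.\<close>

lemma Pearson_equation:
  assumes "pearson_params P" "x \<in> state_space P"
  shows "\<exists>r D'. (stat_density P has_real_derivative stat_density P x * r) (at x) \<and>
    (diffusion P has_real_derivative D') (at x) \<and> D' + diffusion P x * r = drift P x"
proof (cases P)
  case (OU \<theta> \<mu>0 v)
  define k where "k = 1 / sqrt (2 * pi * v)"
  have m: "stat_density P = (\<lambda>x. k * exp (- (x - \<mu>0)\<^sup>2 / (2 * v)))"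
    and D: "diffusion P = (\<lambda>x. \<theta> * v)" by (auto simp: OU k_def)
  have v: "0 < v" using assms(1) by (simp add: OU)
  have "(stat_density P has_real_derivative stat_density P x * (- (x - \<mu>0) / v)) (at x)"
    unfolding m using v by (auto intro!: derivative_eq_intros simp: field_simps)
  moreover have "(diffusion P has_real_derivative 0) (at x)" unfolding D by simp
  moreover have "0 + diffusion P x * (- (x - \<mu>0) / v) = drift P x" using v by (simp add: OU field_simps)
  ultimately show ?thesis by blast
next
  case (CIR \<theta> a b)
  define k where "k = a powr b / Gamma b"
  have m: "stat_density P = (\<lambda>x. k * x powr (b - 1) * exp (- a * x))"
    and D: "diffusion P = (\<lambda>x. \<theta> * x / a)" by (auto simp: CIR k_def)
  have x: "0 < x" "0 < a" using assms by (simp_all add: CIR)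
  have d: "((\<lambda>x. x powr (b - 1)) has_real_derivative x powr (b - 1) * ((b - 1) / x)) (at x)"
    by (rule powr_has_log_derivative[OF x(1)])
  have "(stat_density P has_real_derivative stat_density P x * ((b - 1) / x - a)) (at x)"
    unfolding m by (rule derivative_eq_intros d refl)+ (simp add: algebra_simps)
  moreover have "(diffusion P has_real_derivative \<theta> / a) (at x)"
    unfolding D by (rule DERIV_cdivide[OF DERIV_cmult_Id])
  moreover have "\<theta> / a + diffusion P x * ((b - 1) / x - a) = drift P x"
    using x by (simp add: CIR field_simps)
  ultimately show ?thesis by blast
next
  case (Jacobi a b)
  define k where "k = Beta (a + 1) (b + 1) * 2 powr (a + b + 1)"
  have m: "stat_density P = (\<lambda>x. (1 - x) powr a * (1 + x) powr b / k)"
    and D: "diffusion P = (\<lambda>x. 1 - x\<^sup>2)" by (auto simp: Jacobi k_def)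
  have x: "0 < 1 - x" "0 < 1 + x" using assms by (simp_all add: Jacobi)
  have "((\<lambda>x. (1 - x) powr a) has_real_derivative (1 - x) powr a * (a / (1 - x)) * (- 1)) (at x)"
    by (rule DERIV_chain2[where g = "\<lambda>x. 1 - x", OF powr_has_log_derivative[OF x(1)]]) (auto intro!: derivative_eq_intros)
  then have d1: "((\<lambda>x. (1 - x) powr a) has_real_derivative (1 - x) powr a * (- a / (1 - x))) (at x)"
    by simp
  have "((\<lambda>x. (1 + x) powr b) has_real_derivative (1 + x) powr b * (b / (1 + x)) * 1) (at x)"
    by (rule DERIV_chain2[where g = "\<lambda>x. 1 + x", OF powr_has_log_derivative[OF x(2)]]) (auto intro!: derivative_eq_intros)
  then have d2: "((\<lambda>x. (1 + x) powr b) has_real_derivative (1 + x) powr b * (b / (1 + x))) (at x)"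
    by simp
  have "((\<lambda>x. (1 - x) powr a * (1 + x) powr b / k) has_real_derivative
      ((1 - x) powr a * (- a / (1 - x)) * (1 + x) powr b + (1 + x) powr b * (b / (1 + x)) * (1 - x) powr a) / k) (at x)"
    by (intro DERIV_cdivide DERIV_mult d1 d2)
  then have "(stat_density P has_real_derivative stat_density P x * (b / (1 + x) - a / (1 - x))) (at x)"
    unfolding m by (rule DERIV_cong) (simp add: add_divide_distrib diff_divide_distrib algebra_simps)
  moreover have "(diffusion P has_real_derivative - 2 * x) (at x)"
    unfolding D by (auto intro!: derivative_eq_intros)
  moreover have "- 2 * x + diffusion P x * (b / (1 + x) - a / (1 - x)) = drift P x"
  proof -
    have "(1 - x\<^sup>2) * (b / (1 + x)) = b * (1 - x)" "(1 - x\<^sup>2) * (a / (1 - x)) = a * (1 + x)"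
      using x by (simp_all add: field_simps power2_eq_square)
    then show ?thesis by (simp add: Jacobi right_diff_distrib) (simp add: algebra_simps)
  qed
  ultimately show ?thesis by blast
qed

lemma stat_density_differentiable:
  "pearson_params P \<Longrightarrow> x \<in> state_space P \<Longrightarrow> stat_density P differentiable (at x)"
  using Pearson_equation[of P x] by (auto simp: real_differentiable_def)

text \<open>The vanishing of the stationary flux. It makes \<open>D m\<close> an integrating factor
  for \<G>.\<close>

lemma diffusion_density_has_derivative:
  assumes "pearson_params P" "x \<in> state_space P"
  shows "((\<lambda>y. diffusion P y * stat_density P y) has_real_derivative drift P x * stat_density P x) (at x)"
proof -
  from Pearson_equation[OF assms] obtain r D' where
    "(stat_density P has_real_derivative stat_density P x * r) (at x)"
    "(diffusion P has_real_derivative D') (at x)" and eq: "D' + diffusion P x * r = drift P x" by blast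
  from DERIV_mult[OF this(2,1)] have "((\<lambda>y. diffusion P y * stat_density P y) has_real_derivative
      (D' + diffusion P x * r) * stat_density P x) (at x)"
    by (rule DERIV_cong) (simp add: algebra_simps)
  then show ?thesis unfolding eq .
qed

section \<open>Orthonormal polynomials\<close>

lemma continuous_on_stat_density:
  "pearson_params P \<Longrightarrow> A \<subseteq> state_space P \<Longrightarrow> continuous_on A (stat_density P)"
  by (meson stat_density_differentiable continuous_at_imp_continuous_on differentiable_imp_continuous_within subsetD)

lemma sets_state_space: "state_space P \<in> sets lebesgue"
  using open_state_space[of P] by (simp add: borel_open sets_completionI_sets)

lemma stat_density_measurable:
  "pearson_params P \<Longrightarrow> stat_density P \<in> borel_measurable (lebesgue_on (state_space P))"
  by (intro continuous_imp_measurable_on_sets_lebesgue continuous_on_stat_density sets_state_space) auto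

lemma measurable_stat_measure: "borel_measurable (stat_measure P) = borel_measurable (lebesgue_on (state_space P))"
  by (simp add: stat_measure_def cong: measurable_cong_sets)

lemma poly_measurable_stat_measure: "poly q \<in> borel_measurable (stat_measure P)"
  unfolding measurable_stat_measure
  by (intro continuous_imp_measurable_on_sets_lebesgue sets_state_space continuous_on_poly continuous_on_id)

lemma AE_stat_density_nonneg:
  "pearson_params P \<Longrightarrow> AE x in lebesgue_on (state_space P). 0 \<le> stat_density P x"
  by (rule AE_I2) (auto simp: less_imp_le stat_density_pos)

lemma integrable_stat_measure:
  assumes "pearson_params P" "g \<in> borel_measurable (stat_measure P)"
  shows "integrable (stat_measure P) g \<longleftrightarrow>
    integrable (lebesgue_on (state_space P)) (\<lambda>x. stat_density P x * g x)"
  using assms unfolding measurable_stat_measure unfolding stat_measure_def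
  by (subst integrable_density) (auto intro: stat_density_measurable AE_stat_density_nonneg)

lemma integral_stat_measure:
  assumes "pearson_params P" "g \<in> borel_measurable (stat_measure P)"
  shows "(\<integral>x. g x \<partial>stat_measure P) = (LINT x:state_space P|lebesgue. g x * stat_density P x)"
proof -
  have "(\<integral>x. g x \<partial>stat_measure P) = (\<integral>x. stat_density P x * g x \<partial>lebesgue_on (state_space P))"
    using assms unfolding measurable_stat_measure unfolding stat_measure_def
    by (subst integral_density) (auto intro: stat_density_measurable AE_stat_density_nonneg)
  also have "\<dots> = (LINT x:state_space P|lebesgue. stat_density P x * g x)"
    using sets_state_space by (simp add: integral_restrict_space set_lebesgue_integral_def)
  finally show ?thesis by (simp add: mult.commute)
qed

text \<open>Links the gauge integrals over compact intervals in the elliptic estimate with the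
  Bochner integral in which the polynomials are orthonormal.\<close>

lemma interval_integral_le_stat_measure:
  assumes P: "pearson_params P" and sub: "{c..d} \<subseteq> state_space P"
    and g: "continuous_on (state_space P) g" "\<And>x. 0 \<le> g x" "integrable (stat_measure P) g"
  shows "integral {c..d} (\<lambda>x. g x * stat_density P x) \<le> (\<integral>x. g x \<partial>stat_measure P)"
proof -
  have gm: "g \<in> borel_measurable (stat_measure P)" using g(3) by simp
  have i: "set_integrable lebesgue (state_space P) (\<lambda>x. g x * stat_density P x)"
    using g(3) unfolding integrable_stat_measure[OF P gm]
    using sets_state_space by (simp add: set_integrable_def integrable_restrict_space mult.commute)
  have "integral {c..d} (\<lambda>x. g x * stat_density P x) \<le> integral (state_space P) (\<lambda>x. g x * stat_density P x)"
  proof (rule integral_subset_le[OF sub])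
    show "(\<lambda>x. g x * stat_density P x) integrable_on {c..d}"
      using continuous_on_stat_density[OF P sub] continuous_on_subset[OF g(1) sub]
      by (intro integrable_continuous_real continuous_intros)
    show "(\<lambda>x. g x * stat_density P x) integrable_on state_space P"
      using set_lebesgue_integral_eq_integral(1)[OF i] .
    show "\<forall>x\<in>state_space P. 0 \<le> g x * stat_density P x"
      using g(2) stat_density_pos[OF P] by (simp add: less_imp_le)
  qed
  then show ?thesis
    using set_lebesgue_integral_eq_integral(2)[OF i] integral_stat_measure[OF P gm] by simp
qed

lemma generator_poly:
  "generator P (poly q) x = drift P x * poly (pderiv q) x + diffusion P x * poly (pderiv (pderiv q)) x"
proof -
  have "deriv (poly q) = poly (pderiv q)" for q :: "real poly"
    by (rule ext) (rule DERIV_imp_deriv[OF poly_DERIV])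
  then show ?thesis by (simp add: generator_def)
qed

text \<open>The Sturm-Liouville form \<open>m * \<G> q = (D m q')'\<close>. It fits the elliptic
  estimate with \<open>p = D m\<close> and \<open>w = m * \<G> q\<close>.\<close>

lemma generator_divergence_form:
  assumes "pearson_params P" "x \<in> state_space P"
  shows "((\<lambda>y. diffusion P y * stat_density P y * poly (pderiv q) y) has_real_derivative
    stat_density P x * generator P (poly q) x) (at x)"
  by (rule DERIV_cong[OF DERIV_mult[OF diffusion_density_has_derivative[OF assms] poly_DERIV]])
     (simp add: generator_poly algebra_simps)

lemma pderiv_sum: "pderiv (\<Sum>n\<in>A. q n) = (\<Sum>n\<in>A. pderiv (q n))"
  by (induction A rule: infinite_finite_induct) (auto simp: pderiv_add)

lemma generator_sum:
  fixes q :: "nat \<Rightarrow> real poly"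
  shows "generator P (poly (\<Sum>n\<in>A. q n)) x = (\<Sum>n\<in>A. generator P (poly (q n)) x)"
  by (simp add: generator_poly pderiv_sum poly_sum sum_distrib_left sum.distrib)

lemma generator_smult: "generator P (poly (smult c q)) x = c * generator P (poly q) x"
  by (simp add: generator_poly pderiv_smult algebra_simps)

lemma enlarge_interval:
  assumes "{u..v} \<subseteq> state_space P" "u \<le> v"
  obtains \<delta> where "0 < \<delta>" "{u-\<delta>..v+\<delta>} \<subseteq> state_space P"
proof -
  have "u \<in> state_space P" "v \<in> state_space P" using assms by auto
  then obtain e1 e2 where e: "0 < e1" "cball u e1 \<subseteq> state_space P" "0 < e2" "cball v e2 \<subseteq> state_space P"
    using open_state_space[of P] unfolding open_contains_cball by blast
  define \<delta> where "\<delta> = min e1 e2"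
  have "u - \<delta> \<in> state_space P" "v + \<delta> \<in> state_space P"
    using e by (auto simp: \<delta>_def cball_def dist_real_def subset_iff)
  with e show ?thesis by (intro that[of \<delta>] state_space_interval) (auto simp: \<delta>_def)
qed

lemma bounds_on_interval:
  fixes g :: "real \<Rightarrow> real"
  assumes "continuous_on {c..d} g" "\<And>x. x \<in> {c..d} \<Longrightarrow> 0 < g x"
  obtains lo hi where "0 < lo" "0 < hi" "\<And>x. x \<in> {c..d} \<Longrightarrow> lo \<le> g x" "\<And>x. x \<in> {c..d} \<Longrightarrow> g x \<le> hi"
proof (cases "{c..d} = {}")
  case True then show ?thesis using that[of 1 1] by auto
next
  case False
  obtain x where "x \<in> {c..d}" "\<And>y. y \<in> {c..d} \<Longrightarrow> g x \<le> g y"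
    using continuous_attains_inf[OF compact_Icc False assms(1)] by blast
  moreover obtain z where "z \<in> {c..d}" "\<And>y. y \<in> {c..d} \<Longrightarrow> g y \<le> g z"
    using continuous_attains_sup[OF compact_Icc False assms(1)] by blast
  ultimately show ?thesis using that[of "g x" "g z"] assms(2) by blast
qed

lemma continuous_on_diffusion: "continuous_on A (diffusion P)"
proof -
  have "isCont (diffusion P) x" for x
  proof (cases P)
    case (OU \<theta> \<mu>0 v)
    then have "diffusion P = (\<lambda>x. \<theta> * v)" by auto
    then show ?thesis by simp
  next
    case (CIR \<theta> a b)
    then have "diffusion P = (\<lambda>x. \<theta> * x * inverse a)" by (auto simp: divide_inverse)
    then show ?thesis by (auto intro!: continuous_intros)
  next
    case (Jacobi a b)
    then have "diffusion P = (\<lambda>x. 1 - x\<^sup>2)" by auto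
    then show ?thesis by (auto intro!: continuous_intros)
  qed
  then show ?thesis by (simp add: continuous_at_imp_continuous_on)
qed

locale pearson_system =
  fixes P :: pearson and Q :: "nat \<Rightarrow> real poly"
  assumes params: "pearson_params P" and ortho: "orthonormal_polys P Q"
begin

lemma generator_Q: "x \<in> state_space P \<Longrightarrow> generator P (poly (Q n)) x = - eigval P n * poly (Q n) x"
  using ortho by (simp add: orthonormal_polys_def)

lemma orthonormal_stat_measure:
  "(\<integral>x. poly (Q n) x * poly (Q k) x \<partial>stat_measure P) = (if n = k then 1 else 0)"
proof -
  have "(\<lambda>x. poly (Q n) x * poly (Q k) x) \<in> borel_measurable (stat_measure P)"
    using poly_measurable_stat_measure[of "Q n * Q k" P] by (simp add: poly_mult[abs_def])
  then show ?thesis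
    using ortho by (simp add: integral_stat_measure[OF params] orthonormal_polys_def)
qed

text \<open>A Bochner integral is \<open>0\<close> when it does not exist, so the normalisation gives integrability.\<close>

lemma integrable_Q_sq: "integrable (stat_measure P) (\<lambda>x. (poly (Q n) x)\<^sup>2)"
  using orthonormal_stat_measure[of n n] not_integrable_integral_eq
  by (fastforce simp: power2_eq_square)

lemmas Q_sum_square = orthonormal_sum_square[OF poly_measurable_stat_measure integrable_Q_sq orthonormal_stat_measure]

text \<open>Testing the elliptic estimate with the polynomial
  \<open>y \<mapsto> \<Sum>n. Q\<^sub>n(x) Q\<^sub>n(y) / (1 + \<lambda>\<^sub>n\<^sup>2)\<close>, whose value at \<open>x\<close> equals its squared graph norm.\<close>

lemma kernel_bound:
  assumes sub: "{u..v} \<subseteq> state_space P"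
  obtains C where "0 \<le> C"
    "\<And>N x. x \<in> {u..v} \<Longrightarrow> (\<Sum>n<N. (poly (Q n) x)\<^sup>2 / (1 + (eigval P n)\<^sup>2)) \<le> C"
proof (cases "u \<le> v")
  case False
  then show ?thesis using that[of 0] by auto
next
  case True
  obtain \<delta> where \<delta>: "0 < \<delta>" "{u-\<delta>..v+\<delta>} \<subseteq> state_space P" using enlarge_interval[OF sub True] .
  let ?K = "{u-\<delta>..v+\<delta>}"
  let ?m = "stat_density P" and ?p = "\<lambda>y. diffusion P y * stat_density P y"
  note cm = continuous_on_stat_density[OF params \<delta>(2)]
  obtain m0 m1 where m: "0 < m0" "0 < m1" "\<And>x. x \<in> ?K \<Longrightarrow> m0 \<le> ?m x" "\<And>x. x \<in> ?K \<Longrightarrow> ?m x \<le> m1"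
    using bounds_on_interval[OF cm] stat_density_pos[OF params] \<delta>(2) by (metis subsetD)
  obtain p0 p1 where p: "0 < p0" "\<And>x. x \<in> ?K \<Longrightarrow> p0 \<le> ?p x"
    using bounds_on_interval[of "u-\<delta>" "v+\<delta>" ?p] stat_density_pos[OF params] diffusion_pos[OF params] \<delta>(2)
      continuous_on_mult[OF continuous_on_diffusion cm] by (metis mult_pos_pos subsetD)
  \<comment> \<open>The factor \<open>1 / m0\<close> passes from Lebesgue measure to the stationary
    one. In \<open>B\<close> a single \<open>m1\<close> appears because one of the two densities in
    \<open>(m * \<G> q)^2\<close> is absorbed by the measure.\<close>
  define A where "A = 2 / \<delta> / m0"
  define B where "B = 2 * \<delta> ^ 3 / p0\<^sup>2 * m1"
  have AB: "0 \<le> A" "0 \<le> B" using \<delta> m by (auto simp: A_def B_def)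
  show ?thesis
  proof (rule that[of "A + B"])
    show "0 \<le> A + B" using AB by simp
    fix N x assume x: "x \<in> {u..v}"
    define b where "b n = poly (Q n) x / (1 + (eigval P n)\<^sup>2)" for n
    define q where "q = (\<Sum>n<N. smult (b n) (Q n))"
    define q' where "q' = (\<Sum>n<N. smult (- eigval P n * b n) (Q n))"
    define T where "T = (\<Sum>n<N. (poly (Q n) x)\<^sup>2 / (1 + (eigval P n)\<^sup>2))"
    let ?J = "{x-\<delta>..x+\<delta>}"
    have J: "?J \<subseteq> ?K" "?J \<subseteq> state_space P" using x \<delta>(2) by auto
    have qx: "poly q y = (\<Sum>n<N. b n * poly (Q n) y)" for y by (simp add: q_def poly_sum)
    have q'x: "poly q' y = (\<Sum>n<N. - eigval P n * b n * poly (Q n) y)" for y by (simp add: q'_def poly_sum)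
    have gen: "generator P (poly q) y = poly q' y" if "y \<in> state_space P" for y
      unfolding q_def generator_sum generator_smult generator_Q[OF that] q'x by (simp add: mult_ac)
    have dv: "((\<lambda>y. ?p y * poly (pderiv q) y) has_real_derivative ?m y * poly q' y) (at y)"
      if "y \<in> ?J" for y
      using generator_divergence_form[OF params, of y q] gen[of y] that J by auto
    have T: "T = poly q x" by (simp add: T_def qx b_def power2_eq_square)
    have main: "(poly q x)\<^sup>2 \<le> 2 / \<delta> * integral ?J (\<lambda>y. (poly q y)\<^sup>2)
        + 2 * \<delta> ^ 3 / p0\<^sup>2 * integral ?J (\<lambda>y. (?m y * poly q' y)\<^sup>2)"
      by (rule elliptic_pointwise_bound[OF \<delta>(1) p(1) poly_DERIV dv])
         (use J p continuous_on_stat_density[OF params J(2)] in \<open>auto intro!: continuous_intros\<close>)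
    have q_le: "integral ?J (\<lambda>y. (poly q y)\<^sup>2) \<le> 1 / m0 * (\<Sum>n<N. (b n)\<^sup>2)"
    proof -
      have "integral ?J (\<lambda>y. (poly q y)\<^sup>2) \<le> integral ?J (\<lambda>y. 1 / m0 * ((poly q y)\<^sup>2 * ?m y))"
      proof (rule integral_le)
        fix y assume "y \<in> ?J"
        then have "m0 \<le> ?m y" using J m by auto
        then have "(poly q y)\<^sup>2 * m0 \<le> (poly q y)\<^sup>2 * ?m y" by (intro mult_left_mono) auto
        then show "(poly q y)\<^sup>2 \<le> 1 / m0 * ((poly q y)\<^sup>2 * ?m y)" using m(1) by (simp add: field_simps)
      qed (use continuous_on_stat_density[OF params J(2)] m(1) in \<open>auto intro!: integrable_continuous_real continuous_intros\<close>)
      also have "\<dots> = 1 / m0 * integral ?J (\<lambda>y. (poly q y)\<^sup>2 * ?m y)" by simp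
      also have "integral ?J (\<lambda>y. (poly q y)\<^sup>2 * ?m y) \<le> (\<integral>y. (poly q y)\<^sup>2 \<partial>stat_measure P)"
        using Q_sum_square(1)[where b = b and N = N]
        by (intro interval_integral_le_stat_measure[OF params J(2)]) (auto simp: qx intro!: continuous_intros)
      also have "\<dots> = (\<Sum>n<N. (b n)\<^sup>2)" unfolding qx using Q_sum_square(2)[where b = b and N = N] by simp
      finally show ?thesis using m(1) by (simp add: divide_right_mono)
    qed
    have q'_le: "integral ?J (\<lambda>y. (?m y * poly q' y)\<^sup>2) \<le> m1 * (\<Sum>n<N. (- eigval P n * b n)\<^sup>2)"
    proof -
      have "integral ?J (\<lambda>y. (?m y * poly q' y)\<^sup>2) \<le> integral ?J (\<lambda>y. m1 * ((poly q' y)\<^sup>2 * ?m y))"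
      proof (rule integral_le)
        fix y assume y: "y \<in> ?J"
        then have "?m y \<le> m1" "0 < ?m y" using J m stat_density_pos[OF params] by auto
        then have "?m y * (?m y * (poly q' y)\<^sup>2) \<le> m1 * (?m y * (poly q' y)\<^sup>2)" by (intro mult_right_mono) auto
        then show "(?m y * poly q' y)\<^sup>2 \<le> m1 * ((poly q' y)\<^sup>2 * ?m y)"
          by (simp add: power2_eq_square mult_ac)
      qed (use continuous_on_stat_density[OF params J(2)] m(1) in \<open>auto intro!: integrable_continuous_real continuous_intros\<close>)
      also have "\<dots> = m1 * integral ?J (\<lambda>y. (poly q' y)\<^sup>2 * ?m y)" by simp
      also have "integral ?J (\<lambda>y. (poly q' y)\<^sup>2 * ?m y) \<le> (\<integral>y. (poly q' y)\<^sup>2 \<partial>stat_measure P)"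
        using Q_sum_square(1)[where b = "\<lambda>n. - eigval P n * b n" and N = N]
        by (intro interval_integral_le_stat_measure[OF params J(2)]) (auto simp: q'x intro!: continuous_intros)
      also have "\<dots> = (\<Sum>n<N. (- eigval P n * b n)\<^sup>2)" unfolding q'x
        using Q_sum_square(2)[where b = "\<lambda>n. - eigval P n * b n" and N = N] by simp
      finally show ?thesis using m(2) by simp
    qed
    note main
    also have "2 / \<delta> * integral ?J (\<lambda>y. (poly q y)\<^sup>2) + 2 * \<delta> ^ 3 / p0\<^sup>2 * integral ?J (\<lambda>y. (?m y * poly q' y)\<^sup>2)
        \<le> 2 / \<delta> * (1 / m0 * (\<Sum>n<N. (b n)\<^sup>2))
        + 2 * \<delta> ^ 3 / p0\<^sup>2 * (m1 * (\<Sum>n<N. (- eigval P n * b n)\<^sup>2))"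
      using \<delta>(1) q_le q'_le by (intro add_mono mult_left_mono) auto
    also have "\<dots> = A * (\<Sum>n<N. (b n)\<^sup>2) + B * (\<Sum>n<N. (eigval P n * b n)\<^sup>2)"
      by (simp add: A_def B_def)
    also have "\<dots> \<le> (A + B) * (\<Sum>n<N. (b n)\<^sup>2) + (A + B) * (\<Sum>n<N. (eigval P n * b n)\<^sup>2)"
      using AB by (intro add_mono mult_right_mono sum_nonneg) auto
    also have "\<dots> = (A + B) * (\<Sum>n<N. (b n)\<^sup>2 + (eigval P n * b n)\<^sup>2)"
      by (simp add: sum.distrib distrib_left)
    also have "(\<Sum>n<N. (b n)\<^sup>2 + (eigval P n * b n)\<^sup>2) = T"
      unfolding T_def
    proof (rule sum.cong[OF refl])
      fix n
      have pos: "1 + (eigval P n)\<^sup>2 > 0" by (simp add: add_pos_nonneg)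
      have "(b n)\<^sup>2 + (eigval P n * b n)\<^sup>2 = (1 + (eigval P n)\<^sup>2) * (b n)\<^sup>2"
        by (simp add: power_mult_distrib algebra_simps)
      also have "\<dots> = (poly (Q n) x)\<^sup>2 / (1 + (eigval P n)\<^sup>2)"
        using pos by (simp add: b_def power_divide power2_eq_square[of "1 + _"])
      finally show "(b n)\<^sup>2 + (eigval P n * b n)\<^sup>2 = (poly (Q n) x)\<^sup>2 / (1 + (eigval P n)\<^sup>2)" .
    qed
    \<comment> \<open>\<open>T\<close> enters squared on the left and linearly on the right;
      cancelling leaves a bound independent of \<open>N\<close> and \<open>x\<close>.\<close>
    finally have "T * T \<le> (A + B) * T" by (simp add: T power2_eq_square)
    moreover have "0 \<le> T" unfolding T_def by (intro sum_nonneg) auto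
    ultimately show "T \<le> A + B" using AB by (cases "T = 0") (auto dest: mult_right_le_imp_le)
  qed
qed

text \<open>\<open>fp_coeff\<close> is an unweighted integral because the density cancels: it is the
  Fourier coefficient of \<open>h / m\<close> in the weighted space, so Bessel's inequality
  applies.\<close>

lemma fp_coeff_square_summable:
  assumes "in_L2 P (\<lambda>x. h x / stat_density P x)"
  shows "summable (\<lambda>n. (fp_coeff P Q h n)\<^sup>2)"
proof -
  let ?H = "\<lambda>x. h x / stat_density P x"
  have H: "?H \<in> borel_measurable (stat_measure P)" "integrable (stat_measure P) (\<lambda>x. (?H x)\<^sup>2)"
    using assms by (auto simp: in_L2_def)
  have "fp_coeff P Q h n = (\<integral>x. ?H x * poly (Q n) x \<partial>stat_measure P)" for n
  proof -
    have "(\<integral>x. ?H x * poly (Q n) x \<partial>stat_measure P)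
        = (LINT x:state_space P|lebesgue. ?H x * poly (Q n) x * stat_density P x)"
      using H(1) poly_measurable_stat_measure[of "Q n" P] by (intro integral_stat_measure[OF params] borel_measurable_times)
    also have "\<dots> = fp_coeff P Q h n"
      unfolding fp_coeff_def using stat_density_pos[OF params]
      by (intro set_lebesgue_integral_cong sets_state_space) fastforce
    finally show ?thesis by simp
  qed
  then have "(\<Sum>n\<le>N. (fp_coeff P Q h n)\<^sup>2) \<le> (\<integral>x. (?H x)\<^sup>2 \<partial>stat_measure P)" for N
    using Bessel_inequality[OF H poly_measurable_stat_measure integrable_Q_sq orthonormal_stat_measure, of "Suc N"] by (simp add: lessThan_Suc_atMost)
  then show ?thesis by (intro bounded_imp_summable[where B = "\<integral>x. (?H x)\<^sup>2 \<partial>stat_measure P"]) auto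
qed

end

section \<open>Convergence of series and of their derivatives\<close>

text \<open>Cauchy's criterion on blocks; for \<open>n \<le> m\<close> the block is empty, so
  \<open>n\<close> can range freely. Blocks of polynomials are polynomials again, which lets
  estimates for single polynomials act on a series.\<close>

lemma uniformly_convergent_on_series_iff:
  fixes h :: "nat \<Rightarrow> 'a \<Rightarrow> real"
  shows "uniformly_convergent_on Z (\<lambda>N z. \<Sum>n<N. h n z) \<longleftrightarrow>
    (\<forall>e>0. \<exists>M. \<forall>z\<in>Z. \<forall>m\<ge>M. \<forall>n. \<bar>\<Sum>i=m..<n. h i z\<bar> < e)"
proof -
  have diff: "(\<Sum>i<n. h i z) - (\<Sum>i<m. h i z) = (\<Sum>i=m..<n. h i z)" if "m \<le> n" for m n z
    using sum_diff_nat_ivl[of 0 m n "\<lambda>i. h i z"] that by (simp add: atLeast0LessThan)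
  have "uniformly_Cauchy_on Z (\<lambda>N z. \<Sum>n<N. h n z) \<longleftrightarrow>
    (\<forall>e>0. \<exists>M. \<forall>z\<in>Z. \<forall>m\<ge>M. \<forall>n. \<bar>\<Sum>i=m..<n. h i z\<bar> < e)" (is "_ = ?R")
  proof
    assume c: "uniformly_Cauchy_on Z (\<lambda>N z. \<Sum>n<N. h n z)"
    show ?R
    proof (intro allI impI)
      fix e :: real assume "0 < e"
      with c obtain M where M: "\<And>z m n. z \<in> Z \<Longrightarrow> M \<le> m \<Longrightarrow> M \<le> n \<Longrightarrow> \<bar>(\<Sum>i<m. h i z) - (\<Sum>i<n. h i z)\<bar> < e"
        unfolding uniformly_Cauchy_on_def dist_real_def by metis
      have "\<bar>\<Sum>i=m..<n. h i z\<bar> < e" if "z \<in> Z" "M \<le> m" for z m n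
        using M[of z n m] diff[of m n z] that \<open>0 < e\<close> by (cases "m \<le> n") auto
      then show "\<exists>M. \<forall>z\<in>Z. \<forall>m\<ge>M. \<forall>n. \<bar>\<Sum>i=m..<n. h i z\<bar> < e" by blast
    qed
  next
    assume R: ?R
    show "uniformly_Cauchy_on Z (\<lambda>N z. \<Sum>n<N. h n z)"
    proof (rule uniformly_Cauchy_onI')
      fix e :: real assume "0 < e"
      with R obtain M where M: "\<And>z m n. z \<in> Z \<Longrightarrow> M \<le> m \<Longrightarrow> \<bar>\<Sum>i=m..<n. h i z\<bar> < e" by blast
      have "dist (\<Sum>n<m. h n z) (\<Sum>n<n. h n z) < e" if "z \<in> Z" "M \<le> m" "m < n" for z m n
        using M[of z m n] diff[of m n z] that by (simp add: dist_real_def abs_minus_commute)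
      then show "\<exists>M. \<forall>z\<in>Z. \<forall>m\<ge>M. \<forall>n>m. dist (\<Sum>n<m. h n z) (\<Sum>n<n. h n z) < e" by blast
    qed
  qed
  then show ?thesis
    using Cauchy_uniformly_convergent[of Z "\<lambda>N z. \<Sum>n<N. h n z"]
      uniformly_convergent_Cauchy[of Z "\<lambda>N z. \<Sum>n<N. h n z"] by blast
qed

lemma uniformly_convergent_on_series_compose:
  fixes h :: "nat \<Rightarrow> 'a \<Rightarrow> real"
  assumes "uniformly_convergent_on Z (\<lambda>N z. \<Sum>n<N. h n z)" "\<And>y. y \<in> Y \<Longrightarrow> g y \<in> Z"
  shows "uniformly_convergent_on Y (\<lambda>N y. \<Sum>n<N. h n (g y))"
  using assms unfolding uniformly_convergent_on_series_iff by meson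

lemma uniform_limit_suminf:
  fixes h :: "nat \<Rightarrow> 'a \<Rightarrow> real"
  assumes "uniformly_convergent_on Z (\<lambda>N z. \<Sum>n<N. h n z)"
  shows "uniform_limit Z (\<lambda>N z. \<Sum>n<N. h n z) (\<lambda>z. \<Sum>n. h n z) sequentially"
  using assms by (simp add: uniformly_convergent_uniform_limit_iff suminf_eq_lim)

lemma uniform_limit_sums:
  fixes h :: "nat \<Rightarrow> 'a \<Rightarrow> real"
  assumes "uniform_limit Z (\<lambda>N z. \<Sum>n<N. h n z) l sequentially" "z \<in> Z"
  shows "(\<lambda>n. h n z) sums l z"
  using tendsto_uniform_limitI[OF assms] by (simp add: sums_def)

text \<open>Summation by parts as an induction: once \<open>b (m+k)\<close> times the block of
  \<open>e\<close> is subtracted, the errors telescope to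
  \<open>(b m - b (m+k)) * \<epsilon>\<close>.\<close>

lemma Abel_inequality:
  fixes b e :: "nat \<Rightarrow> real"
  assumes e: "\<And>k. \<bar>\<Sum>i=m..<k. e i\<bar> \<le> \<epsilon>" and b: "\<And>n. b (Suc n) \<le> b n" "\<And>n. 0 \<le> b n"
  shows "\<bar>\<Sum>i=m..<n. b i * e i\<bar> \<le> b m * \<epsilon>"
proof (cases "m \<le> n")
  case True
  then obtain k where k: "n = m + k" using le_Suc_ex by blast
  have "\<bar>(\<Sum>i=m..<m+k. b i * e i) - b (m+k) * (\<Sum>i=m..<m+k. e i)\<bar> \<le> (b m - b (m+k)) * \<epsilon>"
  proof (induction k)
    case (Suc k)
    let ?E = "\<lambda>k. \<Sum>i=m..<m+k. e i" and ?S = "\<lambda>k. \<Sum>i=m..<m+k. b i * e i"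
    have "?S (Suc k) - b (m + Suc k) * ?E (Suc k)
        = (?S k - b (m+k) * ?E k) + (b (m+k) - b (m + Suc k)) * ?E (Suc k)"
      by (simp add: algebra_simps)
    moreover have "\<bar>(b (m+k) - b (m + Suc k)) * ?E (Suc k)\<bar> \<le> (b (m+k) - b (m + Suc k)) * \<epsilon>"
      using b(1)[of "m+k"] e[of "m + Suc k"] by (subst abs_mult) (auto intro!: mult_mono)
    ultimately show ?case using Suc.IH by (simp add: left_diff_distrib)
  qed simp
  moreover have "\<bar>b (m+k) * (\<Sum>i=m..<m+k. e i)\<bar> \<le> b (m+k) * \<epsilon>"
    using b(2)[of "m+k"] e[of "m+k"] by (auto simp: abs_mult intro!: mult_left_mono)
  ultimately show ?thesis by (simp add: k left_diff_distrib)
next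
  case False
  moreover have "0 \<le> \<epsilon>" using e[of m] by simp
  ultimately show ?thesis using b(2)[of m] by simp
qed

text \<open>Serves the neighbourhood of time \<open>0\<close>, where the multipliers
  \<open>F(\<lambda>_n t^\<beta>)\<close> approach \<open>1\<close> and their decay in
  \<open>n\<close> is no longer uniform.\<close>

lemma Abel_uniform_test:
  fixes b e :: "nat \<Rightarrow> 'a \<Rightarrow> real"
  assumes conv: "uniformly_convergent_on Z (\<lambda>N z. \<Sum>n<N. e n z)"
    and b: "\<And>n z. z \<in> Z \<Longrightarrow> b (Suc n) z \<le> b n z" "\<And>n z. z \<in> Z \<Longrightarrow> 0 \<le> b n z" "\<And>n z. z \<in> Z \<Longrightarrow> b n z \<le> 1"
  shows "uniformly_convergent_on Z (\<lambda>N z. \<Sum>n<N. b n z * e n z)"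
  unfolding uniformly_convergent_on_series_iff
proof (intro allI impI)
  fix \<epsilon> :: real assume "0 < \<epsilon>"
  then obtain M where M: "\<And>z m n. z \<in> Z \<Longrightarrow> M \<le> m \<Longrightarrow> \<bar>\<Sum>i=m..<n. e i z\<bar> < \<epsilon> / 2"
    using conv unfolding uniformly_convergent_on_series_iff by (meson half_gt_zero)
  have "\<bar>\<Sum>i=m..<n. b i z * e i z\<bar> < \<epsilon>" if z: "z \<in> Z" and "M \<le> m" for z m n
  proof -
    have "\<bar>\<Sum>i=m..<n. b i z * e i z\<bar> \<le> b m z * (\<epsilon> / 2)"
      using M[OF z \<open>M \<le> m\<close>] b[OF z] by (intro Abel_inequality) (auto intro: less_imp_le)
    also have "\<dots> \<le> 1 * (\<epsilon> / 2)" using b(3)[OF z] \<open>0 < \<epsilon>\<close> by (intro mult_right_mono) auto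
    finally show ?thesis using \<open>0 < \<epsilon>\<close> by simp
  qed
  then show "\<exists>M. \<forall>z\<in>Z. \<forall>m\<ge>M. \<forall>n. \<bar>\<Sum>i=m..<n. b i z * e i z\<bar> < \<epsilon>" by blast
qed

text \<open>The tail of the sum of the \<open>(a n)^2\<close> does not involve \<open>z\<close>, and
  the other Cauchy-Schwarz factor is bounded uniformly in \<open>z\<close>.\<close>

lemma Cauchy_Schwarz_uniform_test:
  fixes h :: "nat \<Rightarrow> 'a \<Rightarrow> real"
  assumes a: "summable (\<lambda>n. (a n)\<^sup>2)"
    and h: "\<And>n z. z \<in> Z \<Longrightarrow> \<bar>h n z\<bar> \<le> \<bar>a n\<bar> * k n z"
    and k: "\<And>N z. z \<in> Z \<Longrightarrow> (\<Sum>n<N. (k n z)\<^sup>2) \<le> C"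
  shows "uniformly_convergent_on Z (\<lambda>N z. \<Sum>n<N. h n z)"
    and "z \<in> Z \<Longrightarrow> summable (\<lambda>n. \<bar>h n z\<bar>)"
proof -
  have tail: "\<exists>M. \<forall>z\<in>Z. \<forall>m\<ge>M. \<forall>n. (\<Sum>i=m..<n. \<bar>h i z\<bar>) < e" if "0 < e" for e
  proof -
    have pos: "0 < e\<^sup>2 / (\<bar>C\<bar> + 1)" using that by (intro divide_pos_pos) auto
    then obtain M where M: "\<And>m n. M \<le> m \<Longrightarrow> \<bar>\<Sum>i=m..<n. (a i)\<^sup>2\<bar> < e\<^sup>2 / (\<bar>C\<bar> + 1)"
      using a unfolding summable_Cauchy by (metis real_norm_def)
    have "(\<Sum>i=m..<n. \<bar>h i z\<bar>) < e" if z: "z \<in> Z" and "M \<le> m" for z m n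
    proof -
      have "(\<Sum>i=m..<n. \<bar>h i z\<bar>) \<le> (\<Sum>i=m..<n. \<bar>a i\<bar> * k i z)" by (intro sum_mono h z)
      then have "(\<Sum>i=m..<n. \<bar>h i z\<bar>)\<^sup>2 \<le> (\<Sum>i=m..<n. \<bar>a i\<bar> * k i z)\<^sup>2"
        by (intro power_mono sum_nonneg) auto
      also have "\<dots> \<le> (\<Sum>i=m..<n. \<bar>a i\<bar>\<^sup>2) * (\<Sum>i=m..<n. (k i z)\<^sup>2)"
        by (rule Cauchy_Schwarz_ineq_sum)
      also have "\<dots> \<le> (\<Sum>i=m..<n. (a i)\<^sup>2) * (\<bar>C\<bar> + 1)"
      proof -
        have "(\<Sum>i=m..<n. (k i z)\<^sup>2) \<le> (\<Sum>i<n. (k i z)\<^sup>2)" by (intro sum_mono2) auto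
        also have "\<dots> \<le> \<bar>C\<bar> + 1" using k[OF z, of n] by linarith
        finally show ?thesis by (auto intro!: mult_left_mono sum_nonneg)
      qed
      also have "\<dots> < e\<^sup>2" using M[OF \<open>M \<le> m\<close>, of n]
        by (simp add: abs_of_nonneg[OF sum_nonneg] pos_less_divide_eq)
      finally show ?thesis using \<open>0 < e\<close> by (simp add: power_less_imp_less_base)
    qed
    then show ?thesis by blast
  qed
  then have abs: "uniformly_convergent_on Z (\<lambda>N z. \<Sum>n<N. \<bar>h n z\<bar>)"
    unfolding uniformly_convergent_on_series_iff by (simp add: sum_nonneg)
  show "z \<in> Z \<Longrightarrow> summable (\<lambda>n. \<bar>h n z\<bar>)"
    by (rule sums_summable[OF uniform_limit_sums[OF uniform_limit_suminf[OF abs]]])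
  show "uniformly_convergent_on Z (\<lambda>N z. \<Sum>n<N. h n z)"
    unfolding uniformly_convergent_on_series_iff
  proof (intro allI impI)
    fix e :: real assume "0 < e"
    from tail[OF this] obtain M where "\<And>z m n. z \<in> Z \<Longrightarrow> M \<le> m \<Longrightarrow> (\<Sum>i=m..<n. \<bar>h i z\<bar>) < e" by blast
    then show "\<exists>M. \<forall>z\<in>Z. \<forall>m\<ge>M. \<forall>n. \<bar>\<Sum>i=m..<n. h i z\<bar> < e"
      by (intro exI[of _ M] ballI allI impI le_less_trans[OF sum_abs])
  qed
qed

text \<open>Convergence of \<open>\<Sum>q\<^sub>n\<close> and \<open>\<Sum>\<G>q\<^sub>n\<close> controls \<open>\<Sum>q\<^sub>n'\<close>: the flux \<open>D m q'\<close> is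
  small at a mean-value point and has a small derivative.\<close>

lemma generator_series:
  assumes params: "pearson_params P" and x: "x \<in> state_space P"
    and U: "\<And>c d. {c..d} \<subseteq> state_space P \<Longrightarrow> uniformly_convergent_on {c..d} (\<lambda>N x. \<Sum>n<N. poly (q n) x)"
    and G: "\<And>c d. {c..d} \<subseteq> state_space P \<Longrightarrow> uniformly_convergent_on {c..d} (\<lambda>N x. \<Sum>n<N. generator P (poly (q n)) x)"
  shows "((\<lambda>x. \<Sum>n. poly (q n) x) has_real_derivative (\<Sum>n. poly (pderiv (q n)) x)) (at x)"
    and "((\<lambda>x. diffusion P x * stat_density P x * (\<Sum>n. poly (pderiv (q n)) x)) has_real_derivative
      stat_density P x * (\<Sum>n. generator P (poly (q n)) x)) (at x)"
proof -
  let ?m = "stat_density P" and ?p = "\<lambda>x. diffusion P x * stat_density P x"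
  obtain \<delta> where \<delta>: "0 < \<delta>" "{x-\<delta>..x+\<delta>} \<subseteq> state_space P" using enlarge_interval[of x x P] x by auto
  define c d where "c = x - \<delta>" and "d = x + \<delta>"
  have cd: "c < d" "{c..d} \<subseteq> state_space P" and xi: "x \<in> interior {c..d}" "x \<in> {c..d}"
    using \<delta> by (auto simp: c_def d_def)
  note cm = continuous_on_stat_density[OF params cd(2)]
  obtain m0 m1 where m: "0 < m1" "\<And>y. y \<in> {c..d} \<Longrightarrow> ?m y \<le> m1"
    using bounds_on_interval[OF cm] stat_density_pos[OF params] cd(2) by (metis subsetD)
  have cp: "continuous_on {c..d} ?p" by (intro continuous_on_mult continuous_on_diffusion cm)
  have pos: "0 < ?p y" if "y \<in> {c..d}" for y
    using that cd(2) stat_density_pos[OF params] diffusion_pos[OF params] by (intro mult_pos_pos) auto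
  obtain p0 p1 where p: "0 < p0" "0 < p1" "\<And>y. y \<in> {c..d} \<Longrightarrow> p0 \<le> ?p y" "\<And>y. y \<in> {c..d} \<Longrightarrow> ?p y \<le> p1"
    using bounds_on_interval[OF cp pos] by blast
  \<comment> \<open>The first summand bounds the flux at a mean-value point, the second its growth
    across the interval; dividing by \<open>p0\<close> turns flux into derivative.\<close>
  define \<kappa> where "\<kappa> = (p1 * 2 / (d - c) + m1 * (d - c)) / p0"
  have \<kappa>: "0 < \<kappa>" using p m cd by (auto simp: \<kappa>_def intro!: divide_pos_pos add_pos_pos)
  have flux: "\<bar>poly (pderiv r) y\<bar> \<le> \<kappa> * e"
    if r: "\<And>z. z \<in> {c..d} \<Longrightarrow> \<bar>poly r z\<bar> \<le> e" "\<And>z. z \<in> {c..d} \<Longrightarrow> \<bar>generator P (poly r) z\<bar> \<le> e"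
      and y: "y \<in> {c..d}" for r e y
  proof -
    obtain \<xi> where \<xi>: "c < \<xi>" "\<xi> < d" "poly r d - poly r c = (d - c) * poly (pderiv r) \<xi>"
      using MVT2[OF cd(1), of "poly r" "poly (pderiv r)"] poly_DERIV by blast
    have "(d - c) * \<bar>poly (pderiv r) \<xi>\<bar> = \<bar>poly r d - poly r c\<bar>" using \<xi>(3) cd(1) by (simp add: abs_mult)
    also have "\<dots> \<le> 2 * e" using r(1)[of c] r(1)[of d] cd(1) by auto
    finally have "\<bar>poly (pderiv r) \<xi>\<bar> \<le> 2 * e / (d - c)" using cd(1) by (simp add: field_simps)
    then have "?p \<xi> * \<bar>poly (pderiv r) \<xi>\<bar> \<le> p1 * (2 * e / (d - c))"
      using p(2) p(4)[of \<xi>] \<xi> by (intro mult_mono) auto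
    then have 1: "\<bar>?p \<xi> * poly (pderiv r) \<xi>\<bar> \<le> p1 * (2 * e / (d - c))"
      using pos[of \<xi>] \<xi> by (simp only: abs_mult[of "?p \<xi>"] abs_of_pos atLeastAtMost_iff less_imp_le)
    have e0: "0 \<le> e" using r(1)[OF y] by simp
    have "norm (?p y * poly (pderiv r) y - ?p \<xi> * poly (pderiv r) \<xi>) \<le> m1 * e * norm (y - \<xi>)"
    proof (rule field_differentiable_bound[of "{c..d}"])
      fix z assume z: "z \<in> {c..d}"
      show "((\<lambda>y. ?p y * poly (pderiv r) y) has_field_derivative ?m z * generator P (poly r) z) (at z within {c..d})"
        by (rule has_field_derivative_at_within[OF generator_divergence_form[OF params subsetD[OF cd(2) z]]])
      show "norm (?m z * generator P (poly r) z) \<le> m1 * e"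
        using m(1) m(2)[OF z] r(2)[OF z] stat_density_pos[OF params subsetD[OF cd(2) z]]
        unfolding real_norm_def abs_mult by (intro mult_mono) auto
    qed (use y \<xi> in auto)
    also have "\<dots> \<le> m1 * e * (d - c)" using y \<xi> m(1) e0 by (intro mult_left_mono) auto
    finally have "\<bar>?p y * poly (pderiv r) y\<bar> \<le> p1 * (2 * e / (d - c)) + m1 * e * (d - c)"
      using 1 unfolding real_norm_def by linarith
    moreover have "p0 * \<bar>poly (pderiv r) y\<bar> \<le> \<bar>?p y * poly (pderiv r) y\<bar>"
      unfolding abs_mult[of "?p y"] by (intro mult_right_mono order_trans[OF p(3)[OF y] abs_ge_self]) simp
    ultimately have "p0 * \<bar>poly (pderiv r) y\<bar> \<le> p1 * (2 * e / (d - c)) + m1 * e * (d - c)" by linarith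
    also have "\<dots> = (p1 * 2 / (d - c) + m1 * (d - c)) * e" by (simp add: algebra_simps)
    also have "p1 * 2 / (d - c) + m1 * (d - c) = p0 * \<kappa>" using p(1) by (simp add: \<kappa>_def)
    finally show ?thesis using p(1) by (simp add: mult.assoc)
  qed
  have U': "uniformly_convergent_on {c..d} (\<lambda>N x. \<Sum>n<N. poly (pderiv (q n)) x)"
    unfolding uniformly_convergent_on_series_iff
  proof (intro allI impI)
    fix e :: real assume "0 < e"
    then have pos: "0 < e / (2 * \<kappa>)" using \<kappa> by simp
    obtain M1 M2 where M1: "\<And>z m n. z \<in> {c..d} \<Longrightarrow> M1 \<le> m \<Longrightarrow> \<bar>\<Sum>i=m..<n. poly (q i) z\<bar> < e / (2 * \<kappa>)"
      and M2: "\<And>z m n. z \<in> {c..d} \<Longrightarrow> M2 \<le> m \<Longrightarrow> \<bar>\<Sum>i=m..<n. generator P (poly (q i)) z\<bar> < e / (2 * \<kappa>)"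
      using U[OF cd(2)] G[OF cd(2)] pos unfolding uniformly_convergent_on_series_iff by meson
    have "\<bar>\<Sum>i=m..<n. poly (pderiv (q i)) z\<bar> < e" if "z \<in> {c..d}" "max M1 M2 \<le> m" for z m n
    proof -
      \<comment> \<open>\<open>flux\<close> is applied to a whole block of the series.\<close>
      have "\<bar>poly (pderiv (\<Sum>i=m..<n. q i)) z\<bar> \<le> \<kappa> * (e / (2 * \<kappa>))"
        using M1[of _ m n] M2[of _ m n] that
        by (intro flux) (auto simp: poly_sum generator_sum intro: less_imp_le)
      also have "\<dots> < e" using \<open>0 < e\<close> \<kappa> by simp
      finally show ?thesis by (simp add: pderiv_sum poly_sum)
    qed
    then show "\<exists>M. \<forall>z\<in>{c..d}. \<forall>m\<ge>M. \<forall>n. \<bar>\<Sum>i=m..<n. poly (pderiv (q i)) z\<bar> < e" by blast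
  qed
  have sU: "summable (\<lambda>n. poly (q n) x)"
    using sums_summable[OF uniform_limit_sums[OF uniform_limit_suminf[OF U[OF cd(2)]] xi(2)]] .
  have sU': "summable (\<lambda>n. poly (pderiv (q n)) y)" if "y \<in> {c..d}" for y
    using sums_summable[OF uniform_limit_sums[OF uniform_limit_suminf[OF U'] that]] .
  have sG: "summable (\<lambda>n. generator P (poly (q n)) x)"
    using sums_summable[OF uniform_limit_sums[OF uniform_limit_suminf[OF G[OF cd(2)]] xi(2)]] .
  show "((\<lambda>x. \<Sum>n. poly (q n) x) has_real_derivative (\<Sum>n. poly (pderiv (q n)) x)) (at x)"
    by (rule has_field_derivative_series'(2)[where f = "\<lambda>n. poly (q n)" and f' = "\<lambda>n. poly (pderiv (q n))",
          OF convex_closed_interval _ U' xi(2) sU xi(1)])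
       (rule has_field_derivative_at_within[OF poly_DERIV])
  have mG: "uniformly_convergent_on {c..d} (\<lambda>N x. \<Sum>n<N. ?m x * generator P (poly (q n)) x)"
    unfolding uniformly_convergent_on_series_iff
  proof (intro allI impI)
    fix e :: real assume "0 < e"
    then have pos: "0 < e / m1" using m by simp
    obtain M where M: "\<And>z m n. z \<in> {c..d} \<Longrightarrow> M \<le> m \<Longrightarrow> \<bar>\<Sum>i=m..<n. generator P (poly (q i)) z\<bar> < e / m1"
      using G[OF cd(2)] pos unfolding uniformly_convergent_on_series_iff by meson
    have "\<bar>\<Sum>i=m..<n. ?m z * generator P (poly (q i)) z\<bar> < e" if "z \<in> {c..d}" "M \<le> m" for z m n
    proof -
      have z: "0 < ?m z" "?m z \<le> m1" using that cd(2) stat_density_pos[OF params] m(2) by auto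
      have "\<bar>\<Sum>i=m..<n. ?m z * generator P (poly (q i)) z\<bar> = ?m z * \<bar>\<Sum>i=m..<n. generator P (poly (q i)) z\<bar>"
        using z by (simp add: sum_distrib_left[symmetric] abs_mult)
      also have "\<dots> < ?m z * (e / m1)" using M[OF that] z by (intro mult_strict_left_mono) auto
      also have "\<dots> \<le> e" using z \<open>0 < e\<close> m(1) by (simp add: field_simps)
      finally show ?thesis .
    qed
    then show "\<exists>M. \<forall>z\<in>{c..d}. \<forall>m\<ge>M. \<forall>n. \<bar>\<Sum>i=m..<n. ?m z * generator P (poly (q i)) z\<bar> < e" by blast
  qed
  have "((\<lambda>x. \<Sum>n. ?p x * poly (pderiv (q n)) x) has_real_derivative
      (\<Sum>n. ?m x * generator P (poly (q n)) x)) (at x)"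
  proof (rule has_field_derivative_series'(2)[where f = "\<lambda>n x. ?p x * poly (pderiv (q n)) x"
        and f' = "\<lambda>n x. ?m x * generator P (poly (q n)) x", OF convex_closed_interval _ mG xi(2) _ xi(1)])
    show "((\<lambda>y. ?p y * poly (pderiv (q n)) y) has_real_derivative ?m z * generator P (poly (q n)) z) (at z within {c..d})"
      if "z \<in> {c..d}" for n z
      by (rule has_field_derivative_at_within[OF generator_divergence_form[OF params subsetD[OF cd(2) that]]])
    show "summable (\<lambda>n. ?p x * poly (pderiv (q n)) x)" by (intro summable_mult sU' xi(2))
  qed
  then have "((\<lambda>x. \<Sum>n. ?p x * poly (pderiv (q n)) x) has_real_derivative
      ?m x * (\<Sum>n. generator P (poly (q n)) x)) (at x)"
    by (simp only: suminf_mult[OF sG])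
  then show "((\<lambda>x. ?p x * (\<Sum>n. poly (pderiv (q n)) x)) has_real_derivative
      ?m x * (\<Sum>n. generator P (poly (q n)) x)) (at x)"
  proof (rule has_field_derivative_transform_within_open)
    show "(\<Sum>n. ?p y * poly (pderiv (q n)) y) = ?p y * (\<Sum>n. poly (pderiv (q n)) y)" if "y \<in> {c<..<d}" for y
      using that by (intro suminf_mult sU') auto
  qed (use xi in \<open>auto simp: c_def d_def \<delta>(1)\<close>)
qed

text \<open>By stationarity, \<open>(D m)' = \<mu> m\<close>, the product rule turns \<open>(D m v)'' - (\<mu> m v)'\<close> into the
  derivative of the flux \<open>D m v'\<close>.\<close>

lemma fokker_planck_density_times:
  assumes params: "pearson_params P"
    and v: "\<And>x. x \<in> state_space P \<Longrightarrow> (v has_real_derivative v' x) (at x)"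
    and w: "\<And>x. x \<in> state_space P \<Longrightarrow>
      ((\<lambda>x. diffusion P x * stat_density P x * v' x) has_real_derivative stat_density P x * w x) (at x)"
  shows "fokker_planck_defined P (\<lambda>x. stat_density P x * v x)"
    and "x \<in> state_space P \<Longrightarrow> fokker_planck P (\<lambda>x. stat_density P x * v x) x = stat_density P x * w x"
proof -
  let ?m = "stat_density P"
  let ?A = "\<lambda>y. drift P y * (?m y * v y)" and ?B = "\<lambda>y. diffusion P y * (?m y * v y)"
  have A: "?A differentiable (at x)" if "x \<in> state_space P" for x
    using v[OF that] stat_density_differentiable[OF params that] drift_differentiable[of P x]
    by (intro differentiable_mult) (auto simp: real_differentiable_def)
  have B: "(?B has_real_derivative ?A x + diffusion P x * ?m x * v' x) (at x)" if "x \<in> state_space P" for x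
  proof -
    have "((\<lambda>y. (diffusion P y * ?m y) * v y) has_real_derivative
        drift P x * ?m x * v x + v' x * (diffusion P x * ?m x)) (at x)"
      by (rule DERIV_mult[OF diffusion_density_has_derivative[OF params that] v[OF that]])
    then show ?thesis by (simp add: mult_ac)
  qed
  have dA: "(?A has_real_derivative deriv ?A x) (at x)" if "x \<in> state_space P" for x
    using A[OF that] by (simp add: DERIV_deriv_iff_real_differentiable)
  have B': "(deriv ?B has_real_derivative deriv ?A x + ?m x * w x) (at x)" if x: "x \<in> state_space P" for x
  proof (rule has_field_derivative_transform_within_open[OF _ open_state_space x])
    show "((\<lambda>y. ?A y + diffusion P y * ?m y * v' y) has_real_derivative deriv ?A x + ?m x * w x) (at x)"
      by (intro DERIV_add dA w x)
    show "?A y + diffusion P y * ?m y * v' y = deriv ?B y" if "y \<in> state_space P" for y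
      using DERIV_imp_deriv[OF B[OF that]] by simp
  qed
  show "fokker_planck_defined P (\<lambda>x. ?m x * v x)"
    unfolding fokker_planck_defined_def using A B B' by (auto simp: real_differentiable_def)
  show "x \<in> state_space P \<Longrightarrow> fokker_planck P (\<lambda>x. ?m x * v x) x = ?m x * w x"
    using DERIV_imp_deriv[OF B'] by (simp add: fokker_planck_def)
qed

lemma caputo_regular_sum:
  assumes "\<And>n. n \<in> A \<Longrightarrow> caputo_regular t (g n) (g' n)"
  shows "caputo_regular t (\<lambda>s. \<Sum>n\<in>A. g n s * c n) (\<lambda>s. \<Sum>n\<in>A. g' n s * c n)"
  using assms unfolding caputo_regular_def
  by (auto intro!: continuous_intros DERIV_sum DERIV_cmult_right)

section \<open>The solution\<close>

text \<open>The initial datum is represented by \<open>H\<close>, to be \<open>h / m\<close>, and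
  its Fourier coefficients \<open>a\<close>. The assumptions \<open>a_sq\<close> and
  \<open>initial\<close> feed the Cauchy-Schwarz and the Abel test respectively.\<close>

locale fractional_pearson = kilbas_saigo_range \<alpha> \<beta> + pearson_system P Q
  for \<alpha> \<beta> :: real and P :: pearson and Q :: "nat \<Rightarrow> real poly" +
  fixes a :: "nat \<Rightarrow> real" and H :: "real \<Rightarrow> real"
  assumes a_sq: "summable (\<lambda>n. (a n)\<^sup>2)"
    and initial: "\<And>c d. {c..d} \<subseteq> state_space P \<Longrightarrow>
      uniform_limit {c..d} (\<lambda>N x. \<Sum>n<N. a n * poly (Q n) x) H sequentially"
begin

abbreviation ev :: "nat \<Rightarrow> real" where "ev \<equiv> eigval P"

lemma ev_nonneg: "0 \<le> ev n" by (rule eigval_nonneg[OF params])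

definition mode :: "nat \<Rightarrow> real \<Rightarrow> real" where
  "mode n x = poly (Q n) x * a n"

text \<open>The candidate solution divided by the stationary density, with space as first argument
  because the Caputo integral acts at fixed \<open>x\<close>.\<close>

definition sol :: "real \<Rightarrow> real \<Rightarrow> real" where
  "sol x s = (\<Sum>n. F (ev n * s powr \<beta>) * mode n x)"

definition sol' :: "real \<Rightarrow> real \<Rightarrow> real" where
  "sol' x s = (\<Sum>n. F_scaled' (ev n) s * mode n x)"

text \<open>Cauchy-Schwarz between \<open>a n\<close> and
  \<open>\<bar>B\<bar> * \<bar>Q_n(x)\<bar> / (1 + \<lambda>_n)\<close>. As
  \<open>1 + \<lambda>^2 \<le> (1 + \<lambda>)^2\<close> for nonnegative \<lambda>, the squares of
  the latter are controlled by \<open>kernel_bound\<close>.\<close>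

lemma weighted_series:
  fixes h :: "nat \<Rightarrow> real \<Rightarrow> real"
  assumes sub: "{c..d} \<subseteq> state_space P"
    and h: "\<And>n x s. x \<in> {c..d} \<Longrightarrow> s \<in> T \<Longrightarrow> \<bar>h n s\<bar> \<le> B / (1 + ev n)"
  shows "uniformly_convergent_on ({c..d} \<times> T) (\<lambda>N (x, s). \<Sum>n<N. h n s * mode n x)"
    and "x \<in> {c..d} \<Longrightarrow> s \<in> T \<Longrightarrow> summable (\<lambda>n. \<bar>h n s * mode n x\<bar>)"
proof -
  obtain C where C: "\<And>N x. x \<in> {c..d} \<Longrightarrow> (\<Sum>n<N. (poly (Q n) x)\<^sup>2 / (1 + (ev n)\<^sup>2)) \<le> C"
    using kernel_bound[OF sub] by metis
  define k where "k n z = \<bar>B\<bar> * \<bar>poly (Q n) (fst z)\<bar> / (1 + ev n)" for n and z :: "real \<times> real"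
  have hk: "\<bar>h n (snd z) * mode n (fst z)\<bar> \<le> \<bar>a n\<bar> * k n z" if z: "z \<in> {c..d} \<times> T" for n z
  proof -
    have "\<bar>h n (snd z)\<bar> \<le> B / (1 + ev n)" using h[of "fst z" "snd z" n] z by auto
    also have "\<dots> \<le> \<bar>B\<bar> / (1 + ev n)" using ev_nonneg[of n] by (intro divide_right_mono) auto
    finally have "\<bar>h n (snd z)\<bar> * \<bar>mode n (fst z)\<bar> \<le> \<bar>B\<bar> / (1 + ev n) * \<bar>mode n (fst z)\<bar>"
      by (intro mult_right_mono) auto
    then show ?thesis by (simp add: mode_def k_def abs_mult mult_ac)
  qed
  have kb: "(\<Sum>n<N. (k n z)\<^sup>2) \<le> B\<^sup>2 * C" if z: "z \<in> {c..d} \<times> T" for N z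
  proof -
    have "(k n z)\<^sup>2 \<le> B\<^sup>2 * ((poly (Q n) (fst z))\<^sup>2 / (1 + (ev n)\<^sup>2))" for n
    proof -
      have "1 + (ev n)\<^sup>2 \<le> (1 + ev n)\<^sup>2" using ev_nonneg[of n] by (simp add: power2_sum)
      then have "(poly (Q n) (fst z))\<^sup>2 / (1 + ev n)\<^sup>2 \<le> (poly (Q n) (fst z))\<^sup>2 / (1 + (ev n)\<^sup>2)"
        by (intro frac_le) (auto simp: add_pos_nonneg)
      then have "B\<^sup>2 * ((poly (Q n) (fst z))\<^sup>2 / (1 + ev n)\<^sup>2) \<le> B\<^sup>2 * ((poly (Q n) (fst z))\<^sup>2 / (1 + (ev n)\<^sup>2))"
        by (intro mult_left_mono) auto
      then show ?thesis by (simp add: k_def power_divide power_mult_distrib)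
    qed
    then have "(\<Sum>n<N. (k n z)\<^sup>2) \<le> (\<Sum>n<N. B\<^sup>2 * ((poly (Q n) (fst z))\<^sup>2 / (1 + (ev n)\<^sup>2)))"
      by (intro sum_mono) auto
    also have "\<dots> = B\<^sup>2 * (\<Sum>n<N. (poly (Q n) (fst z))\<^sup>2 / (1 + (ev n)\<^sup>2))"
      by (simp add: sum_distrib_left)
    also have "\<dots> \<le> B\<^sup>2 * C" using C[of "fst z" N] z by (intro mult_left_mono) auto
    finally show ?thesis .
  qed
  show "uniformly_convergent_on ({c..d} \<times> T) (\<lambda>N (x, s). \<Sum>n<N. h n s * mode n x)"
    using Cauchy_Schwarz_uniform_test(1)[where h = "\<lambda>n z. h n (snd z) * mode n (fst z)", OF a_sq hk kb]
    by (simp add: case_prod_beta')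
  show "summable (\<lambda>n. \<bar>h n s * mode n x\<bar>)" if "x \<in> {c..d}" "s \<in> T"
  proof -
    have "summable (\<lambda>n. \<bar>h n (snd (x, s)) * mode n (fst (x, s))\<bar>)"
      by (rule Cauchy_Schwarz_uniform_test(2)[where h = "\<lambda>n z. h n (snd z) * mode n (fst z)"
            and Z = "{c..d} \<times> T", OF a_sq hk kb]) (use that in auto)
    then show ?thesis by simp
  qed
qed

lemma F_series_abs_summable:
  assumes "x \<in> state_space P" "0 < t"
  shows "summable (\<lambda>n. \<bar>F (ev n * t powr \<beta>) * mode n x\<bar>)"
proof -
  obtain C where C: "0 < C" "\<And>z. 0 \<le> z \<Longrightarrow> F z \<le> C / (1 + z)" using F_decay by metis
  \<comment> \<open>Chosen so that
    \<open>w * (1 + \<lambda>) \<le> 1 + \<lambda> * t powr \<beta>\<close> for every \<lambda>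
    \<ge> 0.\<close>
  define w where "w = min 1 (t powr \<beta>)"
  have w: "0 < w" "w \<le> 1" "w \<le> t powr \<beta>" using \<open>0 < t\<close> by (auto simp: w_def)
  have "\<bar>F (ev n * t powr \<beta>)\<bar> \<le> (C / w) / (1 + ev n)" for n
  proof -
    have z: "0 \<le> ev n * t powr \<beta>" using ev_nonneg by simp
    have "\<bar>F (ev n * t powr \<beta>)\<bar> \<le> C / (1 + ev n * t powr \<beta>)" using F_nonneg[OF z] C(2)[OF z] by simp
    also have "\<dots> \<le> C / (w * (1 + ev n))"
      using C w ev_nonneg[of n] mult_left_mono[OF w(3) ev_nonneg[of n]]
      by (intro divide_left_mono) (auto simp: algebra_simps intro!: mult_pos_pos add_pos_nonneg)
    finally show ?thesis by simp
  qed
  then show ?thesis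
    using weighted_series(2)[of x x "{t}" "\<lambda>n s. F (ev n * s powr \<beta>)" "C / w" x t] assms by auto
qed

text \<open>For every \<open>s\<close>, time \<open>0\<close> included, the multipliers lie between
  \<open>0\<close> and \<open>1\<close> and decrease in \<open>n\<close>, so Abel's test inherits
  the uniform convergence of the initial expansion.\<close>

lemma F_series_uniform_limit:
  assumes "{c..d} \<subseteq> state_space P"
  shows "uniform_limit ({c..d} \<times> {0..}) (\<lambda>N (x, s). \<Sum>n<N. F (ev n * s powr \<beta>) * mode n x) (\<lambda>(x, s). sol x s) sequentially"
proof -
  have "uniformly_convergent_on {c..d} (\<lambda>N x. \<Sum>n<N. mode n x)"
    using initial[OF assms] by (auto simp: uniformly_convergent_on_def mode_def mult.commute)
  then have "uniformly_convergent_on ({c..d} \<times> {0..}) (\<lambda>N z. \<Sum>n<N. mode n (fst z))"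
    by (rule uniformly_convergent_on_series_compose) auto
  then have "uniformly_convergent_on ({c..d} \<times> {0..}) (\<lambda>N z. \<Sum>n<N. F (ev n * snd z powr \<beta>) * mode n (fst z))"
  proof (rule Abel_uniform_test)
    fix n and z :: "real \<times> real"
    have z: "0 \<le> ev n * snd z powr \<beta>" for n using ev_nonneg by simp
    show "F (ev (Suc n) * snd z powr \<beta>) \<le> F (ev n * snd z powr \<beta>)"
      using z[of n] eigval_Suc[OF params, of n] by (intro F_antimono mult_right_mono) auto
    show "0 \<le> F (ev n * snd z powr \<beta>)" "F (ev n * snd z powr \<beta>) \<le> 1"
      using F_nonneg[OF z] F_le_1[OF z] by auto
  qed
  from uniform_limit_suminf[OF this] show ?thesis by (simp add: sol_def case_prod_beta')
qed

text \<open>Differentiating in time costs \<open>\<beta> / t0\<close> and no power of the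
  eigenvalue, because \<open>z F'\<close> obeys the same decay bound as \<open>F\<close>.\<close>

lemma F'_series_uniform:
  assumes "{c..d} \<subseteq> state_space P" "0 < t0"
  shows "uniformly_convergent_on ({c..d} \<times> {t0..t1}) (\<lambda>N (x, s). \<Sum>n<N. F_scaled' (ev n) s * mode n x)"
proof -
  obtain C where C: "0 < C" "\<And>z. 0 \<le> z \<Longrightarrow> \<bar>z * F' z\<bar> \<le> C / (1 + z)" using F_decay by metis
  define w where "w = min 1 (t0 powr \<beta>)"
  have w: "0 < w" "w \<le> 1" "w \<le> t0 powr \<beta>" using assms(2) by (auto simp: w_def)
  have "\<bar>F_scaled' (ev n) s\<bar> \<le> (\<beta> / t0 * (C / w)) / (1 + ev n)" if s: "s \<in> {t0..t1}" for n s
  proof -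
    have z: "0 \<le> ev n * s powr \<beta>" using ev_nonneg by simp
    have ws: "w \<le> s powr \<beta>" using w(3) powr_mono2[of \<beta> t0 s] s assms(2) beta_pos by simp
    have "\<bar>ev n * s powr \<beta> * F' (ev n * s powr \<beta>)\<bar> \<le> C / (1 + ev n * s powr \<beta>)" by (rule C(2)[OF z])
    also have "\<dots> \<le> C / (w * (1 + ev n))"
      using C w ev_nonneg[of n] mult_left_mono[OF ws ev_nonneg[of n]]
      by (intro divide_left_mono) (auto simp: algebra_simps intro!: mult_pos_pos add_pos_nonneg)
    finally have "\<beta> / s * \<bar>ev n * s powr \<beta> * F' (ev n * s powr \<beta>)\<bar> \<le> \<beta> / t0 * (C / (w * (1 + ev n)))"
      using s assms(2) beta_pos by (intro mult_mono divide_left_mono) auto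
    moreover have "\<bar>F_scaled' (ev n) s\<bar> = \<beta> / s * \<bar>ev n * s powr \<beta> * F' (ev n * s powr \<beta>)\<bar>"
      using s assms(2) beta_pos by (simp add: F_scaled'_eq abs_mult)
    ultimately show ?thesis by simp
  qed
  then show ?thesis by (intro weighted_series(1) assms(1))
qed

lemma F'_series_uniform_limit:
  assumes "{c..d} \<subseteq> state_space P" "0 < t0"
  shows "uniform_limit ({c..d} \<times> {t0..t1}) (\<lambda>N (x, s). \<Sum>n<N. F_scaled' (ev n) s * mode n x) (\<lambda>(x, s). sol' x s) sequentially"
  using uniform_limit_suminf[where h = "\<lambda>n z. F_scaled' (ev n) (snd z) * mode n (fst z)"] F'_series_uniform[OF assms]
  by (simp add: sol'_def case_prod_beta')

lemma F_series_regular: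
  assumes "0 < t"
  shows "caputo_regular t (\<lambda>s. \<Sum>n<N. F (ev n * s powr \<beta>) * mode n x) (\<lambda>s. \<Sum>n<N. F_scaled' (ev n) s * mode n x)"
  by (intro caputo_regular_sum F_scaled_regular assms)

lemma sol_has_derivative:
  assumes x: "x \<in> state_space P" and "0 < s"
  shows "(sol x has_real_derivative sol' x s) (at s)"
proof -
  have sub: "{x..x} \<subseteq> state_space P" using x by simp
  \<comment> \<open>The neighbourhood \<open>{s/2 .. 2 * s}\<close> stays away from time
    \<open>0\<close>, where \<open>F'_series_uniform\<close> gives no bound.\<close>
  have conv: "uniformly_convergent_on {s/2 .. 2 * s} (\<lambda>N s. \<Sum>n<N. F_scaled' (ev n) s * mode n x)"
    using uniformly_convergent_on_series_compose[where h = "\<lambda>n z. F_scaled' (ev n) (snd z) * mode n (fst z)"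
        and g = "\<lambda>s. (x, s)" and Y = "{s/2 .. 2 * s}"] F'_series_uniform[OF sub, of "s/2" "2 * s"] \<open>0 < s\<close>
    by (simp add: case_prod_beta')
  show ?thesis unfolding sol_def[abs_def] sol'_def
  proof (rule has_field_derivative_series'(2)[where f = "\<lambda>n s. F (ev n * s powr \<beta>) * mode n x"
        and f' = "\<lambda>n s. F_scaled' (ev n) s * mode n x", OF convex_closed_interval _ conv])
    show "((\<lambda>s. F (ev n * s powr \<beta>) * mode n x) has_real_derivative F_scaled' (ev n) r * mode n x) (at r within {s/2 .. 2 * s})"
      if "r \<in> {s/2 .. 2 * s}" for n r
      using F_scaled_regular[of r "ev n"] that \<open>0 < s\<close>
      by (intro has_field_derivative_at_within[OF DERIV_cmult_right]) (auto simp: caputo_regular_def)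
    show "summable (\<lambda>n. F (ev n * s powr \<beta>) * mode n x)"
      using F_series_abs_summable[OF assms] by (rule summable_rabs_cancel)
  qed (use \<open>0 < s\<close> in auto)
qed

lemma sol_continuous:
  assumes "x \<in> state_space P"
  shows "continuous_on {0..} (sol x)"
proof (rule uniform_limit_theorem)
  have sub: "{x..x} \<subseteq> state_space P" using assms by simp
  show "uniform_limit {0..} (\<lambda>N s. \<Sum>n<N. F (ev n * s powr \<beta>) * mode n x) (sol x) sequentially"
    using uniform_limit_compose'[OF F_series_uniform_limit[OF sub], of "\<lambda>s. (x, s)" "{0..}"] by simp
  show "\<forall>\<^sub>F N in sequentially. continuous_on {0..} (\<lambda>s. \<Sum>n<N. F (ev n * s powr \<beta>) * mode n x)"
    using beta_pos
    by (intro always_eventually allI continuous_intros continuous_on_powser_compose entire_ks_coeff continuous_on_powr') auto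
qed auto

lemma sol_regular:
  assumes x: "x \<in> state_space P" and "0 < t"
  shows "caputo_regular t (sol x) (sol' x)"
  unfolding caputo_regular_def
proof (intro conjI ballI)
  show "continuous_on {0..t} (sol x)" using sol_continuous[OF x] by (rule continuous_on_subset) auto
  show "(sol x has_real_derivative sol' x s) (at s)" if "s \<in> {0<..t}" for s
    using sol_has_derivative[OF x] that by simp
  have sub: "{x..x} \<subseteq> state_space P" using x by simp
  show "continuous_on {t/2..t} (sol' x)"
  proof (rule uniform_limit_theorem)
    show "uniform_limit {t/2..t} (\<lambda>N s. \<Sum>n<N. F_scaled' (ev n) s * mode n x) (sol' x) sequentially"
      using uniform_limit_compose'[OF F'_series_uniform_limit[OF sub, of "t/2" t], of "\<lambda>s. (x, s)" "{t/2..t}"] \<open>0 < t\<close>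
      by simp
    show "\<forall>\<^sub>F N in sequentially. continuous_on {t/2..t} (\<lambda>s. \<Sum>n<N. F_scaled' (ev n) s * mode n x)"
      using F_series_regular[OF \<open>0 < t\<close>] by (simp add: caputo_regular_def)
  qed auto
qed

text \<open>Absorbs the time factor into the polynomial, since \<open>generator_series\<close> is
  about series of polynomials.\<close>

definition sol_poly :: "real \<Rightarrow> nat \<Rightarrow> real poly" where
  "sol_poly t n = smult (F (ev n * t powr \<beta>) * a n) (Q n)"

lemma poly_sol_poly: "poly (sol_poly t n) x = F (ev n * t powr \<beta>) * mode n x"
  by (simp add: sol_poly_def mode_def mult_ac)

lemma generator_sol_poly:
  "x \<in> state_space P \<Longrightarrow> generator P (poly (sol_poly t n)) x = - ev n * F (ev n * t powr \<beta>) * mode n x"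
  by (simp add: sol_poly_def generator_smult generator_Q mode_def mult_ac)

text \<open>The sum of the \<G>-images, named through the time integral before convergence in space
  is known. With \<open>\<beta> - \<alpha> = \<gamma>\<close> it is the fractional derivative of
  \<open>sol x\<close>.\<close>

definition sol_gen :: "real \<Rightarrow> real \<Rightarrow> real" where
  "sol_gen t x = integral {0..t} (\<lambda>s. sol' x s / (t - s) powr \<alpha>) / (Gamma (1 - \<alpha>) * t powr (\<beta> - \<alpha>))"

text \<open>Mode by mode the eigenvalue equations in time and in space agree, so the \<G>-image of a
  partial sum is a multiple of its Caputo integral, and \<open>caputo_uniform_limit\<close> replaces
  the missing decay of \<open>\<lambda>_n * F(\<lambda>_n t^\<beta>)\<close>.\<close>

lemma generator_series_limit:
  assumes sub: "{c..d} \<subseteq> state_space P" and "0 < t"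
  shows "uniform_limit {c..d} (\<lambda>N x. \<Sum>n<N. generator P (poly (sol_poly t n)) x) (sol_gen t) sequentially"
proof -
  define k where "k = Gamma (1 - \<alpha>) * t powr (\<beta> - \<alpha>)"
  have k: "0 < k" using \<open>0 < t\<close> alpha_less by (simp add: k_def)
  let ?I = "\<lambda>N x. integral {0..t} (\<lambda>s. (\<Sum>n<N. F_scaled' (ev n) s * mode n x) / (t - s) powr \<alpha>)"
  have "uniform_limit {c..d} ?I (\<lambda>x. integral {0..t} (\<lambda>s. sol' x s / (t - s) powr \<alpha>)) sequentially"
  proof (rule caputo_uniform_limit[OF alpha_pos alpha_less \<open>0 < t\<close> F_series_regular[OF \<open>0 < t\<close>] sol_regular])
    show "uniform_limit ({c..d} \<times> {0..t}) (\<lambda>N (x, s). \<Sum>n<N. F (ev n * s powr \<beta>) * mode n x) (\<lambda>(x, s). sol x s) sequentially"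
      by (rule uniform_limit_on_subset[OF F_series_uniform_limit[OF sub]]) auto
    show "uniform_limit ({c..d} \<times> {t/2..t}) (\<lambda>N (x, s). \<Sum>n<N. F_scaled' (ev n) s * mode n x) (\<lambda>(x, s). sol' x s) sequentially"
      using \<open>0 < t\<close> by (intro F'_series_uniform_limit[OF sub]) auto
  qed (use sub \<open>0 < t\<close> in auto)
  then have "uniform_limit {c..d} (\<lambda>N x. inverse k * ?I N x)
      (\<lambda>x. inverse k * integral {0..t} (\<lambda>s. sol' x s / (t - s) powr \<alpha>)) sequentially"
    by (rule bounded_linear.uniform_limit[OF bounded_linear_mult_right])
  moreover have "inverse k * ?I N x = (\<Sum>n<N. generator P (poly (sol_poly t n)) x)" if "x \<in> {c..d}" for N x
  proof -
    have "?I N x = integral {0..t} (\<lambda>s. \<Sum>n<N. F_scaled' (ev n) s / (t - s) powr \<alpha> * mode n x)"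
      by (simp add: sum_divide_distrib)
    also have "\<dots> = (\<Sum>n<N. integral {0..t} (\<lambda>s. F_scaled' (ev n) s / (t - s) powr \<alpha> * mode n x))"
      by (intro integral_sum integrable_on_mult_left caputo_integrable[OF alpha_pos alpha_less \<open>0 < t\<close> F_scaled_regular[OF \<open>0 < t\<close>]]) auto
    also have "\<dots> = (\<Sum>n<N. k * (- ev n * F (ev n * t powr \<beta>)) * mode n x)"
      by (simp only: integral_mult_left F_scaled_caputo[OF \<open>0 < t\<close>] k_def)
    also have "\<dots> = (\<Sum>n<N. k * generator P (poly (sol_poly t n)) x)"
      using that sub by (intro sum.cong refl) (auto simp: generator_sol_poly)
    finally show ?thesis using k by (simp add: sum_distrib_left[symmetric])
  qed
  ultimately show ?thesis
    by (subst (asm) uniform_limit_cong'[where i = "sol_gen t" and g = "\<lambda>N x. \<Sum>n<N. generator P (poly (sol_poly t n)) x"])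
       (auto simp: sol_gen_def k_def field_simps)
qed

lemma sol_space_regular:
  assumes "0 < t"
  shows "fokker_planck_defined P (\<lambda>x. stat_density P x * sol x t)"
    and "x \<in> state_space P \<Longrightarrow> fokker_planck P (\<lambda>x. stat_density P x * sol x t) x = stat_density P x * sol_gen t x"
proof -
  have U: "uniformly_convergent_on {c..d} (\<lambda>N x. \<Sum>n<N. poly (sol_poly t n) x)" if "{c..d} \<subseteq> state_space P" for c d
  proof -
    have "uniform_limit {c..d} (\<lambda>N x. \<Sum>n<N. F (ev n * t powr \<beta>) * mode n x) (\<lambda>x. sol x t) sequentially"
      using uniform_limit_compose'[OF F_series_uniform_limit[OF that], of "\<lambda>x. (x, t)" "{c..d}"] assms by auto
    then show ?thesis unfolding poly_sol_poly by (auto simp: uniformly_convergent_on_def)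
  qed
  have G: "uniformly_convergent_on {c..d} (\<lambda>N x. \<Sum>n<N. generator P (poly (sol_poly t n)) x)"
    if "{c..d} \<subseteq> state_space P" for c d
    using generator_series_limit[OF that assms] by (auto simp: uniformly_convergent_on_def)
  have sol_eq: "(\<lambda>x. \<Sum>n. poly (sol_poly t n) x) = (\<lambda>x. sol x t)" by (simp add: poly_sol_poly sol_def)
  have w_eq: "(\<Sum>n. generator P (poly (sol_poly t n)) x) = sol_gen t x" if "x \<in> state_space P" for x
    using sums_unique[OF uniform_limit_sums[OF generator_series_limit[of x x t]], of x] that assms by simp
  note ser = generator_series[OF params _ U G]
  have 1: "((\<lambda>x. sol x t) has_real_derivative (\<Sum>n. poly (pderiv (sol_poly t n)) x)) (at x)" if "x \<in> state_space P" for x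
    using ser(1)[OF that] unfolding sol_eq by simp
  have 2: "((\<lambda>x. diffusion P x * stat_density P x * (\<Sum>n. poly (pderiv (sol_poly t n)) x)) has_real_derivative
      stat_density P x * sol_gen t x) (at x)" if "x \<in> state_space P" for x
    using ser(2)[OF that] by (simp add: w_eq[OF that])
  show "fokker_planck_defined P (\<lambda>x. stat_density P x * sol x t)"
    by (rule fokker_planck_density_times(1)[OF params 1 2])
  show "x \<in> state_space P \<Longrightarrow> fokker_planck P (\<lambda>x. stat_density P x * sol x t) x = stat_density P x * sol_gen t x"
    by (rule fokker_planck_density_times(2)[OF params 1 2])
qed

lemma frac_integrand_has_integral:
  assumes x: "x \<in> state_space P" and "0 < t"
  shows "(frac_integrand \<alpha> (\<lambda>s. c * sol x s) t has_integral
    c * integral {0..t} (\<lambda>s. sol' x s / (t - s) powr \<alpha>)) {0..t}"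
proof (rule has_integral_spike_finite)
  show "((\<lambda>s. c * (sol' x s / (t - s) powr \<alpha>)) has_integral
      c * integral {0..t} (\<lambda>s. sol' x s / (t - s) powr \<alpha>)) {0..t}"
    by (intro has_integral_mult_right integrable_integral
        caputo_integrable[OF alpha_pos alpha_less \<open>0 < t\<close> sol_regular[OF assms]])
  \<comment> \<open>At \<open>s = 0\<close> the value of \<open>deriv\<close> is not known to be
    \<open>c * sol' x 0\<close>; a single point does not affect the integral.\<close>
  show "frac_integrand \<alpha> (\<lambda>s. c * sol x s) t s = c * (sol' x s / (t - s) powr \<alpha>)" if "s \<in> {0..t} - {0}" for s
    using DERIV_imp_deriv[OF DERIV_cmult[OF sol_has_derivative[OF x], of s c]] that
    by (simp add: frac_integrand_def)
qed simp

lemma frac_deriv_defined_sol: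
  assumes "x \<in> state_space P"
  shows "frac_deriv_defined \<alpha> (\<lambda>t. c * sol x t)"
  unfolding frac_deriv_defined_def
proof (intro conjI allI impI)
  show "continuous_on {0..} (\<lambda>t. c * sol x t)" using sol_continuous[OF assms] by (intro continuous_intros)
  show "(\<lambda>t. c * sol x t) differentiable at t" if "0 < t" for t
    using DERIV_cmult[OF sol_has_derivative[OF assms that]] by (auto simp: real_differentiable_def)
  show "frac_integrand \<alpha> (\<lambda>t. c * sol x t) t integrable_on {0..t}" if "0 < t" for t
    using frac_integrand_has_integral[OF assms that] by blast
qed

lemma frac_deriv_sol:
  assumes "x \<in> state_space P" "0 < t"
  shows "frac_deriv \<alpha> (\<beta> - \<alpha>) (\<lambda>s. c * sol x s) t = c * sol_gen t x"
  unfolding frac_deriv_def sol_gen_def powr_minus integral_unique[OF frac_integrand_has_integral[OF assms]]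
  by (simp add: divide_inverse)

lemma sol_0:
  assumes "x \<in> state_space P"
  shows "sol x 0 = H x"
proof -
  have "(\<lambda>n. a n * poly (Q n) x) sums H x"
    using uniform_limit_sums[OF initial[of x x], of x] assms by simp
  then show ?thesis by (simp add: sol_def mode_def ks_coeff_0 sums_iff mult.commute)
qed

end

text \<open>For \<open>m = 1 + \<gamma>/\<alpha>\<close> and \<open>l = \<gamma>/\<alpha>\<close>
  the argument \<open>\<alpha> * (k * m + l)\<close> equals
  \<open>(k + 1) * (\<alpha> + \<gamma>) - \<alpha>\<close>, so each Gamma quotient is
  \<open>1 / \<rho> (Suc k)\<close>; the sign of \<open>-z\<close> goes into the
  coefficients.\<close>

lemma kilbas_saigo_eq_powser:
  assumes "kilbas_saigo_range \<alpha> (\<alpha> + \<gamma>)"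
  shows "kilbas_saigo \<alpha> (1 + \<gamma> / \<alpha>) (\<gamma> / \<alpha>) (- z) = powser (kilbas_saigo_range.ks_coeff \<alpha> (\<alpha> + \<gamma>)) z"
proof -
  interpret kilbas_saigo_range \<alpha> "\<alpha> + \<gamma>" by fact
  have factor: "Gamma (1 + \<alpha> * (real k * (1 + \<gamma> / \<alpha>) + \<gamma> / \<alpha>)) / Gamma (1 + \<alpha> * (real k * (1 + \<gamma> / \<alpha>) + \<gamma> / \<alpha> + 1))
      = 1 / \<rho> (Suc k)" for k
  proof -
    have "1 + \<alpha> * (real k * (1 + \<gamma> / \<alpha>) + \<gamma> / \<alpha>) = 1 + real (Suc k) * (\<alpha> + \<gamma>) - \<alpha>"
      "1 + \<alpha> * (real k * (1 + \<gamma> / \<alpha>) + \<gamma> / \<alpha> + 1) = 1 + real (Suc k) * (\<alpha> + \<gamma>)"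
      using alpha_pos by (simp_all add: field_simps)
    then show ?thesis by (simp only: \<rho>_def divide_divide_eq_right mult_1)
  qed
  have "kilbas_saigo_coeff \<alpha> (1 + \<gamma> / \<alpha>) (\<gamma> / \<alpha>) n * (- z) ^ n = ks_coeff n * z ^ n" for n
    unfolding kilbas_saigo_coeff_def factor by (simp add: ks_coeff_def prod_dividef power_minus[of z])
  then show ?thesis by (simp add: kilbas_saigo_def powser_def)
qed

theorem theorem4p3:
  fixes \<alpha> \<gamma> :: real and P :: pearson and Q :: "nat \<Rightarrow> real poly" and h :: "real \<Rightarrow> real"
  assumes "0 < \<alpha>" and "\<alpha> < 1" and "0 \<le> \<gamma>" and "0 < \<alpha> + \<gamma>" and "\<alpha> + \<gamma> \<le> 1"
    and "pearson_params P"
    and "orthonormal_polys P Q"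
    and "in_L2 P (\<lambda>x. h x / stat_density P x)"
    and "\<And>u v. {u..v} \<subseteq> state_space P \<Longrightarrow>
           uniform_limit {u..v} (\<lambda>N x. \<Sum>n<N. fp_coeff P Q h n * poly (Q n) x)
             (\<lambda>x. h x / stat_density P x) sequentially"
  shows "strong_solution \<alpha> \<gamma> P h (sol_series \<alpha> \<gamma> P Q h) \<and>
    (\<forall>t>0. \<forall>x\<in>state_space P. summable (\<lambda>n. \<bar>sol_term \<alpha> \<gamma> P Q h t x n\<bar>))"
proof -
  have params: "pearson_params P" by fact
  interpret ks: kilbas_saigo_range \<alpha> "\<alpha> + \<gamma>"
    using assms(1-3) by unfold_locales auto
  interpret ps: pearson_system P Q
    using assms(6,7) by unfold_locales
  \<comment> \<open>The problem is divided by the stationary density: \<open>sol\<close> represents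
    \<open>g / m\<close>, with initial value \<open>h / m\<close>.\<close>
  interpret fractional_pearson \<alpha> "\<alpha> + \<gamma>" P Q "fp_coeff P Q h" "\<lambda>x. h x / stat_density P x"
    using ps.fp_coeff_square_summable[OF assms(8)] assms(9) by unfold_locales
  have term_eq: "sol_term \<alpha> \<gamma> P Q h t x n = ks.F (ev n * t powr (\<alpha> + \<gamma>)) * mode n x" for t x n
    using kilbas_saigo_eq_powser[OF ks.kilbas_saigo_range_axioms, of "ev n * t powr (\<alpha> + \<gamma>)"]
    by (simp add: sol_term_def mode_def)
  have series_eq: "sol_series \<alpha> \<gamma> P Q h t x = stat_density P x * sol x t" for t x
    by (simp add: sol_series_def term_eq sol_def)
  have "frac_deriv \<alpha> \<gamma> (\<lambda>s. stat_density P x * sol x s) t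
      = fokker_planck P (\<lambda>x. stat_density P x * sol x t) x"
    if "0 < t" "x \<in> state_space P" for t x
    using frac_deriv_sol[OF that(2,1), of "stat_density P x"] sol_space_regular(2)[OF that] by simp
  moreover have "sol_series \<alpha> \<gamma> P Q h 0 x = h x" if "x \<in> state_space P" for x
    using sol_0[OF that] stat_density_pos[OF params that] by (simp add: series_eq)
  ultimately have "strong_solution \<alpha> \<gamma> P h (sol_series \<alpha> \<gamma> P Q h)"
    using frac_deriv_defined_sol sol_space_regular(1)
    by (simp add: strong_solution_def series_eq[abs_def])
  then show ?thesis using F_series_abs_summable by (simp add: term_eq)
qed

end
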